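(* Let $K$ be a field of characteristic $0$, $H$ a Hopf algebra over $K$, $(R,\xi)$ a pre-bialgebra with cocycle in ${}_H^H\mathcal{YD}$, let $(A=R\#_\xi H,H,\pi,\sigma)$ be the associated splitting datum, and let $\gamma\in Z_H^2(A,K)$. Let $\gamma_R:R\otimes R\to K$, $\gamma_R(r\otimes s)=\gamma(r\#1_H\otimes s\#1_H)$, with convolution inverse $\gamma_R^{-1}$, and define $\xi_{\gamma_R}:R\otimes R\to H$ by $$\xi_{\gamma_R}=u_H\gamma_R*\xi*(H\otimes\gamma_R^{-1})\rho_{R\otimes R}.$$ Let $\theta:R\otimes K\to R$ be the canonical isomorphism $\theta(r\otimes 1)=r$. Then: (1) $(A^\gamma,H,\pi,\sigma)$ is a splitting datum whose associated pre-bialgebra with cocycle is $(R\otimes K,\ \xi_{\gamma_R}(\theta\otimes\theta))$. (2) $(R^{\gamma_R},\xi_{\gamma_R})$ is a pre-bialgebra with cocycle in ${}_H^H\mathcal{YD}$, isomorphic via $\theta$ to the pre-bialgebra with cocycle $(R\otimes K,\xi_{\gamma_R}(\theta\otimes\theta))$ of (1). (3) $A^\gamma=(R\#_\xi H)^\gamma=R^{\gamma_R}\#_{\xi_{\gamma_R}}H$ (as bialgebras, on the common underlying vector space $R\otimes H$).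
   Context: Yetter-Drinfeld conventions. ${}_H^H\mathcal{YD}$ is the category of left-left Yetter-Drinfeld modules over $H$: left $H$-modules (action written $hv$) and left $H$-comodules ($\rho(v)=v_{\langle -1\rangle}\otimes v_{\langle 0\rangle}$) with $\rho(hv)=h_{(1)}v_{\langle -1\rangle}S(h_{(3)})\otimes h_{(2)}v_{\langle 0\rangle}$. Tensor products carry the diagonal action and codiagonal coaction ($\rho_{R\otimes R}(r\otimes s)=r_{\langle-1\rangle}s_{\langle-1\rangle}\otimes r_{\langle0\rangle}\otimes s_{\langle0\rangle}$); the braiding is $c_{V,W}(v\otimes w)=v_{\langle -1\rangle}w\otimes v_{\langle 0\rangle}$. For a coalgebra $C$ in ${}_H^H\mathcal{YD}$ write $\Delta_C(x)=x^{(1)}\otimes x^{(2)}$. For coalgebras $C,D$ in ${}_H^H\mathcal{YD}$, $C\otimes D$ is a coalgebra in ${}_H^H\mathcal{YD}$ with counit $\varepsilon_C\otimes\varepsilon_D$ and $\Delta_{C\otimes D}(x\otimes y)=(x^{(1)}\otimes x^{(2)}_{\langle -1\rangle}y^{(1)})\otimes(x^{(2)}_{\langle 0\rangle}\otimes y^{(2)})$. Convolution $*$ of maps on $R\otimes R$ is taken with respect to $\Delta_{R\otimes R}$. A coaugmented coalgebra in ${}_H^H\mathcal{YD}$ is one with a map $u_C:K\to C$ such that $1_C=u_C(1)$ is grouplike, $h1_C=\varepsilon_H(h)1_C$ and $\rho(1_C)=1_H\otimes 1_C$. Pre-bialgebra with cocycle. A pre-bialgebra $R=(R,m_R,u_R,\Delta_R,\varepsilon_R)$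 in ${}_H^H\mathcal{YD}$ is a coaugmented coalgebra in ${}_H^H\mathcal{YD}$ with a left $H$-linear map $m_R:R\otimes R\to R$ that is a coalgebra homomorphism, $\Delta_Rm_R=(m_R\otimes m_R)\Delta_{R\otimes R}$, $\varepsilon_Rm_R=\varepsilon_R\otimes\varepsilon_R$, and for which $1_R$ is a two-sided unit ($m_R$ need be neither associative nor $H$-colinear). A pre-bialgebra with cocycle $(R,\xi)$ is a pre-bialgebra $R$ with a linear map $\xi:R\otimes R\to H$ such that, for all $h\in H$, $r,s,t\in R$, and $z\in R\otimes R$ (with $\Delta_{R\otimes R}(z)=z^{(1)}\otimes z^{(2)}$): (a) $\xi(z)_{(1)}\otimes\xi(z)_{(2)}=\xi(z^{(1)})z^{(2)}_{\langle -1\rangle}\otimes\xi(z^{(2)}_{\langle 0\rangle})$ and $\varepsilon_H\xi=\varepsilon_R\otimes\varepsilon_R$; (b) $\xi(hz)=h_{(1)}\xi(z)S(h_{(2)})$; (c) $m_R(z^{(1)})_{\langle -1\rangle}\,\xi(z^{(2)})\otimes m_R(z^{(1)})_{\langle 0\rangle}=\xi(z^{(1)})z^{(2)}_{\langle -1\rangle}\otimes m_R(z^{(2)}_{\langle 0\rangle})$; (d) $m_R(r\otimes m_R(s\otimes t))=m_R\big(m_R(z^{(1)})\otimes\xi(z^{(2)})t\big)$ with $z=r\otimes s$; (e) $\xi(r\otimes m_R(w^{(1)}))\,\xi(w^{(2)})=\xi\big(m_R(z^{(1)})\otimes\xi(z^{(2)})_{(1)}t\big)\,\xi(z^{(2)})_{(2)}$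 with $w=s\otimes t$, $z=r\otimes s$; (f) $\xi(r\otimes 1_R)=\xi(1_R\otimes r)=\varepsilon_R(r)1_H$. A morphism $(R,\xi)\to(R',\xi')$ is a coalgebra homomorphism $f$ in ${}_H^H\mathcal{YD}$ with $fm=m'(f\otimes f)$, $fu=u'$, $\xi'(f\otimes f)=\xi$. Splitting data. A splitting datum $(A,H,\pi,\sigma)$ consists of a bialgebra $A$, a bialgebra homomorphism $\sigma:H\to A$ and a coalgebra homomorphism $\pi:A\to H$ with $\pi\sigma=\mathrm{Id}_H$ and $\pi(\sigma(h)x\sigma(h'))=h\pi(x)h'$. The pre-bialgebra with cocycle associated to it is $(R,\xi)$ with $R=A^{co\pi}=\{a\in A: a_{(1)}\otimes\pi(a_{(2)})=a\otimes 1_H\}$, action $h\cdot r=\sigma(h_{(1)})r\sigma S(h_{(2)})$, coaction $\rho(r)=\pi(r_{(1)})\otimes r_{(2)}$, $\Delta_R(r)=\tau(r_{(1)})\otimes r_{(2)}$, $\varepsilon_R=\varepsilon_A|_R$, where $\tau:A\to R$, $\tau(a)=a_{(1)}\sigma S\pi(a_{(2)})$; unit $1_A$, multiplication $m_R(r\otimes s)=\tau(r\cdot_As)$, and cocycle $\xi(r\otimes s)=\pi(r\cdot_As)$. The splitting datum associated to $(R,\xi)$. $A=R\#_\xi H$ is the bialgebra with underlying space $R\otimes H$ (elements $r\#h$), unit $1_R\#1_H$, counit $\varepsilon_R\otimes\varepsilon_H$, $\Delta_A(r\#h)=r^{(1)}\#r^{(2)}_{\langle -1\rangle}h_{(1)}\otimes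 r^{(2)}_{\langle 0\rangle}\#h_{(2)}$, and multiplication $(r\#h)(s\#h')=m_R\big(r^{(1)}\otimes r^{(2)}_{\langle -1\rangle}(h_{(1)}s)^{(1)}\big)\#\xi\big(r^{(2)}_{\langle 0\rangle}\otimes(h_{(1)}s)^{(2)}\big)h_{(2)}h'$, together with $\sigma(h)=1_R\#h$, $\pi(r\#h)=\varepsilon_R(r)h$. Its coinvariants are $R\otimes K$ (that is, $R\otimes K1_H$). Cocycles and twists. $Z_H^2(A,K)$ is the set of convolution invertible linear maps $\gamma:A\otimes A\to K$ with $\gamma(y_{(1)}\otimes z_{(1)})\gamma(x\otimes y_{(2)}z_{(2)})=\gamma(x_{(1)}\otimes y_{(1)})\gamma(x_{(2)}y_{(2)}\otimes z)$, $\gamma(x\otimes 1)=\gamma(1\otimes x)=\varepsilon_A(x)$, and $\gamma(\sigma(h)a\otimes a'\sigma(h'))=\varepsilon_H(h)\gamma(a\otimes a')\varepsilon_H(h')$. $A^\gamma$ is the bialgebra equal to $A$ as a coalgebra, with the same unit and product $x\cdot_\gamma y=\gamma(x_{(1)}\otimes y_{(1)})x_{(2)}y_{(2)}\gamma^{-1}(x_{(3)}\otimes y_{(3)})$. For a convolution invertible $\upsilon:R\otimes R\to K$ (such as $\gamma_R$), $R^\upsilon$ denotes the coalgebra $R$ in ${}_H^H\mathcal{YD}$ with unit $u_R$ and multiplication $m_{R^\upsilon}=(\upsilon\otimes m_R\otimes\upsilon^{-1})\Delta^2_{R\otimes R}$, where $\Delta^2_{R\otimes R}$ is the twice-iterated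 comultiplication. *)

theory Defs
  imports Main "HOL.Vector_Spaces"
begin

section \<open>Tensor products\<close>

text \<open>
  A vector space over the field \<open>'k\<close> is a subspace \<open>carr V\<close> of an ambient vector space, the latter
  being a whole type with scalar multiplication \<open>scl V\<close>. Carriers are needed because coinvariants
  and tensor products are proper subspaces of their ambient types. Maps between vector spaces are
  only meaningful on carriers.
\<close>

record ('k, 'v) vspace =
  carr :: "'v set"
  scl :: "'k \<Rightarrow> 'v \<Rightarrow> 'v"

definition vspace :: "('k::field, 'v::ab_group_add, 'z) vspace_scheme \<Rightarrow> bool" where
  "vspace V \<longleftrightarrow> vector_space (scl V) \<and> module.subspace (scl V) (carr V)"

definition lin :: "('k::field, 'v::ab_group_add, 'z) vspace_scheme \<Rightarrow>
    ('k, 'w::ab_group_add, 'y) vspace_scheme \<Rightarrow> ('v \<Rightarrow> 'w) \<Rightarrow> bool" where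
  "lin V W f \<longleftrightarrow> (\<forall>x\<in>carr V. f x \<in> carr W) \<and>
     (\<forall>x\<in>carr V. \<forall>y\<in>carr V. f (x + y) = f x + f y) \<and>
     (\<forall>c. \<forall>x\<in>carr V. f (scl V c x) = scl W c (f x))"

definition bilin :: "('k::field, 'v::ab_group_add, 'z) vspace_scheme \<Rightarrow>
    ('k, 'w::ab_group_add, 'y) vspace_scheme \<Rightarrow> ('k, 'u::ab_group_add, 'x) vspace_scheme \<Rightarrow>
    ('v \<Rightarrow> 'w \<Rightarrow> 'u) \<Rightarrow> bool" where
  "bilin V W U f \<longleftrightarrow> (\<forall>w\<in>carr W. lin V U (\<lambda>v. f v w)) \<and> (\<forall>v\<in>carr V. lin W U (f v))"

definition Kspace :: "('k::field, 'k) vspace" where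
  "Kspace = \<lparr>carr = UNIV, scl = (*)\<rparr>"

definition ambient :: "('k::field, 'v::ab_group_add, 'z) vspace_scheme \<Rightarrow> ('k, 'v) vspace" where
  "ambient V = \<lparr>carr = UNIV, scl = scl V\<rparr>"

text \<open>
  The tensor product is realised inside the dual of the space of bilinear forms: \<open>v \<otimes> w\<close> is
  evaluation at \<open>(v, w)\<close>. Only bilinear forms on the ambient spaces are tested, so \<open>tens V W\<close>
  depends on \<open>V\<close>, \<open>W\<close> only through their scalar multiplications; thus for subspaces
  \<open>V' \<subseteq> V\<close>, \<open>W' \<subseteq> W\<close> the space \<open>V' \<otimes> W'\<close> is literally contained in \<open>V \<otimes> W\<close>.
\<close>

typedef ('k, 'v, 'w) tensor = "UNIV :: (('v \<Rightarrow> 'w \<Rightarrow> 'k) \<Rightarrow> 'k) set"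
  by simp

setup_lifting type_definition_tensor

instantiation tensor :: (ab_group_add, type, type) ab_group_add
begin

lift_definition zero_tensor :: "('a, 'b, 'c) tensor" is "\<lambda>_. 0" .
lift_definition plus_tensor :: "('a, 'b, 'c) tensor \<Rightarrow> ('a, 'b, 'c) tensor \<Rightarrow> ('a, 'b, 'c) tensor"
  is "\<lambda>s t b. s b + t b" .
lift_definition minus_tensor :: "('a, 'b, 'c) tensor \<Rightarrow> ('a, 'b, 'c) tensor \<Rightarrow> ('a, 'b, 'c) tensor"
  is "\<lambda>s t b. s b - t b" .
lift_definition uminus_tensor :: "('a, 'b, 'c) tensor \<Rightarrow> ('a, 'b, 'c) tensor"
  is "\<lambda>t b. - t b" .

instance
  by standard (transfer, simp add: fun_eq_iff algebra_simps)+

end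

lift_definition tscale :: "'k::field \<Rightarrow> ('k, 'v, 'w) tensor \<Rightarrow> ('k, 'v, 'w) tensor"
  is "\<lambda>c t b. c * t b" .

lift_definition tens :: "('k::field, 'v::ab_group_add, 'z) vspace_scheme \<Rightarrow>
    ('k, 'w::ab_group_add, 'y) vspace_scheme \<Rightarrow> 'v \<Rightarrow> 'w \<Rightarrow> ('k, 'v, 'w) tensor"
  is "\<lambda>V W v w b. if bilin (ambient V) (ambient W) Kspace b then b v w else 0" .

definition tprod :: "('k::field, 'v::ab_group_add, 'z) vspace_scheme \<Rightarrow>
    ('k, 'w::ab_group_add, 'y) vspace_scheme \<Rightarrow> ('k, ('k, 'v, 'w) tensor) vspace" where
  "tprod V W = \<lparr>carr = module.span tscale {tens V W v w | v w. v \<in> carr V \<and> w \<in> carr W},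
                scl = tscale\<rparr>"

text \<open>
  Sweedler notation: if \<open>t = \<Sum>\<^sub>i v\<^sub>i \<otimes> w\<^sub>i\<close> in \<open>V \<otimes> W\<close> and \<open>f\<close> is bilinear on \<open>V \<times> W\<close>, then
  \<open>sw V W t f = \<Sum>\<^sub>i f v\<^sub>i w\<^sub>i\<close>. Lemma \<open>sw_eq\<close> below states that the choice of
  representation does not matter.
\<close>

definition sw :: "('k::field, 'v::ab_group_add, 'z) vspace_scheme \<Rightarrow>
    ('k, 'w::ab_group_add, 'y) vspace_scheme \<Rightarrow> ('k, 'v, 'w) tensor \<Rightarrow>
    ('v \<Rightarrow> 'w \<Rightarrow> 'u::ab_group_add) \<Rightarrow> 'u" where
  "sw V W t f =
     (let xs = (SOME xs. set xs \<subseteq> carr V \<times> carr W \<and> (\<Sum>(v, w)\<leftarrow>xs. tens V W v w) = t)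
      in \<Sum>(v, w)\<leftarrow>xs. f v w)"

lemma separating_functional:
  fixes s :: "'k::field \<Rightarrow> 'u::ab_group_add \<Rightarrow> 'u"
  assumes "vector_space s" and "u \<noteq> 0"
  shows "\<exists>g. Vector_Spaces.linear s (*) g \<and> g u \<noteq> 0"
proof -
  interpret vector_space s by fact
  have ind: "independent {u}" using assms(2) by simp
  let ?B = "extend_basis {u}"
  have B: "independent ?B" "span ?B = UNIV" "{u} \<subseteq> ?B"
    using independent_extend_basis[OF ind] span_extend_basis[OF ind] extend_basis_superset[OF ind]
    by auto
  have "representation ?B u u = 1"
    using representation_basis[OF B(1)] B(3) by simp
  with linear_representation[OF B(1,2), of u] show ?thesis by fastforce
qed

lemma subspace_projection:
  fixes s :: "'k::field \<Rightarrow> 'v::ab_group_add \<Rightarrow> 'v"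
  assumes "vector_space s" and "module.subspace s S"
  shows "\<exists>p. Vector_Spaces.linear s s p \<and> range p \<subseteq> S \<and> (\<forall>x\<in>S. p x = x)"
proof -
  interpret vector_space s by fact
  interpret vector_space_pair s s by unfold_locales
  show ?thesis
    using linear_exists_left_inverse_on[of "\<lambda>x. x" S] assms(2) linear_ident by auto
qed

lemma linear_sum_list:
  assumes "Vector_Spaces.linear s t g"
  shows "g (\<Sum>x\<leftarrow>xs. F x) = (\<Sum>x\<leftarrow>xs. g (F x))"
proof -
  interpret Vector_Spaces.linear s t g by fact
  show ?thesis by (induction xs) (simp_all add: add zero)
qed

lemma tens_sum_eq:
  fixes V :: "('k::field, 'v::ab_group_add, 'z) vspace_scheme"
    and W :: "('k, 'w::ab_group_add, 'y) vspace_scheme"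
    and U :: "('k, 'u::ab_group_add, 'x) vspace_scheme"
  assumes V: "vspace V" and W: "vspace W" and U: "vspace U" and f: "bilin V W U f"
    and xs: "set xs \<subseteq> carr V \<times> carr W" and ys: "set ys \<subseteq> carr V \<times> carr W"
    and eq: "(\<Sum>(v, w)\<leftarrow>xs. tens V W v w) = (\<Sum>(v, w)\<leftarrow>ys. tens V W v w)"
  shows "(\<Sum>(v, w)\<leftarrow>xs. f v w) = (\<Sum>(v, w)\<leftarrow>ys. f v w)"
proof (rule ccontr)
  assume ne: "(\<Sum>(v, w)\<leftarrow>xs. f v w) \<noteq> (\<Sum>(v, w)\<leftarrow>ys. f v w)"
  have U': "vector_space (scl U)" using U by (simp add: vspace_def)
  obtain g where g: "Vector_Spaces.linear (scl U) (*) g"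
    and g0: "g ((\<Sum>(v, w)\<leftarrow>xs. f v w) - (\<Sum>(v, w)\<leftarrow>ys. f v w)) \<noteq> 0"
    using separating_functional[OF U'] ne by (metis eq_iff_diff_eq_0)
  interpret g: Vector_Spaces.linear "scl U" "(*)" g by fact
  obtain p where p: "Vector_Spaces.linear (scl V) (scl V) p" "\<And>x. p x \<in> carr V"
      "\<And>x. x \<in> carr V \<Longrightarrow> p x = x"
    using subspace_projection[of "scl V" "carr V"] V unfolding vspace_def by blast
  interpret p: Vector_Spaces.linear "scl V" "scl V" p by fact
  obtain q where q: "Vector_Spaces.linear (scl W) (scl W) q" "\<And>x. q x \<in> carr W"
      "\<And>x. x \<in> carr W \<Longrightarrow> q x = x"
    using subspace_projection[of "scl W" "carr W"] W unfolding vspace_def by blast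
  interpret q: Vector_Spaces.linear "scl W" "scl W" q by fact
  define b where "b = (\<lambda>v w. g (f (p v) (q w)))"
  have b: "bilin (ambient V) (ambient W) Kspace b"
    using f p(2) q(2)
    by (auto simp: bilin_def lin_def ambient_def Kspace_def b_def p.add p.scale q.add q.scale
        g.add g.scale)
  have "(\<Sum>(v, w)\<leftarrow>zs. g (f v w)) = Rep_tensor (\<Sum>(v, w)\<leftarrow>zs. tens V W v w) b"
    if "set zs \<subseteq> carr V \<times> carr W" for zs
    using that
    by (induction zs)
      (auto simp: zero_tensor.rep_eq plus_tensor.rep_eq tens.rep_eq b[unfolded b_def] b_def p(3) q(3))
  then have "(\<Sum>(v, w)\<leftarrow>xs. g (f v w)) = (\<Sum>(v, w)\<leftarrow>ys. g (f v w))"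
    using xs ys eq by simp
  moreover have "g (\<Sum>(v, w)\<leftarrow>zs. f v w) = (\<Sum>(v, w)\<leftarrow>zs. g (f v w))" for zs
    using linear_sum_list[OF g, of "\<lambda>(v, w). f v w" zs] by (simp add: case_prod_unfold)
  ultimately show False using g0 by (simp add: g.diff)
qed

lemma sw_eq:
  fixes V :: "('k::field, 'v::ab_group_add, 'z) vspace_scheme"
    and W :: "('k, 'w::ab_group_add, 'y) vspace_scheme"
    and U :: "('k, 'u::ab_group_add, 'x) vspace_scheme"
  assumes V: "vspace V" and W: "vspace W" and U: "vspace U" and f: "bilin V W U f"
    and xs: "set xs \<subseteq> carr V \<times> carr W"
  shows "sw V W (\<Sum>(v, w)\<leftarrow>xs. tens V W v w) f = (\<Sum>(v, w)\<leftarrow>xs. f v w)"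
proof -
  let ?P = "\<lambda>ys. set ys \<subseteq> carr V \<times> carr W \<and>
    (\<Sum>(v, w)\<leftarrow>ys. tens V W v w) = (\<Sum>(v, w)\<leftarrow>xs. tens V W v w)"
  have "?P (SOME ys. ?P ys)"
    by (rule someI[of ?P xs]) (use xs in simp)
  then show ?thesis
    unfolding sw_def Let_def using tens_sum_eq[OF V W U f _ xs] by blast
qed


section \<open>Coalgebras, bialgebras, Hopf algebras\<close>

record ('k, 'c) coalg = "('k, 'c) vspace" +
  cop :: "'c \<Rightarrow> ('k, 'c, 'c) tensor"  (\<open>\<Delta>\<index>\<close>)
  cou :: "'c \<Rightarrow> 'k"  (\<open>\<epsilon>\<index>\<close>)

record ('k, 'a) bialg = "('k, 'a) coalg" +
  mul :: "'a \<Rightarrow> 'a \<Rightarrow> 'a"  (infixl \<open>\<cdot>\<index>\<close> 70)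
  unt :: "'a"  (\<open>\<one>\<index>\<close>)

record ('k, 'h) hopf = "('k, 'h) bialg" +
  antip :: "'h \<Rightarrow> 'h"  (\<open>\<S>\<index>\<close>)

definition coalgebra :: "('k::field, 'c::ab_group_add, 'z) coalg_scheme \<Rightarrow> bool" where
  "coalgebra C \<longleftrightarrow> vspace C \<and> lin C (tprod C C) (\<Delta>\<^bsub>C\<^esub>) \<and> lin C Kspace (\<epsilon>\<^bsub>C\<^esub>) \<and>
     (\<forall>x\<in>carr C.
        sw C C (\<Delta>\<^bsub>C\<^esub> x) (\<lambda>a b. sw C C (\<Delta>\<^bsub>C\<^esub> a) (\<lambda>c d. tens C (tprod C C) c (tens C C d b)))
          = sw C C (\<Delta>\<^bsub>C\<^esub> x) (\<lambda>a b. tens C (tprod C C) a (\<Delta>\<^bsub>C\<^esub> b)) \<and>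
        sw C C (\<Delta>\<^bsub>C\<^esub> x) (\<lambda>a b. scl C (\<epsilon>\<^bsub>C\<^esub> a) b) = x \<and>
        sw C C (\<Delta>\<^bsub>C\<^esub> x) (\<lambda>a b. scl C (\<epsilon>\<^bsub>C\<^esub> b) a) = x)"

definition coalg_hom :: "('k::field, 'c::ab_group_add, 'z) coalg_scheme \<Rightarrow>
    ('k, 'd::ab_group_add, 'y) coalg_scheme \<Rightarrow> ('c \<Rightarrow> 'd) \<Rightarrow> bool" where
  "coalg_hom C D f \<longleftrightarrow> lin C D f \<and>
     (\<forall>x\<in>carr C. \<Delta>\<^bsub>D\<^esub> (f x) = sw C C (\<Delta>\<^bsub>C\<^esub> x) (\<lambda>a b. tens D D (f a) (f b)) \<and>
                 \<epsilon>\<^bsub>D\<^esub> (f x) = \<epsilon>\<^bsub>C\<^esub> x)"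

definition bialgebra :: "('k::field, 'a::ab_group_add, 'z) bialg_scheme \<Rightarrow> bool" where
  "bialgebra A \<longleftrightarrow> coalgebra A \<and> bilin A A A (mul A) \<and> \<one>\<^bsub>A\<^esub> \<in> carr A \<and>
     (\<forall>x\<in>carr A. \<forall>y\<in>carr A. \<forall>z\<in>carr A. (x \<cdot>\<^bsub>A\<^esub> y) \<cdot>\<^bsub>A\<^esub> z = x \<cdot>\<^bsub>A\<^esub> (y \<cdot>\<^bsub>A\<^esub> z)) \<and>
     (\<forall>x\<in>carr A. \<one>\<^bsub>A\<^esub> \<cdot>\<^bsub>A\<^esub> x = x \<and> x \<cdot>\<^bsub>A\<^esub> \<one>\<^bsub>A\<^esub> = x) \<and>
     (\<forall>x\<in>carr A. \<forall>y\<in>carr A.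
        \<Delta>\<^bsub>A\<^esub> (x \<cdot>\<^bsub>A\<^esub> y) = sw A A (\<Delta>\<^bsub>A\<^esub> x) (\<lambda>x1 x2. sw A A (\<Delta>\<^bsub>A\<^esub> y) (\<lambda>y1 y2.
            tens A A (x1 \<cdot>\<^bsub>A\<^esub> y1) (x2 \<cdot>\<^bsub>A\<^esub> y2))) \<and>
        \<epsilon>\<^bsub>A\<^esub> (x \<cdot>\<^bsub>A\<^esub> y) = \<epsilon>\<^bsub>A\<^esub> x * \<epsilon>\<^bsub>A\<^esub> y) \<and>
     \<Delta>\<^bsub>A\<^esub> \<one>\<^bsub>A\<^esub> = tens A A \<one>\<^bsub>A\<^esub> \<one>\<^bsub>A\<^esub> \<and> \<epsilon>\<^bsub>A\<^esub> \<one>\<^bsub>A\<^esub> = 1"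

definition bialg_hom :: "('k::field, 'a::ab_group_add, 'z) bialg_scheme \<Rightarrow>
    ('k, 'b::ab_group_add, 'y) bialg_scheme \<Rightarrow> ('a \<Rightarrow> 'b) \<Rightarrow> bool" where
  "bialg_hom A B f \<longleftrightarrow> coalg_hom A B f \<and> f \<one>\<^bsub>A\<^esub> = \<one>\<^bsub>B\<^esub> \<and>
     (\<forall>x\<in>carr A. \<forall>y\<in>carr A. f (x \<cdot>\<^bsub>A\<^esub> y) = f x \<cdot>\<^bsub>B\<^esub> f y)"

text \<open>Equality of bialgebras; functions on the ambient type are compared on the carrier only.\<close>

definition bialg_eq :: "('k::field, 'a::ab_group_add, 'z) bialg_scheme \<Rightarrow>
    ('k, 'a, 'y) bialg_scheme \<Rightarrow> bool" where
  "bialg_eq A B \<longleftrightarrow> carr A = carr B \<and> \<one>\<^bsub>A\<^esub> = \<one>\<^bsub>B\<^esub> \<and> scl A = scl B \<and>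
     (\<forall>x\<in>carr A. \<Delta>\<^bsub>A\<^esub> x = \<Delta>\<^bsub>B\<^esub> x \<and> \<epsilon>\<^bsub>A\<^esub> x = \<epsilon>\<^bsub>B\<^esub> x) \<and>
     (\<forall>x\<in>carr A. \<forall>y\<in>carr A. x \<cdot>\<^bsub>A\<^esub> y = x \<cdot>\<^bsub>B\<^esub> y)"

definition hopf_algebra :: "('k::field, 'h::ab_group_add, 'z) hopf_scheme \<Rightarrow> bool" where
  "hopf_algebra H \<longleftrightarrow> bialgebra H \<and> lin H H (\<S>\<^bsub>H\<^esub>) \<and>
     (\<forall>h\<in>carr H.
        sw H H (\<Delta>\<^bsub>H\<^esub> h) (\<lambda>h1 h2. \<S>\<^bsub>H\<^esub> h1 \<cdot>\<^bsub>H\<^esub> h2) = scl H (\<epsilon>\<^bsub>H\<^esub> h) \<one>\<^bsub>H\<^esub> \<and>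
        sw H H (\<Delta>\<^bsub>H\<^esub> h) (\<lambda>h1 h2. h1 \<cdot>\<^bsub>H\<^esub> \<S>\<^bsub>H\<^esub> h2) = scl H (\<epsilon>\<^bsub>H\<^esub> h) \<one>\<^bsub>H\<^esub>)"

text \<open>The ordinary tensor product coalgebra (with the flip), used for \<open>A \<otimes> A\<close>.\<close>

definition ctens :: "('k::field, 'c::ab_group_add, 'z) coalg_scheme \<Rightarrow>
    ('k, 'd::ab_group_add, 'y) coalg_scheme \<Rightarrow> ('k, ('k, 'c, 'd) tensor) coalg" where
  "ctens C D = \<lparr>carr = carr (tprod C D), scl = scl (tprod C D),
     cop = (\<lambda>t. sw C D t (\<lambda>x y. sw C C (\<Delta>\<^bsub>C\<^esub> x) (\<lambda>x1 x2. sw D D (\<Delta>\<^bsub>D\<^esub> y) (\<lambda>y1 y2.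
        tens (tprod C D) (tprod C D) (tens C D x1 y1) (tens C D x2 y2))))),
     cou = (\<lambda>t. sw C D t (\<lambda>x y. \<epsilon>\<^bsub>C\<^esub> x * \<epsilon>\<^bsub>D\<^esub> y))\<rparr>"

definition conv :: "('k::field, 'c::ab_group_add, 'z) coalg_scheme \<Rightarrow> ('u \<Rightarrow> 'u \<Rightarrow> 'u::ab_group_add) \<Rightarrow>
    ('c \<Rightarrow> 'u) \<Rightarrow> ('c \<Rightarrow> 'u) \<Rightarrow> 'c \<Rightarrow> 'u" where
  "conv C m f g = (\<lambda>x. sw C C (\<Delta>\<^bsub>C\<^esub> x) (\<lambda>a b. m (f a) (g b)))"

definition is_conv_inv :: "('k::field, 'c::ab_group_add, 'z) coalg_scheme \<Rightarrow>
    ('c \<Rightarrow> 'k) \<Rightarrow> ('c \<Rightarrow> 'k) \<Rightarrow> bool" where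
  "is_conv_inv C f g \<longleftrightarrow> lin C Kspace g \<and>
     (\<forall>x\<in>carr C. conv C (*) f g x = \<epsilon>\<^bsub>C\<^esub> x \<and> conv C (*) g f x = \<epsilon>\<^bsub>C\<^esub> x)"

definition conv_invertible :: "('k::field, 'c::ab_group_add, 'z) coalg_scheme \<Rightarrow>
    ('c \<Rightarrow> 'k) \<Rightarrow> bool" where
  "conv_invertible C f \<longleftrightarrow> lin C Kspace f \<and> (\<exists>g. is_conv_inv C f g)"

text \<open>The convolution inverse is unique as a function on the carrier.\<close>

definition conv_inv :: "('k::field, 'c::ab_group_add, 'z) coalg_scheme \<Rightarrow>
    ('c \<Rightarrow> 'k) \<Rightarrow> 'c \<Rightarrow> 'k" where
  "conv_inv C f = (SOME g. is_conv_inv C f g)"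


section \<open>Yetter-Drinfeld modules and coalgebras therein\<close>

record ('k, 'h, 'v) ydcoalg = "('k, 'v) coalg" +
  act :: "'h \<Rightarrow> 'v \<Rightarrow> 'v"
  coact :: "'v \<Rightarrow> ('k, 'h, 'v) tensor"  (\<open>\<rho>\<index>\<close>)

text \<open>The predicates \<open>yd_module\<close>, \<open>yd_hom\<close> ignore the comultiplication and counit of the record.\<close>

definition yd_module :: "('k::field, 'h::ab_group_add, 'z) hopf_scheme \<Rightarrow>
    ('k, 'h, 'v::ab_group_add, 'y) ydcoalg_scheme \<Rightarrow> bool" where
  "yd_module H V \<longleftrightarrow> vspace V \<and>
     bilin H V V (act V) \<and>
     (\<forall>v\<in>carr V. act V \<one>\<^bsub>H\<^esub> v = v) \<and>
     (\<forall>g\<in>carr H. \<forall>h\<in>carr H. \<forall>v\<in>carr V. act V (g \<cdot>\<^bsub>H\<^esub> h) v = act V g (act V h v)) \<and>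
     lin V (tprod H V) (\<rho>\<^bsub>V\<^esub>) \<and>
     (\<forall>v\<in>carr V.
        sw H V (\<rho>\<^bsub>V\<^esub> v) (\<lambda>g v0. sw H H (\<Delta>\<^bsub>H\<^esub> g) (\<lambda>g1 g2. tens H (tprod H V) g1 (tens H V g2 v0)))
          = sw H V (\<rho>\<^bsub>V\<^esub> v) (\<lambda>g v0. tens H (tprod H V) g (\<rho>\<^bsub>V\<^esub> v0)) \<and>
        sw H V (\<rho>\<^bsub>V\<^esub> v) (\<lambda>g v0. scl V (\<epsilon>\<^bsub>H\<^esub> g) v0) = v) \<and>
     (\<forall>h\<in>carr H. \<forall>v\<in>carr V.
        \<rho>\<^bsub>V\<^esub> (act V h v) =
          sw H H (\<Delta>\<^bsub>H\<^esub> h) (\<lambda>h1 h'. sw H H (\<Delta>\<^bsub>H\<^esub> h') (\<lambda>h2 h3. sw H V (\<rho>\<^bsub>V\<^esub> v) (\<lambda>g v0.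
            tens H V (h1 \<cdot>\<^bsub>H\<^esub> g \<cdot>\<^bsub>H\<^esub> \<S>\<^bsub>H\<^esub> h3) (act V h2 v0)))))"

definition yd_hom :: "('k::field, 'h::ab_group_add, 'z) hopf_scheme \<Rightarrow>
    ('k, 'h, 'v::ab_group_add, 'y) ydcoalg_scheme \<Rightarrow>
    ('k, 'h, 'w::ab_group_add, 'x) ydcoalg_scheme \<Rightarrow> ('v \<Rightarrow> 'w) \<Rightarrow> bool" where
  "yd_hom H V W f \<longleftrightarrow> lin V W f \<and>
     (\<forall>h\<in>carr H. \<forall>v\<in>carr V. f (act V h v) = act W h (f v)) \<and>
     (\<forall>v\<in>carr V. \<rho>\<^bsub>W\<^esub> (f v) = sw H V (\<rho>\<^bsub>V\<^esub> v) (\<lambda>g v0. tens H W g (f v0)))"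

text \<open>
  Tensor product of coalgebras in the Yetter-Drinfeld category; the comultiplication involves
  the braiding \<open>x \<otimes> y \<mapsto> x\<^sub>-\<^sub>1 y \<otimes> x\<^sub>0\<close>.
\<close>

definition ytens :: "('k::field, 'h::ab_group_add, 'z) hopf_scheme \<Rightarrow>
    ('k, 'h, 'c::ab_group_add, 'y) ydcoalg_scheme \<Rightarrow>
    ('k, 'h, 'd::ab_group_add, 'x) ydcoalg_scheme \<Rightarrow>
    ('k, 'h, ('k, 'c, 'd) tensor) ydcoalg" where
  "ytens H C D = \<lparr>carr = carr (tprod C D), scl = scl (tprod C D),
     cop = (\<lambda>t. sw C D t (\<lambda>x y. sw C C (\<Delta>\<^bsub>C\<^esub> x) (\<lambda>x1 x2. sw D D (\<Delta>\<^bsub>D\<^esub> y) (\<lambda>y1 y2.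
        sw H C (\<rho>\<^bsub>C\<^esub> x2) (\<lambda>g x20.
          tens (tprod C D) (tprod C D) (tens C D x1 (act D g y1)) (tens C D x20 y2)))))),
     cou = (\<lambda>t. sw C D t (\<lambda>x y. \<epsilon>\<^bsub>C\<^esub> x * \<epsilon>\<^bsub>D\<^esub> y)),
     act = (\<lambda>h t. sw C D t (\<lambda>x y. sw H H (\<Delta>\<^bsub>H\<^esub> h) (\<lambda>h1 h2. tens C D (act C h1 x) (act D h2 y)))),
     coact = (\<lambda>t. sw C D t (\<lambda>x y. sw H C (\<rho>\<^bsub>C\<^esub> x) (\<lambda>g x0. sw H D (\<rho>\<^bsub>D\<^esub> y) (\<lambda>g' y0.
        tens H (tprod C D) (g \<cdot>\<^bsub>H\<^esub> g') (tens C D x0 y0)))))\<rparr>"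

text \<open>The last two clauses say that the counit is a morphism to the trivial module \<open>K\<close>.\<close>

definition yd_coalgebra :: "('k::field, 'h::ab_group_add, 'z) hopf_scheme \<Rightarrow>
    ('k, 'h, 'c::ab_group_add, 'y) ydcoalg_scheme \<Rightarrow> bool" where
  "yd_coalgebra H C \<longleftrightarrow> yd_module H C \<and> coalgebra C \<and>
     yd_hom H C (ytens H C C) (\<Delta>\<^bsub>C\<^esub>) \<and>
     (\<forall>h\<in>carr H. \<forall>c\<in>carr C. \<epsilon>\<^bsub>C\<^esub> (act C h c) = \<epsilon>\<^bsub>H\<^esub> h * \<epsilon>\<^bsub>C\<^esub> c) \<and>
     (\<forall>c\<in>carr C. sw H C (\<rho>\<^bsub>C\<^esub> c) (\<lambda>g c0. scl H (\<epsilon>\<^bsub>C\<^esub> c0) g) = scl H (\<epsilon>\<^bsub>C\<^esub> c) \<one>\<^bsub>H\<^esub>)"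

text \<open>The unit map \<open>K \<rightarrow> R\<close> is encoded by the image of \<open>1\<close>.\<close>

record ('k, 'h, 'r) prebialg = "('k, 'h, 'r) ydcoalg" +
  punit :: "'r"
  pmul :: "('k, 'r, 'r) tensor \<Rightarrow> 'r"

definition coaugmented :: "('k::field, 'h::ab_group_add, 'z) hopf_scheme \<Rightarrow>
    ('k, 'h, 'r::ab_group_add, 'y) prebialg_scheme \<Rightarrow> bool" where
  "coaugmented H R \<longleftrightarrow> yd_coalgebra H R \<and> punit R \<in> carr R \<and>
     \<Delta>\<^bsub>R\<^esub> (punit R) = tens R R (punit R) (punit R) \<and> \<epsilon>\<^bsub>R\<^esub> (punit R) = 1 \<and>
     (\<forall>h\<in>carr H. act R h (punit R) = scl R (\<epsilon>\<^bsub>H\<^esub> h) (punit R)) \<and>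
     \<rho>\<^bsub>R\<^esub> (punit R) = tens H R \<one>\<^bsub>H\<^esub> (punit R)"

definition pre_bialgebra :: "('k::field, 'h::ab_group_add, 'z) hopf_scheme \<Rightarrow>
    ('k, 'h, 'r::ab_group_add, 'y) prebialg_scheme \<Rightarrow> bool" where
  "pre_bialgebra H R \<longleftrightarrow> coaugmented H R \<and>
     coalg_hom (ytens H R R) R (pmul R) \<and>
     (\<forall>h\<in>carr H. \<forall>z\<in>carr (tprod R R). pmul R (act (ytens H R R) h z) = act R h (pmul R z)) \<and>
     (\<forall>r\<in>carr R. pmul R (tens R R r (punit R)) = r \<and> pmul R (tens R R (punit R) r) = r)"

definition pre_bialgebra_cocycle :: "('k::field, 'h::ab_group_add, 'z) hopf_scheme \<Rightarrow>
    ('k, 'h, 'r::ab_group_add, 'y) prebialg_scheme \<Rightarrow> (('k, 'r, 'r) tensor \<Rightarrow> 'h) \<Rightarrow> bool" where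
  "pre_bialgebra_cocycle H R \<xi> \<longleftrightarrow> pre_bialgebra H R \<and> lin (tprod R R) H \<xi> \<and>
    (let RR = ytens H R R; m = pmul R in
     (\<forall>z\<in>carr RR.
        \<Delta>\<^bsub>H\<^esub> (\<xi> z) = sw RR RR (\<Delta>\<^bsub>RR\<^esub> z) (\<lambda>z1 z2. sw H RR (\<rho>\<^bsub>RR\<^esub> z2) (\<lambda>g z20.
            tens H H (\<xi> z1 \<cdot>\<^bsub>H\<^esub> g) (\<xi> z20))) \<and>
        \<epsilon>\<^bsub>H\<^esub> (\<xi> z) = \<epsilon>\<^bsub>RR\<^esub> z) \<and>
     (\<forall>h\<in>carr H. \<forall>z\<in>carr RR.
        \<xi> (act RR h z) = sw H H (\<Delta>\<^bsub>H\<^esub> h) (\<lambda>h1 h2. h1 \<cdot>\<^bsub>H\<^esub> \<xi> z \<cdot>\<^bsub>H\<^esub> \<S>\<^bsub>H\<^esub> h2)) \<and>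
     (\<forall>z\<in>carr RR.
        sw RR RR (\<Delta>\<^bsub>RR\<^esub> z) (\<lambda>z1 z2. sw H R (\<rho>\<^bsub>R\<^esub> (m z1)) (\<lambda>g r0. tens H R (g \<cdot>\<^bsub>H\<^esub> \<xi> z2) r0))
          = sw RR RR (\<Delta>\<^bsub>RR\<^esub> z) (\<lambda>z1 z2. sw H RR (\<rho>\<^bsub>RR\<^esub> z2) (\<lambda>g z20.
              tens H R (\<xi> z1 \<cdot>\<^bsub>H\<^esub> g) (m z20)))) \<and>
     (\<forall>r\<in>carr R. \<forall>s\<in>carr R. \<forall>t\<in>carr R.
        m (tens R R r (m (tens R R s t)))
          = sw RR RR (\<Delta>\<^bsub>RR\<^esub> (tens R R r s)) (\<lambda>z1 z2. m (tens R R (m z1) (act R (\<xi> z2) t)))) \<and>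
     (\<forall>r\<in>carr R. \<forall>s\<in>carr R. \<forall>t\<in>carr R.
        sw RR RR (\<Delta>\<^bsub>RR\<^esub> (tens R R s t)) (\<lambda>w1 w2. \<xi> (tens R R r (m w1)) \<cdot>\<^bsub>H\<^esub> \<xi> w2)
          = sw RR RR (\<Delta>\<^bsub>RR\<^esub> (tens R R r s)) (\<lambda>z1 z2. sw H H (\<Delta>\<^bsub>H\<^esub> (\<xi> z2)) (\<lambda>x1 x2.
              \<xi> (tens R R (m z1) (act R x1 t)) \<cdot>\<^bsub>H\<^esub> x2))) \<and>
     (\<forall>r\<in>carr R. \<xi> (tens R R r (punit R)) = scl H (\<epsilon>\<^bsub>R\<^esub> r) \<one>\<^bsub>H\<^esub> \<and>
                 \<xi> (tens R R (punit R) r) = scl H (\<epsilon>\<^bsub>R\<^esub> r) \<one>\<^bsub>H\<^esub>))"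

definition pbc_hom :: "('k::field, 'h::ab_group_add, 'z) hopf_scheme \<Rightarrow>
    ('k, 'h, 'r::ab_group_add, 'y) prebialg_scheme \<Rightarrow> (('k, 'r, 'r) tensor \<Rightarrow> 'h) \<Rightarrow>
    ('k, 'h, 's::ab_group_add, 'x) prebialg_scheme \<Rightarrow> (('k, 's, 's) tensor \<Rightarrow> 'h) \<Rightarrow>
    ('r \<Rightarrow> 's) \<Rightarrow> bool" where
  "pbc_hom H R \<xi> R' \<xi>' f \<longleftrightarrow> yd_hom H R R' f \<and> coalg_hom R R' f \<and>
     f (punit R) = punit R' \<and>
     (\<forall>z\<in>carr (tprod R R).
        f (pmul R z) = pmul R' (sw R R z (\<lambda>r s. tens R' R' (f r) (f s))) \<and>
        \<xi>' (sw R R z (\<lambda>r s. tens R' R' (f r) (f s))) = \<xi> z)"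

definition pbc_iso :: "('k::field, 'h::ab_group_add, 'z) hopf_scheme \<Rightarrow>
    ('k, 'h, 'r::ab_group_add, 'y) prebialg_scheme \<Rightarrow> (('k, 'r, 'r) tensor \<Rightarrow> 'h) \<Rightarrow>
    ('k, 'h, 's::ab_group_add, 'x) prebialg_scheme \<Rightarrow> (('k, 's, 's) tensor \<Rightarrow> 'h) \<Rightarrow>
    ('r \<Rightarrow> 's) \<Rightarrow> bool" where
  "pbc_iso H R \<xi> R' \<xi>' f \<longleftrightarrow> pbc_hom H R \<xi> R' \<xi>' f \<and>
     (\<exists>g. pbc_hom H R' \<xi>' R \<xi> g \<and> (\<forall>r\<in>carr R. g (f r) = r) \<and> (\<forall>s\<in>carr R'. f (g s) = s))"


section \<open>Splitting data\<close>

definition splitting_datum :: "('k::field, 'a::ab_group_add, 'z) bialg_scheme \<Rightarrow>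
    ('k, 'h::ab_group_add, 'y) hopf_scheme \<Rightarrow> ('a \<Rightarrow> 'h) \<Rightarrow> ('h \<Rightarrow> 'a) \<Rightarrow> bool" where
  "splitting_datum A H \<pi> \<sigma> \<longleftrightarrow> hopf_algebra H \<and> bialgebra A \<and> bialg_hom H A \<sigma> \<and> coalg_hom A H \<pi> \<and>
     (\<forall>h\<in>carr H. \<pi> (\<sigma> h) = h) \<and>
     (\<forall>h\<in>carr H. \<forall>x\<in>carr A. \<forall>h'\<in>carr H.
        \<pi> (\<sigma> h \<cdot>\<^bsub>A\<^esub> x \<cdot>\<^bsub>A\<^esub> \<sigma> h') = h \<cdot>\<^bsub>H\<^esub> \<pi> x \<cdot>\<^bsub>H\<^esub> h')"

definition split_tau :: "('k::field, 'a::ab_group_add, 'z) bialg_scheme \<Rightarrow>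
    ('k, 'h::ab_group_add, 'y) hopf_scheme \<Rightarrow> ('a \<Rightarrow> 'h) \<Rightarrow> ('h \<Rightarrow> 'a) \<Rightarrow> 'a \<Rightarrow> 'a" where
  "split_tau A H \<pi> \<sigma> a = sw A A (\<Delta>\<^bsub>A\<^esub> a) (\<lambda>a1 a2. a1 \<cdot>\<^bsub>A\<^esub> \<sigma> (\<S>\<^bsub>H\<^esub> (\<pi> a2)))"

text \<open>
  The values of \<open>cop\<close> and \<open>coact\<close> below are written as sums in \<open>A \<otimes> A\<close> and \<open>H \<otimes> A\<close>; on
  coinvariants they lie in the subspaces \<open>R \<otimes> R\<close> and \<open>H \<otimes> R\<close>.
\<close>

definition split_prebialg :: "('k::field, 'a::ab_group_add, 'z) bialg_scheme \<Rightarrow>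
    ('k, 'h::ab_group_add, 'y) hopf_scheme \<Rightarrow> ('a \<Rightarrow> 'h) \<Rightarrow> ('h \<Rightarrow> 'a) \<Rightarrow>
    ('k, 'h, 'a) prebialg" where
  "split_prebialg A H \<pi> \<sigma> = \<lparr>
     carr = {a \<in> carr A. sw A A (\<Delta>\<^bsub>A\<^esub> a) (\<lambda>a1 a2. tens A H a1 (\<pi> a2)) = tens A H a \<one>\<^bsub>H\<^esub>},
     scl = scl A,
     cop = (\<lambda>r. sw A A (\<Delta>\<^bsub>A\<^esub> r) (\<lambda>r1 r2. tens A A (split_tau A H \<pi> \<sigma> r1) r2)),
     cou = \<epsilon>\<^bsub>A\<^esub>,
     act = (\<lambda>h r. sw H H (\<Delta>\<^bsub>H\<^esub> h) (\<lambda>h1 h2. \<sigma> h1 \<cdot>\<^bsub>A\<^esub> r \<cdot>\<^bsub>A\<^esub> \<sigma> (\<S>\<^bsub>H\<^esub> h2))),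
     coact = (\<lambda>r. sw A A (\<Delta>\<^bsub>A\<^esub> r) (\<lambda>r1 r2. tens H A (\<pi> r1) r2)),
     punit = \<one>\<^bsub>A\<^esub>,
     pmul = (\<lambda>z. sw A A z (\<lambda>r s. split_tau A H \<pi> \<sigma> (r \<cdot>\<^bsub>A\<^esub> s)))\<rparr>"

definition split_cocycle :: "('k::field, 'a::ab_group_add, 'z) bialg_scheme \<Rightarrow>
    ('a \<Rightarrow> 'h::ab_group_add) \<Rightarrow> ('k, 'a, 'a) tensor \<Rightarrow> 'h" where
  "split_cocycle A \<pi> = (\<lambda>z. sw A A z (\<lambda>r s. \<pi> (r \<cdot>\<^bsub>A\<^esub> s)))"

text \<open>The bialgebra \<open>R #\<^sub>\<xi> H\<close>, with its maps \<open>\<sigma>\<close> and \<open>\<pi>\<close>; \<open>r # h\<close> is \<open>tens R H r h\<close>.\<close>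

definition smash :: "('k::field, 'h::ab_group_add, 'z) hopf_scheme \<Rightarrow>
    ('k, 'h, 'r::ab_group_add, 'y) prebialg_scheme \<Rightarrow> (('k, 'r, 'r) tensor \<Rightarrow> 'h) \<Rightarrow>
    ('k, ('k, 'r, 'h) tensor) bialg" where
  "smash H R \<xi> = \<lparr>carr = carr (tprod R H), scl = scl (tprod R H),
     cop = (\<lambda>x. sw R H x (\<lambda>r h. sw R R (\<Delta>\<^bsub>R\<^esub> r) (\<lambda>r1 r2. sw H R (\<rho>\<^bsub>R\<^esub> r2) (\<lambda>g r20.
        sw H H (\<Delta>\<^bsub>H\<^esub> h) (\<lambda>h1 h2.
          tens (tprod R H) (tprod R H) (tens R H r1 (g \<cdot>\<^bsub>H\<^esub> h1)) (tens R H r20 h2)))))),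
     cou = (\<lambda>x. sw R H x (\<lambda>r h. \<epsilon>\<^bsub>R\<^esub> r * \<epsilon>\<^bsub>H\<^esub> h)),
     mul = (\<lambda>x y. sw R H x (\<lambda>r h. sw R H y (\<lambda>s h'.
        sw H H (\<Delta>\<^bsub>H\<^esub> h) (\<lambda>h1 h2. sw R R (\<Delta>\<^bsub>R\<^esub> r) (\<lambda>r1 r2. sw H R (\<rho>\<^bsub>R\<^esub> r2) (\<lambda>g r20.
          sw R R (\<Delta>\<^bsub>R\<^esub> (act R h1 s)) (\<lambda>s1 s2.
            tens R H (pmul R (tens R R r1 (act R g s1)))
                     (\<xi> (tens R R r20 s2) \<cdot>\<^bsub>H\<^esub> h2 \<cdot>\<^bsub>H\<^esub> h')))))))),
     unt = tens R H (punit R) \<one>\<^bsub>H\<^esub>\<rparr>"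

definition smash_sigma :: "('k::field, 'h::ab_group_add, 'z) hopf_scheme \<Rightarrow>
    ('k, 'h, 'r::ab_group_add, 'y) prebialg_scheme \<Rightarrow> 'h \<Rightarrow> ('k, 'r, 'h) tensor" where
  "smash_sigma H R = (\<lambda>h. tens R H (punit R) h)"

definition smash_pi :: "('k::field, 'h::ab_group_add, 'z) hopf_scheme \<Rightarrow>
    ('k, 'h, 'r::ab_group_add, 'y) prebialg_scheme \<Rightarrow> ('k, 'r, 'h) tensor \<Rightarrow> 'h" where
  "smash_pi H R = (\<lambda>x. sw R H x (\<lambda>r h. scl H (\<epsilon>\<^bsub>R\<^esub> r) h))"

text \<open>The line \<open>K 1\<^sub>H\<close>; the space \<open>R \<otimes> K\<close> is taken to be \<open>R \<otimes> K 1\<^sub>H \<subseteq> R \<otimes> H\<close>.\<close>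

definition K1 :: "('k::field, 'h::ab_group_add, 'z) hopf_scheme \<Rightarrow> ('k, 'h) vspace" where
  "K1 H = \<lparr>carr = range (\<lambda>c. scl H c \<one>\<^bsub>H\<^esub>), scl = scl H\<rparr>"

text \<open>The canonical map \<open>\<theta>\<close>: for \<open>h = c 1\<^sub>H\<close> one has \<open>\<epsilon>(h) = c\<close>, so \<open>\<theta> (r \<otimes> c 1\<^sub>H) = c r\<close>.\<close>

definition theta :: "('k::field, 'h::ab_group_add, 'z) hopf_scheme \<Rightarrow>
    ('k, 'h, 'r::ab_group_add, 'y) prebialg_scheme \<Rightarrow> ('k, 'r, 'h) tensor \<Rightarrow> 'r" where
  "theta H R = (\<lambda>x. sw R (K1 H) x (\<lambda>r h. scl R (\<epsilon>\<^bsub>H\<^esub> h) r))"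


section \<open>Cocycles and twists\<close>

definition Z2 :: "('k::field, 'h::ab_group_add, 'z) hopf_scheme \<Rightarrow>
    ('k, 'a::ab_group_add, 'y) bialg_scheme \<Rightarrow> ('h \<Rightarrow> 'a) \<Rightarrow> (('k, 'a, 'a) tensor \<Rightarrow> 'k) set" where
  "Z2 H A \<sigma> = {\<gamma>. conv_invertible (ctens A A) \<gamma> \<and>
     (\<forall>x\<in>carr A. \<forall>y\<in>carr A. \<forall>z\<in>carr A.
        sw A A (\<Delta>\<^bsub>A\<^esub> y) (\<lambda>y1 y2. sw A A (\<Delta>\<^bsub>A\<^esub> z) (\<lambda>z1 z2.
            \<gamma> (tens A A y1 z1) * \<gamma> (tens A A x (y2 \<cdot>\<^bsub>A\<^esub> z2))))
          = sw A A (\<Delta>\<^bsub>A\<^esub> x) (\<lambda>x1 x2. sw A A (\<Delta>\<^bsub>A\<^esub> y) (\<lambda>y1 y2.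
            \<gamma> (tens A A x1 y1) * \<gamma> (tens A A (x2 \<cdot>\<^bsub>A\<^esub> y2) z)))) \<and>
     (\<forall>x\<in>carr A. \<gamma> (tens A A x \<one>\<^bsub>A\<^esub>) = \<epsilon>\<^bsub>A\<^esub> x \<and> \<gamma> (tens A A \<one>\<^bsub>A\<^esub> x) = \<epsilon>\<^bsub>A\<^esub> x) \<and>
     (\<forall>h\<in>carr H. \<forall>h'\<in>carr H. \<forall>a\<in>carr A. \<forall>a'\<in>carr A.
        \<gamma> (tens A A (\<sigma> h \<cdot>\<^bsub>A\<^esub> a) (a' \<cdot>\<^bsub>A\<^esub> \<sigma> h')) = \<epsilon>\<^bsub>H\<^esub> h * \<gamma> (tens A A a a') * \<epsilon>\<^bsub>H\<^esub> h')}"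

definition bialg_twist :: "('k::field, 'a::ab_group_add) bialg \<Rightarrow>
    (('k, 'a, 'a) tensor \<Rightarrow> 'k) \<Rightarrow> ('k, 'a) bialg" where
  "bialg_twist A \<gamma> = A\<lparr>mul := (\<lambda>x y.
     sw A A (\<Delta>\<^bsub>A\<^esub> x) (\<lambda>x1 x'. sw A A (\<Delta>\<^bsub>A\<^esub> x') (\<lambda>x2 x3.
     sw A A (\<Delta>\<^bsub>A\<^esub> y) (\<lambda>y1 y'. sw A A (\<Delta>\<^bsub>A\<^esub> y') (\<lambda>y2 y3.
       scl A (\<gamma> (tens A A x1 y1) * conv_inv (ctens A A) \<gamma> (tens A A x3 y3)) (x2 \<cdot>\<^bsub>A\<^esub> y2))))))\<rparr>"

definition gamma_R :: "('k::field, 'h::ab_group_add, 'z) hopf_scheme \<Rightarrow>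
    ('k, 'h, 'r::ab_group_add, 'y) prebialg_scheme \<Rightarrow>
    (('k, ('k, 'r, 'h) tensor, ('k, 'r, 'h) tensor) tensor \<Rightarrow> 'k) \<Rightarrow> ('k, 'r, 'r) tensor \<Rightarrow> 'k" where
  "gamma_R H R \<gamma> = (\<lambda>z. sw R R z (\<lambda>r s.
     \<gamma> (tens (tprod R H) (tprod R H) (tens R H r \<one>\<^bsub>H\<^esub>) (tens R H s \<one>\<^bsub>H\<^esub>))))"

definition prebialg_twist :: "('k::field, 'h::ab_group_add, 'z) hopf_scheme \<Rightarrow>
    ('k, 'h, 'r::ab_group_add) prebialg \<Rightarrow> (('k, 'r, 'r) tensor \<Rightarrow> 'k) \<Rightarrow>
    ('k, 'h, 'r) prebialg" where
  "prebialg_twist H R \<upsilon> = (let RR = ytens H R R in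
     R\<lparr>pmul := (\<lambda>z. sw RR RR (\<Delta>\<^bsub>RR\<^esub> z) (\<lambda>z1 z'. sw RR RR (\<Delta>\<^bsub>RR\<^esub> z') (\<lambda>z2 z3.
          scl R (\<upsilon> z1 * conv_inv RR \<upsilon> z3) (pmul R z2))))\<rparr>)"

text \<open>\<open>u\<^sub>H \<upsilon> * \<xi> * (H \<otimes> \<upsilon>\<^sup>-\<^sup>1) \<rho>\<^bsub>R\<otimes>R\<^esub>\<close>\<close>

definition cocycle_twist :: "('k::field, 'h::ab_group_add, 'z) hopf_scheme \<Rightarrow>
    ('k, 'h, 'r::ab_group_add, 'y) prebialg_scheme \<Rightarrow> (('k, 'r, 'r) tensor \<Rightarrow> 'h) \<Rightarrow>
    (('k, 'r, 'r) tensor \<Rightarrow> 'k) \<Rightarrow> ('k, 'r, 'r) tensor \<Rightarrow> 'h" where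
  "cocycle_twist H R \<xi> \<upsilon> = (let RR = ytens H R R in
     conv RR (mul H)
       (conv RR (mul H) (\<lambda>z. scl H (\<upsilon> z) \<one>\<^bsub>H\<^esub>) \<xi>)
       (\<lambda>z. sw H RR (\<rho>\<^bsub>RR\<^esub> z) (\<lambda>g z0. scl H (conv_inv RR \<upsilon> z0) g)))"

end

(* A bialgebra B on the smash coalgebra R # H in which 1 # H multiplies in the standard way is
   determined by mu (r, s) = (r # 1) (s # 1).  Every such B is a smash product: with
   m = (id # epsilon) mu and xi = (epsilon # id) mu, multiplicativity of the comultiplication gives
   mu (z) = m (z^(1)) # xi (z^(2)), and the axioms of a pre-bialgebra with cocycle are the components
   in R and in H of linearity over H, associativity and multiplicativity of the comultiplication.
   Since gamma is balanced over H (a consequence of the cocycle identity, the normalisation and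
   H-bilinearity) and so is its convolution inverse, twisting by gamma does not change products with
   1 # H.  So A^gamma is again such a bialgebra, and evaluating its product on R # 1 gives
   mu_gamma (z) = gamma_R (z^(1)) m (z^(2)) # xi (z^(3)) z^(4)_<-1> gamma_R^-1 (z^(4)_<0>),
   whose components are the multiplication of R^gamma_R and the cocycle xi_gamma_R. *)

theory Submission
  imports Defs
begin

subsection \<open>Vector spaces and tensors\<close>

text \<open>A Sweedler sum is a choice of representation, so equal tensors need not have visibly
  equal sums. Identities are therefore tested against an arbitrary linear form and, where possible,
  on pure tensors. Both sides become scalar valued nested sums with a normal form: comultiplications
  nested to the right, sums over different spaces in a fixed order, counits pulled out. What may
  remain is the exchange of two sums over the same spaces, made explicitly.

  The axioms are used in both directions. Those of \<open>(R, \<xi>)\<close> make the smash product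
  a bialgebra; that a cocycle twist is again a bialgebra is proved for arbitrary bialgebras; only
  then are the axioms read back from the twist, so no axiom is ever checked on the long formulas
  containing \<open>\<gamma>\<^sub>R\<close> and its inverse.

  Two mismatches have to be bridged. The coinvariants lie in \<open>R \<otimes> H\<close>, another
  type than \<open>R\<close>, so the structure must be transported. And \<gamma> is inverted with
  respect to the flip on \<open>A \<otimes> A\<close>, its restriction with respect to the braiding
  on \<open>R \<otimes> R\<close>.\<close>

lemma vector_space_tscale: "vector_space (tscale :: 'k::field \<Rightarrow> ('k, 'v, 'w) tensor \<Rightarrow> _)"
  by unfold_locales (transfer, simp add: fun_eq_iff algebra_simps)+

lemma carr_tprod: "carr (tprod V W) = module.span tscale {tens V W v w | v w. v \<in> carr V \<and> w \<in> carr W}"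
  and scl_tprod [simp]: "scl (tprod V W) = tscale"
  by (simp_all add: tprod_def)

lemma vspace_tprod [simp]: "vspace (tprod V W)"
proof -
  interpret vector_space tscale by (rule vector_space_tscale)
  show ?thesis by (simp add: vspace_def carr_tprod vector_space_tscale)
qed

lemma vspace_Kspace [simp]: "vspace (Kspace :: ('k::field, 'k) vspace)"
proof -
  have "vector_space ((*) :: 'k \<Rightarrow> 'k \<Rightarrow> 'k)" by unfold_locales (simp_all add: algebra_simps)
  then interpret vector_space "(*) :: 'k \<Rightarrow> 'k \<Rightarrow> 'k" .
  show ?thesis by (simp add: vspace_def Kspace_def vector_space_axioms)
qed

lemma carr_Kspace [simp]: "carr Kspace = UNIV" and scl_Kspace [simp]: "scl Kspace = (*)"
  by (simp_all add: Kspace_def)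

lemma vspace_zero [simp]: "vspace V \<Longrightarrow> 0 \<in> carr V"
  and vspace_add [simp]: "vspace V \<Longrightarrow> x \<in> carr V \<Longrightarrow> y \<in> carr V \<Longrightarrow> x + y \<in> carr V"
  and vspace_scl [simp]: "vspace V \<Longrightarrow> x \<in> carr V \<Longrightarrow> scl V c x \<in> carr V"
proof -
  assume V: "vspace V"
  then interpret vector_space "scl V" by (simp add: vspace_def)
  have *: "subspace (carr V)" using V by (simp add: vspace_def)
  show "0 \<in> carr V" using * subspace_0 by blast
  show "x \<in> carr V \<Longrightarrow> y \<in> carr V \<Longrightarrow> x + y \<in> carr V" using * subspace_add by blast
  show "x \<in> carr V \<Longrightarrow> scl V c x \<in> carr V" using * subspace_scale by blast
qed

lemma scl_one [simp]: "vspace V \<Longrightarrow> scl V 1 x = x"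
  by (simp add: vspace_def vector_space.vector_space_assms(4))

lemma lin_carr: "lin V W f \<Longrightarrow> x \<in> carr V \<Longrightarrow> f x \<in> carr W"
  and lin_add: "lin V W f \<Longrightarrow> x \<in> carr V \<Longrightarrow> y \<in> carr V \<Longrightarrow> f (x + y) = f x + f y"
  and lin_scl: "lin V W f \<Longrightarrow> x \<in> carr V \<Longrightarrow> f (scl V c x) = scl W c (f x)"
  by (auto simp: lin_def)

lemma lin_0: assumes "vspace V" "lin V W f" shows "f 0 = 0"
proof -
  have "f (0 + 0) = f 0 + f 0" by (rule lin_add[OF assms(2)]) (use assms(1) in simp_all)
  then show ?thesis by simp
qed

lemma tens_add_left:
  assumes "vspace V" "vspace W"
  shows "tens V W (v + v') w = tens V W v w + tens V W v' w"
    and "tens V W v (w + w') = tens V W v w + tens V W v w'"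
    and "tens V W (scl V c v) w = tscale c (tens V W v w)"
    and "tens V W v (scl W c w) = tscale c (tens V W v w)"
  by (transfer, auto simp: fun_eq_iff bilin_def lin_def ambient_def Kspace_def)+

lemma tens_carr [simp]: "v \<in> carr V \<Longrightarrow> w \<in> carr W \<Longrightarrow> tens V W v w \<in> carr (tprod V W)"
proof -
  interpret vector_space tscale by (rule vector_space_tscale)
  show "v \<in> carr V \<Longrightarrow> w \<in> carr W \<Longrightarrow> tens V W v w \<in> carr (tprod V W)"
    unfolding carr_tprod by (rule span_base) blast
qed

lemma bilin_tens [simp]: "vspace V \<Longrightarrow> vspace W \<Longrightarrow> bilin V W (tprod V W) (tens V W)"
  by (simp add: bilin_def lin_def tens_add_left)

text \<open>Scalars are absorbed into the left factor, so that sums without coefficients, the only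
  ones over which \<open>sw\<close> ranges, already fill the span.\<close>

lemma tprod_rep:
  assumes "vspace V" "vspace W" "t \<in> carr (tprod V W)"
  shows "\<exists>xs. set xs \<subseteq> carr V \<times> carr W \<and> (\<Sum>(v, w)\<leftarrow>xs. tens V W v w) = t"
proof -
  interpret vector_space tscale by (rule vector_space_tscale)
  have "t \<in> span {tens V W v w | v w. v \<in> carr V \<and> w \<in> carr W}"
    using assms(3) by (simp add: carr_tprod)
  then show ?thesis
  proof (induction rule: span_induct_alt)
    case base
    show ?case by (rule exI[of _ "[]"]) simp
  next
    case (step c x y)
    then obtain v w xs where "x = tens V W v w" "v \<in> carr V" "w \<in> carr W"
      "set xs \<subseteq> carr V \<times> carr W" "(\<Sum>(v, w)\<leftarrow>xs. tens V W v w) = y" by blast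
    then show ?case
      using assms by (intro exI[of _ "(scl V c v, w) # xs"]) (simp add: tens_add_left)
  qed
qed

section \<open>Calculus of Sweedler sums\<close>

definition sw_list :: "('k::field, 'v::ab_group_add, 'z) vspace_scheme \<Rightarrow>
    ('k, 'w::ab_group_add, 'y) vspace_scheme \<Rightarrow> ('k, 'v, 'w) tensor \<Rightarrow> ('v \<times> 'w) list" where
  "sw_list V W t = (SOME xs. set xs \<subseteq> carr V \<times> carr W \<and> (\<Sum>(v, w)\<leftarrow>xs. tens V W v w) = t)"

lemma sw_eq_sum_list: "sw V W t f = (\<Sum>(v, w)\<leftarrow>sw_list V W t. f v w)"
  by (simp add: sw_def sw_list_def)

lemma sw_list:
  assumes "vspace V" "vspace W" "t \<in> carr (tprod V W)"
  shows "set (sw_list V W t) \<subseteq> carr V \<times> carr W"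
    and "(\<Sum>(v, w)\<leftarrow>sw_list V W t. tens V W v w) = t"
  using someI_ex[OF tprod_rep[OF assms]] by (simp_all add: sw_list_def)

text \<open>Both sides sum over the same chosen list, so arbitrary summands are allowed. Declared
  later as a congruence rule, it lets the simplifier assume that the bound components lie in their
  carriers, which discharges most side conditions.\<close>

lemma sw_cong:
  assumes "t = t'" "vspace V" "vspace W" "t' \<in> carr (tprod V W)"
    "\<And>v w. v \<in> carr V \<Longrightarrow> w \<in> carr W \<Longrightarrow> f v w = g v w"
  shows "sw V W t f = sw V W t' g"
  unfolding assms(1) sw_eq_sum_list
  using sw_list(1)[OF assms(2-4)] assms(5) by (auto intro!: arg_cong[of _ _ sum_list] map_cong)

lemma sum_list_swap: "(\<Sum>(a, b)\<leftarrow>xs. \<Sum>(c, d)\<leftarrow>ys. (f a b c d :: 'u::comm_monoid_add)) = (\<Sum>(c, d)\<leftarrow>ys. \<Sum>(a, b)\<leftarrow>xs. f a b c d)"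
proof (induction xs)
  case Nil
  then show ?case by (induction ys) auto
next
  case (Cons x xs)
  obtain a b where "x = (a, b)" by force
  with Cons show ?case by (simp add: case_prod_unfold sum_list_addf)
qed

text \<open>Both sides range over the same two fixed lists. Most uses instantiate the spaces, which
  gives the rewriting a direction.\<close>

lemma sw_swap: "sw V W t (\<lambda>a b. sw X Y s (\<lambda>c d. f a b c d)) = sw X Y s (\<lambda>c d. sw V W t (\<lambda>a b. f a b c d))"
  unfolding sw_def Let_def by (rule sum_list_swap)

lemma lin_sum_list:
  assumes "vspace V" "lin V W g" "\<And>x. x \<in> set xs \<Longrightarrow> F x \<in> carr V"
  shows "g (\<Sum>x\<leftarrow>xs. F x) = (\<Sum>x\<leftarrow>xs. g (F x)) \<and> (\<Sum>x\<leftarrow>xs. F x) \<in> carr V"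
  using assms(3) by (induction xs) (simp_all add: lin_0[OF assms(1,2)] assms(1) lin_add[OF assms(2)])

lemma sw_carr:
  assumes "vspace V" "vspace W" "vspace U" "t \<in> carr (tprod V W)"
    "\<And>v w. v \<in> carr V \<Longrightarrow> w \<in> carr W \<Longrightarrow> f v w \<in> carr U"
  shows "sw V W t f \<in> carr U"
proof -
  have "(\<Sum>(v, w)\<leftarrow>xs. f v w) \<in> carr U" if "set xs \<subseteq> carr V \<times> carr W" for xs
    using that assms(3,5) by (induction xs) auto
  then show ?thesis using sw_list(1)[OF assms(1,2,4)] by (simp add: sw_eq_sum_list)
qed

lemma lin_sw:
  assumes "vspace V" "vspace W" "vspace U" "lin U X g" "t \<in> carr (tprod V W)"
    "\<And>v w. v \<in> carr V \<Longrightarrow> w \<in> carr W \<Longrightarrow> f v w \<in> carr U"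
  shows "g (sw V W t f) = sw V W t (\<lambda>a b. g (f a b))"
  unfolding sw_eq_sum_list
  using lin_sum_list[OF assms(3,4), of "sw_list V W t" "\<lambda>(v,w). f v w"]
    sw_list(1)[OF assms(1,2,5)] assms(6)
  by (force simp: case_prod_unfold)

lemma sw_tens:
  assumes "vspace V" "vspace W" "vspace U" "bilin V W U f" "v \<in> carr V" "w \<in> carr W"
  shows "sw V W (tens V W v w) f = f v w"
  using sw_eq[OF assms(1-4), of "[(v, w)]"] assms(5,6) by simp

text \<open>The list chosen for \<open>s + t\<close> is unrelated to those chosen for
  \<open>s\<close> and \<open>t\<close>. Concatenation and scaling give other representations, and
  \<open>sw_eq\<close> says that they yield the same value.\<close>

lemma lin_sw_arg:
  assumes "vspace V" "vspace W" "vspace U" "bilin V W U f"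
  shows "lin (tprod V W) U (\<lambda>t. sw V W t f)"
proof -
  have f: "f v w \<in> carr U" if "v \<in> carr V" "w \<in> carr W" for v w
    using assms(4) that by (auto simp: bilin_def lin_def)
  have add: "sw V W (s + t) f = sw V W s f + sw V W t f" if s: "s \<in> carr (tprod V W)" and t: "t \<in> carr (tprod V W)" for s t
  proof -
    obtain xs where xs: "set xs \<subseteq> carr V \<times> carr W" "(\<Sum>(v, w)\<leftarrow>xs. tens V W v w) = s"
      using tprod_rep[OF assms(1,2) s]
      by blast
    obtain ys where ys: "set ys \<subseteq> carr V \<times> carr W" "(\<Sum>(v, w)\<leftarrow>ys. tens V W v w) = t"
      using tprod_rep[OF assms(1,2) t] by blast
    have "sw V W (\<Sum>(v, w)\<leftarrow>xs @ ys. tens V W v w) f = (\<Sum>(v, w)\<leftarrow>xs @ ys. f v w)"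
      by (rule sw_eq[OF assms]) (use xs ys in auto)
    also have "\<dots> = sw V W s f + sw V W t f"
      using sw_eq[OF assms xs(1)] sw_eq[OF assms ys(1)] xs(2) ys(2) by simp
    finally show ?thesis using xs(2) ys(2) by simp
  qed
  have scl: "sw V W (tscale c t) f = scl U c (sw V W t f)" if t: "t \<in> carr (tprod V W)" for c t
  proof -
    interpret T: vector_space tscale by (rule vector_space_tscale)
    interpret UU: vector_space "scl U" using assms(3) by (simp add: vspace_def)
    obtain xs where xs: "set xs \<subseteq> carr V \<times> carr W" "(\<Sum>(v, w)\<leftarrow>xs. tens V W v w) = t"
      using tprod_rep[OF assms(1,2) t]
      by blast
    let ?ys = "map (\<lambda>(v, w). (scl V c v, w)) xs"
    have ys: "set ?ys \<subseteq> carr V \<times> carr W" using xs(1) assms(1) by auto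
    have 1: "(\<Sum>(v, w)\<leftarrow>?ys. tens V W v w) = tscale c (\<Sum>(v, w)\<leftarrow>xs. tens V W v w)"
      using assms(1,2) by (induction xs) (auto simp: tens_add_left T.scale_right_distrib)
    have 2: "(\<Sum>(v, w)\<leftarrow>?ys. f v w) = scl U c (\<Sum>(v, w)\<leftarrow>xs. f v w)"
      using xs(1) assms(4)
      by (induction xs) (auto simp: UU.scale_right_distrib bilin_def lin_def)
    show ?thesis
      using sw_eq[OF assms ys] sw_eq[OF assms xs(1)] xs(2) 1 2 by simp
  qed
  show ?thesis using assms f by (auto simp: lin_def add scl intro!: sw_carr)
qed

lemma sw_sw:
  assumes "vspace V" "vspace W" "vspace X" "vspace Y" "vspace U" "t \<in> carr (tprod X Y)"
    "\<And>a b. a \<in> carr X \<Longrightarrow> b \<in> carr Y \<Longrightarrow> G a b \<in> carr (tprod V W)" "bilin V W U F"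
  shows "sw V W (sw X Y t G) F = sw X Y t (\<lambda>a b. sw V W (G a b) F)"
  using lin_sw[OF assms(3,4) vspace_tprod lin_sw_arg[OF assms(1,2,5,8)] assms(6), of G] assms(7) by simp

lemma sw_id:
  assumes "vspace V" "vspace W" "t \<in> carr (tprod V W)"
  shows "sw V W t (tens V W) = t"
  using sw_list(2)[OF assms] by (simp add: sw_eq_sum_list)

lemma eq_by_forms:
  assumes "vspace U" "\<And>\<phi>. lin U Kspace \<phi> \<Longrightarrow> \<phi> x = \<phi> y" "x \<in> carr U" "y \<in> carr U"
  shows "x = y"
proof (rule ccontr)
  assume "x \<noteq> y"
  then obtain g where g: "Vector_Spaces.linear (scl U) (*) g" "g (x - y) \<noteq> 0"
    using separating_functional[of "scl U" "x - y"] assms(1) by (auto simp: vspace_def)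
  interpret g: Vector_Spaces.linear "scl U" "(*)" g by fact
  have "lin U Kspace g" by (simp add: lin_def g.add g.scale)
  then show False using assms(2)[of g] g(2) by (simp add: g.diff)
qed

subsection \<open>Linear and bilinear maps\<close>

lemma lin_comp: "lin V W f \<Longrightarrow> lin X V g \<Longrightarrow> lin X W (\<lambda>x. f (g x))"
  by (simp add: lin_def)

lemma bilin_left: "bilin V W U f \<Longrightarrow> w \<in> carr W \<Longrightarrow> lin X V g \<Longrightarrow> lin X U (\<lambda>x. f (g x) w)"
  by (simp add: bilin_def lin_def)

lemma bilin_right: "bilin V W U f \<Longrightarrow> v \<in> carr V \<Longrightarrow> lin X W g \<Longrightarrow> lin X U (\<lambda>x. f v (g x))"
  by (simp add: bilin_def lin_def)

lemma bilin_iff: "bilin V W U f \<longleftrightarrow> (\<forall>w\<in>carr W. lin V U (\<lambda>v. f v w)) \<and> (\<forall>v\<in>carr V. lin W U (\<lambda>w. f v w))"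
  by (simp add: bilin_def)

lemma lin_id: "lin V V (\<lambda>x. x)" by (simp add: lin_def)

lemma lin_sw1: "lin X (tprod V W) T \<Longrightarrow> vspace V \<Longrightarrow> vspace W \<Longrightarrow> vspace U \<Longrightarrow> bilin V W U F \<Longrightarrow>
  lin X U (\<lambda>x. sw V W (T x) F)"
  using lin_comp[OF lin_sw_arg] .

text \<open>The parameter sits in the summand and the list stays fixed, so a pointwise argument
  along the list suffices. The complementary case, a tensor that varies with the parameter, is
  \<open>lin_sw1\<close>.\<close>

lemma lin_sw2:
  assumes "vspace V" "vspace W" "vspace U" "t \<in> carr (tprod V W)"
    "\<And>v w. v \<in> carr V \<Longrightarrow> w \<in> carr W \<Longrightarrow> lin X U (\<lambda>x. F x v w)"
  shows "lin X U (\<lambda>x. sw V W t (F x))"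
proof -
  interpret UU: vector_space "scl U" using assms(3) by (simp add: vspace_def)
  have "lin X U (\<lambda>x. \<Sum>(v, w)\<leftarrow>xs. F x v w)" if "set xs \<subseteq> carr V \<times> carr W" for xs
    using that
  proof (induction xs)
    case Nil
    then show ?case using assms(3) by (simp add: lin_def)
  next
    case (Cons p xs)
    obtain v w where p: "p = (v, w)" by force
    have "lin X U (\<lambda>x. F x v w)" using assms(5) Cons.prems p by auto
    with Cons show ?case using assms(3) by (simp add: p lin_def UU.scale_right_distrib algebra_simps)
  qed
  then show ?thesis using sw_list(1)[OF assms(1,2,4)] by (simp add: sw_eq_sum_list)
qed

lemma lin_mult [simp]: "lin X Kspace f \<Longrightarrow> lin X Kspace (\<lambda>x. f x * c)" "lin X Kspace f \<Longrightarrow> lin X Kspace (\<lambda>x. c * f x)"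
  by (simp_all add: lin_def algebra_simps)

lemma lin_scl1: "vspace U \<Longrightarrow> lin X Kspace f \<Longrightarrow> u \<in> carr U \<Longrightarrow> lin X U (\<lambda>x. scl U (f x) u)"
proof -
  assume *: "vspace U" "lin X Kspace f" "u \<in> carr U"
  interpret UU: vector_space "scl U" using * by (simp add: vspace_def)
  show ?thesis using * by (auto simp: lin_def UU.scale_left_distrib)
qed
lemma lin_scl2: "vspace U \<Longrightarrow> lin X U f \<Longrightarrow> lin X U (\<lambda>x. scl U c (f x))"
proof -
  assume *: "vspace U" "lin X U f"
  interpret UU: vector_space "scl U" using * by (simp add: vspace_def)
  show ?thesis using * by (auto simp: lin_def UU.scale_right_distrib UU.scale_left_commute)
qed

lemma lin_sw': "lin U X g \<Longrightarrow> vspace V \<Longrightarrow> vspace W \<Longrightarrow> vspace U \<Longrightarrow> t \<in> carr (tprod V W) \<Longrightarrow>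
    (\<And>v w. v \<in> carr V \<Longrightarrow> w \<in> carr W \<Longrightarrow> f v w \<in> carr U) \<Longrightarrow>
  g (sw V W t f) = sw V W t (\<lambda>a b. g (f a b))"
  by (rule lin_sw)

text \<open>Instantiated with the linearity of a map, this bundle tells the simplifier about
  membership, scalars, composition and interchange with \<open>sw\<close>. Additivity enters through
  the last item. \<open>bilinD\<close> below does the same for bilinear maps.\<close>

lemmas linD = lin_carr lin_scl lin_comp lin_sw'

lemma bilin_lin: "bilin V W U f \<Longrightarrow> w \<in> carr W \<Longrightarrow> lin V U (\<lambda>v. f v w)"
  "bilin V W U f \<Longrightarrow> v \<in> carr V \<Longrightarrow> lin W U (\<lambda>w. f v w)"
  by (simp_all add: bilin_def)

lemma bilin_carr: "bilin V W U f \<Longrightarrow> v \<in> carr V \<Longrightarrow> w \<in> carr W \<Longrightarrow> f v w \<in> carr U"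
  by (simp add: bilin_def lin_def)

lemma bilin_sw1: "bilin X Y Z g \<Longrightarrow> vspace V \<Longrightarrow> vspace W \<Longrightarrow> vspace X \<Longrightarrow> t \<in> carr (tprod V W) \<Longrightarrow> y \<in> carr Y \<Longrightarrow>
    (\<And>v w. v \<in> carr V \<Longrightarrow> w \<in> carr W \<Longrightarrow> f v w \<in> carr X) \<Longrightarrow>
  g (sw V W t f) y = sw V W t (\<lambda>a b. g (f a b) y)"
  using lin_sw[OF _ _ _ bilin_lin(1)] .

lemma bilin_sw2: "bilin X Y Z g \<Longrightarrow> vspace V \<Longrightarrow> vspace W \<Longrightarrow> vspace Y \<Longrightarrow> t \<in> carr (tprod V W) \<Longrightarrow> x \<in> carr X \<Longrightarrow>
    (\<And>v w. v \<in> carr V \<Longrightarrow> w \<in> carr W \<Longrightarrow> f v w \<in> carr Y) \<Longrightarrow>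
  g x (sw V W t f) = sw V W t (\<lambda>a b. g x (f a b))"
  using lin_sw[OF _ _ _ bilin_lin(2)] .

lemma bilin_scl: "bilin X Y Z g \<Longrightarrow> x \<in> carr X \<Longrightarrow> y \<in> carr Y \<Longrightarrow> g (scl X c x) y = scl Z c (g x y)"
   "bilin X Y Z g \<Longrightarrow> x \<in> carr X \<Longrightarrow> y \<in> carr Y \<Longrightarrow> g x (scl Y c y) = scl Z c (g x y)"
  by (simp_all add: bilin_def lin_def)

lemmas bilinD = bilin_carr bilin_left bilin_right bilin_sw1 bilin_sw2 bilin_scl

lemma tensD: "vspace V \<Longrightarrow> vspace W \<Longrightarrow> w \<in> carr W \<Longrightarrow> lin X V g \<Longrightarrow> lin X (tprod V W) (\<lambda>x. tens V W (g x) w)"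
  "vspace V \<Longrightarrow> vspace W \<Longrightarrow> v \<in> carr V \<Longrightarrow> lin X W h \<Longrightarrow> lin X (tprod V W) (\<lambda>x. tens V W v (h x))"
  using bilin_left[OF bilin_tens] bilin_right[OF bilin_tens] by blast+

lemma tens_sw: "vspace V \<Longrightarrow> vspace W \<Longrightarrow> vspace A \<Longrightarrow> vspace B \<Longrightarrow> t \<in> carr (tprod A B) \<Longrightarrow> w \<in> carr W \<Longrightarrow>
   (\<And>a b. a \<in> carr A \<Longrightarrow> b \<in> carr B \<Longrightarrow> f a b \<in> carr V) \<Longrightarrow>
   tens V W (sw A B t f) w = sw A B t (\<lambda>a b. tens V W (f a b) w)"
  "vspace V \<Longrightarrow> vspace W \<Longrightarrow> vspace A \<Longrightarrow> vspace B \<Longrightarrow> t \<in> carr (tprod A B) \<Longrightarrow> v \<in> carr V \<Longrightarrow>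
   (\<And>a b. a \<in> carr A \<Longrightarrow> b \<in> carr B \<Longrightarrow> h a b \<in> carr W) \<Longrightarrow>
   tens V W v (sw A B t h) = sw A B t (\<lambda>a b. tens V W v (h a b))"
  using bilin_sw1[OF bilin_tens] bilin_sw2[OF bilin_tens] by blast+

text \<open>In the rewrite rules below all sums are scalar valued, so that no target space has to be guessed.\<close>

lemma sw_tens_K [simp]: "vspace V \<Longrightarrow> vspace W \<Longrightarrow> v \<in> carr V \<Longrightarrow> w \<in> carr W \<Longrightarrow> bilin V W Kspace f \<Longrightarrow> sw V W (tens V W v w) f = f v w"
  by (rule sw_tens[where U = Kspace]) simp_all

lemma sw_sw_K [simp]: "vspace V \<Longrightarrow> vspace W \<Longrightarrow> vspace X \<Longrightarrow> vspace Y \<Longrightarrow> t \<in> carr (tprod X Y) \<Longrightarrow>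
    (\<And>a b. a \<in> carr X \<Longrightarrow> b \<in> carr Y \<Longrightarrow> G a b \<in> carr (tprod V W)) \<Longrightarrow> bilin V W Kspace F \<Longrightarrow>
  sw V W (sw X Y t G) F = sw X Y t (\<lambda>a b. sw V W (G a b) F)"
  by (rule sw_sw[where U = Kspace]) simp_all

lemma sw_scl_K [simp]: "vspace V \<Longrightarrow> vspace W \<Longrightarrow> t \<in> carr (tprod V W) \<Longrightarrow> bilin V W Kspace F \<Longrightarrow>
  sw V W (tscale c t) F = c * sw V W t F"
  using lin_scl[OF lin_sw_arg[of V W Kspace F], of t c] by simp

declare lin_id [simp] lin_sw1 [simp] lin_sw2 [simp] lin_scl1 [simp] lin_scl2 [simp] tensD [simp] tens_sw [simp] bilin_iff [simp] sw_carr [simp]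

lemma tens_scl [simp]: "vspace V \<Longrightarrow> vspace W \<Longrightarrow> tens V W (scl V c v) w = tscale c (tens V W v w)"
  "vspace V \<Longrightarrow> vspace W \<Longrightarrow> tens V W v (scl W c w) = tscale c (tens V W v w)"
  by (simp_all add: tens_add_left)

lemma tens_tscale [simp]: "vspace W \<Longrightarrow> tens (tprod V V') W (tscale c v) w = tscale c (tens (tprod V V') W v w)"
  "vspace V \<Longrightarrow> tens V (tprod W W') v' (tscale c w') = tscale c (tens V (tprod W W') v' w')"
  using tens_scl(1)[OF vspace_tprod, of W V V' c v w] tens_scl(2)[OF _ vspace_tprod, of V W W' v' c w'] by simp_all

lemma tscale_carr [simp]: "t \<in> carr (tprod V W) \<Longrightarrow> tscale c t \<in> carr (tprod V W)"
  using vspace_scl[OF vspace_tprod] by (simp add: scl_tprod)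

lemma lin_tscale [simp]: "lin X (tprod V W) g \<Longrightarrow> lin X (tprod V W) (\<lambda>x. tscale c (g x))"
  "lin X Kspace h \<Longrightarrow> t \<in> carr (tprod V W) \<Longrightarrow> lin X (tprod V W) (\<lambda>x. tscale (h x) t)"
  using lin_scl2[OF vspace_tprod, of X V W g c] lin_scl1[OF vspace_tprod, of X h t V W] by simp_all

text \<open>Kept out of the default rules because both directions are wanted: left to right it
  spreads a factor over a sum so that sums can be regrouped, right to left it pulls constants out so
  that a counit law applies.\<close>

lemma sw_mult: "c * sw V W t f = sw V W t (\<lambda>a b. (c::'k::field) * f a b)"
  "sw V W t f * c = sw V W t (\<lambda>a b. f a b * c)"
  by (simp_all add: sw_eq_sum_list case_prod_unfold sum_list_const_mult sum_list_mult_const)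

declare sw_cong [cong]

subsection \<open>Coalgebras and Yetter-Drinfeld modules\<close>

locale coalg =
  fixes C :: "('k::field, 'c::ab_group_add, 'z) coalg_scheme"
  assumes coalgebra: "coalgebra C"
begin

lemma vsp [simp]: "vspace C" and lin_cop: "lin C (tprod C C) (\<Delta>\<^bsub>C\<^esub>)" and lin_cou: "lin C Kspace (\<epsilon>\<^bsub>C\<^esub>)"
  using coalgebra by (simp_all add: coalgebra_def)

lemmas [simp] = linD[OF lin_cop] linD[OF lin_cou]

text \<open>Summing a trilinear \<open>F\<close> over the two tensors of the axiom turns it into a
  rule for nested sums. Read from left to right it nests iterated comultiplications to the
  right.\<close>

lemma coassoc:
  assumes [simp]: "x \<in> carr C" "\<And>b c. b \<in> carr C \<Longrightarrow> c \<in> carr C \<Longrightarrow> lin C Kspace (\<lambda>a. F a b c)"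
    "\<And>a c. a \<in> carr C \<Longrightarrow> c \<in> carr C \<Longrightarrow> lin C Kspace (\<lambda>b. F a b c)"
    "\<And>a b. a \<in> carr C \<Longrightarrow> b \<in> carr C \<Longrightarrow> lin C Kspace (\<lambda>c. F a b c)"
  shows "sw C C (\<Delta>\<^bsub>C\<^esub> x) (\<lambda>a b. sw C C (\<Delta>\<^bsub>C\<^esub> a) (\<lambda>c d. F c d b)) =
    sw C C (\<Delta>\<^bsub>C\<^esub> x) (\<lambda>a b. sw C C (\<Delta>\<^bsub>C\<^esub> b) (\<lambda>c d. F a c d))"
proof -
  have "sw C C (\<Delta>\<^bsub>C\<^esub> x) (\<lambda>a b. sw C C (\<Delta>\<^bsub>C\<^esub> a) (\<lambda>c d. tens C (tprod C C) c (tens C C d b)))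
          = sw C C (\<Delta>\<^bsub>C\<^esub> x) (\<lambda>a b. tens C (tprod C C) a (\<Delta>\<^bsub>C\<^esub> b))"
    using coalgebra by (simp add: coalgebra_def)
  then have "sw C (tprod C C) (sw C C (\<Delta>\<^bsub>C\<^esub> x) (\<lambda>a b. sw C C (\<Delta>\<^bsub>C\<^esub> a) (\<lambda>c d. tens C (tprod C C) c (tens C C d b)))) (\<lambda>a t. sw C C t (F a))
          = sw C (tprod C C) (sw C C (\<Delta>\<^bsub>C\<^esub> x) (\<lambda>a b. tens C (tprod C C) a (\<Delta>\<^bsub>C\<^esub> b))) (\<lambda>a t. sw C C t (F a))"
    by simp
  then show ?thesis by simp
qed

lemma counit:
  assumes [simp]: "x \<in> carr C" "lin C Kspace F"
  shows "sw C C (\<Delta>\<^bsub>C\<^esub> x) (\<lambda>a b. \<epsilon>\<^bsub>C\<^esub> a * F b) = F x" "sw C C (\<Delta>\<^bsub>C\<^esub> x) (\<lambda>a b. \<epsilon>\<^bsub>C\<^esub> b * F a) = F x"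
    "sw C C (\<Delta>\<^bsub>C\<^esub> x) (\<lambda>a b. F b * \<epsilon>\<^bsub>C\<^esub> a) = F x" "sw C C (\<Delta>\<^bsub>C\<^esub> x) (\<lambda>a b. F a * \<epsilon>\<^bsub>C\<^esub> b) = F x"
proof -
  note [simp] = linD[OF assms(2)]
  have "F (sw C C (\<Delta>\<^bsub>C\<^esub> x) (\<lambda>a b. scl C (\<epsilon>\<^bsub>C\<^esub> a) b)) = F x" "F (sw C C (\<Delta>\<^bsub>C\<^esub> x) (\<lambda>a b. scl C (\<epsilon>\<^bsub>C\<^esub> b) a)) = F x"
    using coalgebra by (simp_all add: coalgebra_def)
  then show "sw C C (\<Delta>\<^bsub>C\<^esub> x) (\<lambda>a b. \<epsilon>\<^bsub>C\<^esub> a * F b) = F x" "sw C C (\<Delta>\<^bsub>C\<^esub> x) (\<lambda>a b. \<epsilon>\<^bsub>C\<^esub> b * F a) = F x"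
     "sw C C (\<Delta>\<^bsub>C\<^esub> x) (\<lambda>a b. F b * \<epsilon>\<^bsub>C\<^esub> a) = F x" "sw C C (\<Delta>\<^bsub>C\<^esub> x) (\<lambda>a b. F a * \<epsilon>\<^bsub>C\<^esub> b) = F x"
    by (simp_all add: mult.commute)
qed

end

text \<open>Records such as \<open>ytens\<close> and \<open>ctens\<close> have the carrier and the
  scalars of \<open>tprod\<close> but further fields. The listed notions read only these two fields,
  so all such records can be normalised to the plain tensor product.\<close>

lemma sw_vs_cong:
  assumes "carr V = carr V'" "scl V = scl V'"
  shows "tens V W = tens V' W" "tens W V = tens W V'" "sw V W = sw V' W" "sw W V = sw W V'"
    "lin V = lin V'" "lin W V = lin W V'" "tprod V W = tprod V' W" "tprod W V = tprod W V'"
    "vspace V = vspace V'" "bilin V W U = bilin V' W U" "bilin W V U = bilin W V' U" "bilin W U V = bilin W U V'"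
proof -
  have t: "tens V W = tens V' W" "tens W V = tens W V'"
    by (simp_all add: fun_eq_iff Rep_tensor_inject[symmetric] tens.rep_eq ambient_def assms(2))
  show "tens V W = tens V' W" "tens W V = tens W V'" by (fact t)+
  show "sw V W = sw V' W" "sw W V = sw W V'" by (intro ext, simp only: sw_def assms t)+
  show "lin V = lin V'" "lin W V = lin W V'" by (intro ext, simp only: lin_def assms)+
  show "tprod V W = tprod V' W" "tprod W V = tprod W V'" by (simp_all only: tprod_def assms t)
  show "vspace V = vspace V'" by (simp only: vspace_def assms)
  show "bilin V W U = bilin V' W U" "bilin W V U = bilin W V' U" "bilin W U V = bilin W U V'"
    by (intro ext, simp only: bilin_def lin_def assms)+
qed

lemma carr_ytens [simp]: "carr (ytens H C D) = carr (tprod C D)"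
  and scl_ytens [simp]: "scl (ytens H C D) = tscale"
  by (simp_all add: ytens_def)

lemmas ytens_norm [simp] = sw_vs_cong[where V = "ytens H C D" and V' = "tprod C D" for H C D, simplified]

lemma tprod_ext:
  assumes "vspace V" "vspace W" "vspace U" "lin (tprod V W) U f" "lin (tprod V W) U g"
    "\<And>v w. v \<in> carr V \<Longrightarrow> w \<in> carr W \<Longrightarrow> f (tens V W v w) = g (tens V W v w)" "t \<in> carr (tprod V W)"
  shows "f t = g t"
proof -
  have "f t = f (sw V W t (tens V W))" using sw_id assms by metis
  also have "\<dots> = sw V W t (\<lambda>v w. f (tens V W v w))" using assms by (simp add: lin_sw'[OF assms(4)])
  also have "\<dots> = sw V W t (\<lambda>v w. g (tens V W v w))" using assms by simp
  also have "\<dots> = g (sw V W t (tens V W))" using assms by (simp add: lin_sw'[OF assms(5)])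
  also have "\<dots> = g t" using sw_id assms by metis
  finally show ?thesis .
qed

locale hopf_alg =
  fixes H :: "('k::field, 'h::ab_group_add, 'z) hopf_scheme"
  assumes hopf: "hopf_algebra H"

locale bialg =
  fixes B :: "('k::field, 'b::ab_group_add, 'z) bialg_scheme"
  assumes bialgebra: "bialgebra B"
begin

sublocale coalg B using bialgebra by unfold_locales (simp add: bialgebra_def)

lemma bilin_mul: "bilin B B B (mul B)" using bialgebra by (simp add: bialgebra_def)

lemmas [simp] = bilinD[OF bilin_mul]

lemma mul_assoc [simp]: "x \<in> carr B \<Longrightarrow> y \<in> carr B \<Longrightarrow> z \<in> carr B \<Longrightarrow> (x \<cdot>\<^bsub>B\<^esub> y) \<cdot>\<^bsub>B\<^esub> z = x \<cdot>\<^bsub>B\<^esub> (y \<cdot>\<^bsub>B\<^esub> z)"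
  and unt_carr [simp]: "\<one>\<^bsub>B\<^esub> \<in> carr B"
  and unt_mul [simp]: "x \<in> carr B \<Longrightarrow> \<one>\<^bsub>B\<^esub> \<cdot>\<^bsub>B\<^esub> x = x" "x \<in> carr B \<Longrightarrow> x \<cdot>\<^bsub>B\<^esub> \<one>\<^bsub>B\<^esub> = x"
  and cop_mul [simp]: "x \<in> carr B \<Longrightarrow> y \<in> carr B \<Longrightarrow> \<Delta>\<^bsub>B\<^esub> (x \<cdot>\<^bsub>B\<^esub> y) =
     sw B B (\<Delta>\<^bsub>B\<^esub> x) (\<lambda>x1 x2. sw B B (\<Delta>\<^bsub>B\<^esub> y) (\<lambda>y1 y2. tens B B (x1 \<cdot>\<^bsub>B\<^esub> y1) (x2 \<cdot>\<^bsub>B\<^esub> y2)))"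
  and cou_mul [simp]: "x \<in> carr B \<Longrightarrow> y \<in> carr B \<Longrightarrow> \<epsilon>\<^bsub>B\<^esub> (x \<cdot>\<^bsub>B\<^esub> y) = \<epsilon>\<^bsub>B\<^esub> x * \<epsilon>\<^bsub>B\<^esub> y"
  and cop_unt [simp]: "\<Delta>\<^bsub>B\<^esub> \<one>\<^bsub>B\<^esub> = tens B B \<one>\<^bsub>B\<^esub> \<one>\<^bsub>B\<^esub>" and cou_unt [simp]: "\<epsilon>\<^bsub>B\<^esub> \<one>\<^bsub>B\<^esub> = 1"
  using bialgebra by (simp_all add: bialgebra_def)

end

context hopf_alg begin

sublocale H: bialg H using hopf by unfold_locales (simp add: hopf_algebra_def)

lemma lin_antip: "lin H H (\<S>\<^bsub>H\<^esub>)" using hopf by (simp add: hopf_algebra_def)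

lemmas [simp] = linD[OF lin_antip]

end

section \<open>Module coalgebras, comodule coalgebras and their braided tensor product\<close>

locale h_coalg = hopf_alg H + coalg C
  for H :: "('k::field, 'h::ab_group_add, 'z) hopf_scheme"
    and C :: "('k, 'h, 'c::ab_group_add, 'y) ydcoalg_scheme"

locale mod_coalg = h_coalg +
  assumes bilin_act: "bilin H C C (act C)"
    and act_unt [simp]: "v \<in> carr C \<Longrightarrow> act C \<one>\<^bsub>H\<^esub> v = v"
    and act_mul [simp]: "g \<in> carr H \<Longrightarrow> h \<in> carr H \<Longrightarrow> v \<in> carr C \<Longrightarrow> act C (g \<cdot>\<^bsub>H\<^esub> h) v = act C g (act C h v)"
    and cop_act [simp]: "h \<in> carr H \<Longrightarrow> v \<in> carr C \<Longrightarrow> \<Delta>\<^bsub>C\<^esub> (act C h v) =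
      sw H H (\<Delta>\<^bsub>H\<^esub> h) (\<lambda>h1 h2. sw C C (\<Delta>\<^bsub>C\<^esub> v) (\<lambda>v1 v2. tens C C (act C h1 v1) (act C h2 v2)))"
    and cou_act [simp]: "h \<in> carr H \<Longrightarrow> v \<in> carr C \<Longrightarrow> \<epsilon>\<^bsub>C\<^esub> (act C h v) = \<epsilon>\<^bsub>H\<^esub> h * \<epsilon>\<^bsub>C\<^esub> v"
begin
lemmas [simp] = bilinD[OF bilin_act]
end

locale comod_coalg = h_coalg +
  assumes lin_coact: "lin C (tprod H C) (\<rho>\<^bsub>C\<^esub>)"
    and comod': "x \<in> carr C \<Longrightarrow> sw H C (\<rho>\<^bsub>C\<^esub> x) (\<lambda>g v0. sw H H (\<Delta>\<^bsub>H\<^esub> g) (\<lambda>g1 g2. tens H (tprod H C) g1 (tens H C g2 v0)))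
          = sw H C (\<rho>\<^bsub>C\<^esub> x) (\<lambda>g v0. tens H (tprod H C) g (\<rho>\<^bsub>C\<^esub> v0))"
    and counit': "x \<in> carr C \<Longrightarrow> sw H C (\<rho>\<^bsub>C\<^esub> x) (\<lambda>g v0. scl C (\<epsilon>\<^bsub>H\<^esub> g) v0) = x"
    and cop_colin': "x \<in> carr C \<Longrightarrow>
      sw H C (\<rho>\<^bsub>C\<^esub> x) (\<lambda>g x0. tens H (tprod C C) g (\<Delta>\<^bsub>C\<^esub> x0)) =
      sw C C (\<Delta>\<^bsub>C\<^esub> x) (\<lambda>a b. sw H C (\<rho>\<^bsub>C\<^esub> a) (\<lambda>g a0. sw H C (\<rho>\<^bsub>C\<^esub> b) (\<lambda>k b0.
        tens H (tprod C C) (g \<cdot>\<^bsub>H\<^esub> k) (tens C C a0 b0))))"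
    and cou_colin': "x \<in> carr C \<Longrightarrow> sw H C (\<rho>\<^bsub>C\<^esub> x) (\<lambda>g c0. scl H (\<epsilon>\<^bsub>C\<^esub> c0) g) = scl H (\<epsilon>\<^bsub>C\<^esub> x) \<one>\<^bsub>H\<^esub>"
begin
lemmas [simp] = linD[OF lin_coact]

lemma comod:
  assumes [simp]: "x \<in> carr C" "\<And>b c. b \<in> carr H \<Longrightarrow> c \<in> carr C \<Longrightarrow> lin H Kspace (\<lambda>a. F a b c)"
    "\<And>a c. a \<in> carr H \<Longrightarrow> c \<in> carr C \<Longrightarrow> lin H Kspace (\<lambda>b. F a b c)"
    "\<And>a b. a \<in> carr H \<Longrightarrow> b \<in> carr H \<Longrightarrow> lin C Kspace (\<lambda>c. F a b c)"
  shows "sw H C (\<rho>\<^bsub>C\<^esub> x) (\<lambda>g a. sw H C (\<rho>\<^bsub>C\<^esub> a) (\<lambda>h b. F g h b)) =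
    sw H C (\<rho>\<^bsub>C\<^esub> x) (\<lambda>g a. sw H H (\<Delta>\<^bsub>H\<^esub> g) (\<lambda>h k. F h k a))"
  using arg_cong[OF comod'[OF assms(1)], of "\<lambda>t. sw H (tprod H C) t (\<lambda>g s. sw H C s (F g))"] by simp

lemma counit_coact:
  assumes [simp]: "x \<in> carr C" "lin C Kspace F"
  shows "sw H C (\<rho>\<^bsub>C\<^esub> x) (\<lambda>g a. \<epsilon>\<^bsub>H\<^esub> g * F a) = F x" "sw H C (\<rho>\<^bsub>C\<^esub> x) (\<lambda>g a. F a * \<epsilon>\<^bsub>H\<^esub> g) = F x"
proof -
  note [simp] = linD[OF assms(2)]
  show "sw H C (\<rho>\<^bsub>C\<^esub> x) (\<lambda>g a. \<epsilon>\<^bsub>H\<^esub> g * F a) = F x" "sw H C (\<rho>\<^bsub>C\<^esub> x) (\<lambda>g a. F a * \<epsilon>\<^bsub>H\<^esub> g) = F x"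
    using arg_cong[OF counit'[OF assms(1)], of F] by (simp_all add: mult.commute)
qed

lemma cop_colin:
  assumes [simp]: "x \<in> carr C" "\<And>b c. b \<in> carr C \<Longrightarrow> c \<in> carr C \<Longrightarrow> lin H Kspace (\<lambda>a. F a b c)"
    "\<And>a c. a \<in> carr H \<Longrightarrow> c \<in> carr C \<Longrightarrow> lin C Kspace (\<lambda>b. F a b c)"
    "\<And>a b. a \<in> carr H \<Longrightarrow> b \<in> carr C \<Longrightarrow> lin C Kspace (\<lambda>c. F a b c)"
  shows "sw H C (\<rho>\<^bsub>C\<^esub> x) (\<lambda>g x0. sw C C (\<Delta>\<^bsub>C\<^esub> x0) (F g)) =
    sw C C (\<Delta>\<^bsub>C\<^esub> x) (\<lambda>a b. sw H C (\<rho>\<^bsub>C\<^esub> a) (\<lambda>g a0. sw H C (\<rho>\<^bsub>C\<^esub> b) (\<lambda>k b0. F (g \<cdot>\<^bsub>H\<^esub> k) a0 b0)))"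
  using arg_cong[OF cop_colin'[OF assms(1)], of "\<lambda>t. sw H (tprod C C) t (\<lambda>g s. sw C C s (F g))"] by simp

lemma cou_colin:
  assumes [simp]: "x \<in> carr C" "lin H Kspace F"
  shows "sw H C (\<rho>\<^bsub>C\<^esub> x) (\<lambda>g a. \<epsilon>\<^bsub>C\<^esub> a * F g) = \<epsilon>\<^bsub>C\<^esub> x * F \<one>\<^bsub>H\<^esub>" "sw H C (\<rho>\<^bsub>C\<^esub> x) (\<lambda>g a. F g * \<epsilon>\<^bsub>C\<^esub> a) = \<epsilon>\<^bsub>C\<^esub> x * F \<one>\<^bsub>H\<^esub>"
proof -
  note [simp] = linD[OF assms(2)]
  show "sw H C (\<rho>\<^bsub>C\<^esub> x) (\<lambda>g a. \<epsilon>\<^bsub>C\<^esub> a * F g) = \<epsilon>\<^bsub>C\<^esub> x * F \<one>\<^bsub>H\<^esub>" "sw H C (\<rho>\<^bsub>C\<^esub> x) (\<lambda>g a. F g * \<epsilon>\<^bsub>C\<^esub> a) = \<epsilon>\<^bsub>C\<^esub> x * F \<one>\<^bsub>H\<^esub>"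
    using arg_cong[OF cou_colin'[OF assms(1)], of F] by (simp_all add: mult.commute)
qed
end

text \<open>The comultiplication of the braided tensor product is built from the coaction on
  \<open>C\<close> and the action on \<open>D\<close>. Separating the two roles covers
  \<open>C = D = R\<close> as well as \<open>D = H\<close> with left multiplication, which gives the
  smash coalgebra.\<close>

locale comod_mod = C: comod_coalg H C + D: mod_coalg H D
  for H :: "('k::field, 'h::ab_group_add, 'z) hopf_scheme"
    and C :: "('k, 'h, 'c::ab_group_add, 'y) ydcoalg_scheme"
    and D :: "('k, 'h, 'd::ab_group_add, 'x) ydcoalg_scheme"
begin

lemmas swaps = sw_swap[of D D _ C C] sw_swap[of H C _ C C] sw_swap[of H C _ D D] sw_swap[of H H _ C C]
  sw_swap[of H H _ D D] sw_swap[of H H _ H C]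

lemma cop_ytens_lin [simp]: "lin (tprod C D) (tprod (tprod C D) (tprod C D)) (\<Delta>\<^bsub>ytens H C D\<^esub>)"
  by (simp add: ytens_def)

lemma cou_ytens_lin [simp]: "lin (tprod C D) Kspace (\<epsilon>\<^bsub>ytens H C D\<^esub>)"
  by (simp add: ytens_def)

lemmas [simp] = linD[OF cop_ytens_lin, unfolded scl_tprod] linD[OF cou_ytens_lin, unfolded scl_tprod scl_Kspace]

lemma cop_ytens_tens [simp]:
  assumes [simp]: "x \<in> carr C" "y \<in> carr D"
  shows "\<Delta>\<^bsub>ytens H C D\<^esub> (tens C D x y) = sw C C (\<Delta>\<^bsub>C\<^esub> x) (\<lambda>x1 x2. sw D D (\<Delta>\<^bsub>D\<^esub> y) (\<lambda>y1 y2.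
        sw H C (\<rho>\<^bsub>C\<^esub> x2) (\<lambda>g x20.
          tens (tprod C D) (tprod C D) (tens C D x1 (act D g y1)) (tens C D x20 y2))))"
  by (simp add: ytens_def sw_tens[where U="tprod (tprod C D) (tprod C D)"])

lemma cou_ytens_tens [simp]:
  assumes [simp]: "x \<in> carr C" "y \<in> carr D"
  shows "\<epsilon>\<^bsub>ytens H C D\<^esub> (tens C D x y) = \<epsilon>\<^bsub>C\<^esub> x * \<epsilon>\<^bsub>D\<^esub> y"
  by (simp add: ytens_def)

text \<open>The braiding is compatible with both comultiplications: with that of \<open>C\<close>
  because it is colinear, with that of \<open>D\<close> because it is H-linear.\<close>

lemma coassoc_ytens:
  assumes x: "x \<in> carr (tprod C D)"
  defines "X \<equiv> tprod C D"
  shows "sw X X (\<Delta>\<^bsub>ytens H C D\<^esub> x) (\<lambda>a b. sw X X (\<Delta>\<^bsub>ytens H C D\<^esub> a) (\<lambda>c d. tens X (tprod X X) c (tens X X d b)))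
          = sw X X (\<Delta>\<^bsub>ytens H C D\<^esub> x) (\<lambda>a b. tens X (tprod X X) a (\<Delta>\<^bsub>ytens H C D\<^esub> b))"
proof (rule eq_by_forms)
  fix \<phi> assume \<phi>: "lin (tprod X (tprod X X)) Kspace \<phi>"
  note [simp] = linD[OF \<phi>[unfolded X_def]]
  let ?L = "\<lambda>x. \<phi> (sw X X (\<Delta>\<^bsub>ytens H C D\<^esub> x) (\<lambda>a b. sw X X (\<Delta>\<^bsub>ytens H C D\<^esub> a) (\<lambda>c d. tens X (tprod X X) c (tens X X d b))))"
  let ?R = "\<lambda>x. \<phi> (sw X X (\<Delta>\<^bsub>ytens H C D\<^esub> x) (\<lambda>a b. tens X (tprod X X) a (\<Delta>\<^bsub>ytens H C D\<^esub> b)))"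
  show "?L x = ?R x"
  proof (rule tprod_ext[where f = ?L and g = ?R, OF _ _ vspace_Kspace _ _ _ x])
    show "lin (tprod C D) Kspace ?L" "lin (tprod C D) Kspace ?R"  unfolding X_def by simp_all
  next
    fix x y assume [simp]: "x \<in> carr C" "y \<in> carr D"
    show "?L (tens C D x y) = ?R (tens C D x y)"
      unfolding X_def
      apply (simp)
      apply (simp add: swaps C.coassoc D.coassoc C.cop_colin C.comod)
      \<comment> \<open>Two coaction sums over the same spaces must change places; as a rewrite rule
        this exchange has no preferred direction.\<close>
      apply (subst sw_swap[of H C _ H C])
      apply (rule refl)
      done
  qed (simp_all add: X_def)
qed (simp_all add: x, unfold X_def, simp_all add: x)

lemma coalgebra_ytens: "coalgebra (ytens H C D)"
proof -
  have "sw X X (\<Delta>\<^bsub>ytens H C D\<^esub> x) (\<lambda>a b. scl X (\<epsilon>\<^bsub>ytens H C D\<^esub> a) b) = x \<and>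
        sw X X (\<Delta>\<^bsub>ytens H C D\<^esub> x) (\<lambda>a b. scl X (\<epsilon>\<^bsub>ytens H C D\<^esub> b) a) = x"
    if x [simp]: "x \<in> carr (tprod C D)" and X: "X = tprod C D" for X x
    unfolding X
  proof (intro conjI; rule eq_by_forms)
    fix \<phi> assume \<phi>: "lin (tprod C D) Kspace \<phi>"
    note [simp] = linD[OF \<phi>, unfolded scl_tprod scl_Kspace]
    show "\<phi> (sw (tprod C D) (tprod C D) (\<Delta>\<^bsub>ytens H C D\<^esub> x) (\<lambda>a b. scl (tprod C D) (\<epsilon>\<^bsub>ytens H C D\<^esub> a) b)) = \<phi> x"
     unfolding X
      apply (rule tprod_ext[OF _ _ vspace_Kspace _ _ _ x])
      apply (simp_all add: X \<phi>)
      apply (simp add: mult.assoc C.counit D.counit C.counit_coact C.cou_colin sw_mult[symmetric])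
      done
    show "\<phi> (sw (tprod C D) (tprod C D) (\<Delta>\<^bsub>ytens H C D\<^esub> x) (\<lambda>a b. scl (tprod C D) (\<epsilon>\<^bsub>ytens H C D\<^esub> b) a)) = \<phi> x"
      apply (rule tprod_ext[OF _ _ vspace_Kspace _ _ _ x])
      apply (simp_all add: X \<phi>)
      apply (simp add: mult.assoc C.counit D.counit C.counit_coact C.cou_colin sw_mult[symmetric])
      done
  qed (simp_all add: X x)
  then show ?thesis
    using coassoc_ytens unfolding coalgebra_def ytens_norm carr_ytens by simp
qed

end

locale yd = comod_coalg H C + mod_coalg H C
  for H :: "('k::field, 'h::ab_group_add, 'z) hopf_scheme"
    and C :: "('k, 'h, 'c::ab_group_add, 'y) ydcoalg_scheme" +
  assumes coact_act [simp]: "h \<in> carr H \<Longrightarrow> v \<in> carr C \<Longrightarrow> \<rho>\<^bsub>C\<^esub> (act C h v) =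
          sw H H (\<Delta>\<^bsub>H\<^esub> h) (\<lambda>h1 h'. sw H H (\<Delta>\<^bsub>H\<^esub> h') (\<lambda>h2 h3. sw H C (\<rho>\<^bsub>C\<^esub> v) (\<lambda>g v0.
            tens H C (h1 \<cdot>\<^bsub>H\<^esub> g \<cdot>\<^bsub>H\<^esub> \<S>\<^bsub>H\<^esub> h3) (act C h2 v0))))"

context hopf_alg begin
lemma antip':
  assumes h: "h \<in> carr H"
  shows "sw H H (\<Delta>\<^bsub>H\<^esub> h) (\<lambda>h1 h2. \<S>\<^bsub>H\<^esub> h1 \<cdot>\<^bsub>H\<^esub> h2) = scl H (\<epsilon>\<^bsub>H\<^esub> h) \<one>\<^bsub>H\<^esub>"
  "sw H H (\<Delta>\<^bsub>H\<^esub> h) (\<lambda>h1 h2. h1 \<cdot>\<^bsub>H\<^esub> \<S>\<^bsub>H\<^esub> h2) = scl H (\<epsilon>\<^bsub>H\<^esub> h) \<one>\<^bsub>H\<^esub>"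
  using hopf h by (simp_all add: hopf_algebra_def)

lemma antip:
  assumes h [simp]: "h \<in> carr H" and F: "lin H Kspace F"
  shows "sw H H (\<Delta>\<^bsub>H\<^esub> h) (\<lambda>h1 h2. F (\<S>\<^bsub>H\<^esub> h1 \<cdot>\<^bsub>H\<^esub> h2)) = \<epsilon>\<^bsub>H\<^esub> h * F \<one>\<^bsub>H\<^esub>"
    "sw H H (\<Delta>\<^bsub>H\<^esub> h) (\<lambda>h1 h2. F (h1 \<cdot>\<^bsub>H\<^esub> \<S>\<^bsub>H\<^esub> h2)) = \<epsilon>\<^bsub>H\<^esub> h * F \<one>\<^bsub>H\<^esub>"
proof -
  note [simp] = linD[OF F]
  show "sw H H (\<Delta>\<^bsub>H\<^esub> h) (\<lambda>h1 h2. F (\<S>\<^bsub>H\<^esub> h1 \<cdot>\<^bsub>H\<^esub> h2)) = \<epsilon>\<^bsub>H\<^esub> h * F \<one>\<^bsub>H\<^esub>"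
    "sw H H (\<Delta>\<^bsub>H\<^esub> h) (\<lambda>h1 h2. F (h1 \<cdot>\<^bsub>H\<^esub> \<S>\<^bsub>H\<^esub> h2)) = \<epsilon>\<^bsub>H\<^esub> h * F \<one>\<^bsub>H\<^esub>"
    using arg_cong[OF antip'(1)[OF h], of F] arg_cong[OF antip'(2)[OF h], of F] by simp_all
qed

end

context yd begin

text \<open>Form of the Yetter-Drinfeld condition without antipode: the extra factor of
  \<open>h\<close> on the right cancels the antipode in \<open>coact_act\<close>. It expresses that
  the braiding is H-linear. Where it is used, \<open>coact_act\<close> is switched off, since
  unfolding the coaction would bring the antipode back.\<close>

lemma braid:
  assumes [simp]: "h \<in> carr H" "v \<in> carr C" "\<And>b. b \<in> carr C \<Longrightarrow> lin H Kspace (\<lambda>a. F a b)"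
    "\<And>a. a \<in> carr H \<Longrightarrow> lin C Kspace (F a)"
  shows "sw H H (\<Delta>\<^bsub>H\<^esub> h) (\<lambda>h1 h2. sw H C (\<rho>\<^bsub>C\<^esub> (act C h1 v)) (\<lambda>g w. F (g \<cdot>\<^bsub>H\<^esub> h2) w)) =
    sw H H (\<Delta>\<^bsub>H\<^esub> h) (\<lambda>h1 h2. sw H C (\<rho>\<^bsub>C\<^esub> v) (\<lambda>g w. F (h1 \<cdot>\<^bsub>H\<^esub> g) (act C h2 w)))"
proof -
  note [simp] = lin_comp[OF assms(3)] lin_comp[OF assms(4)]
  have [simp]: "sw H H (\<Delta>\<^bsub>H\<^esub> k) (\<lambda>p q. F (a \<cdot>\<^bsub>H\<^esub> (g \<cdot>\<^bsub>H\<^esub> (\<S>\<^bsub>H\<^esub> p \<cdot>\<^bsub>H\<^esub> q))) w) = \<epsilon>\<^bsub>H\<^esub> k * F (a \<cdot>\<^bsub>H\<^esub> g) w"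
    if "a \<in> carr H" "g \<in> carr H" "k \<in> carr H" "w \<in> carr C" for a g k w
    using antip(1)[of k "\<lambda>u. F (a \<cdot>\<^bsub>H\<^esub> (g \<cdot>\<^bsub>H\<^esub> u)) w"] that by simp
  show ?thesis
    by (simp add: H.coassoc sw_swap[of H H _ H C]) (simp add: sw_mult[symmetric] H.counit)
qed

end

context comod_mod begin

lemma act_ytens_bilin:
  assumes "mod_coalg H C"
  shows "bilin H (tprod C D) (tprod C D) (act (ytens H C D))"
proof -
  interpret C: mod_coalg H C by fact
  show ?thesis by (simp add: ytens_def)
qed

lemma act_ytens_tens:
  assumes "mod_coalg H C" and [simp]: "h \<in> carr H" "x \<in> carr C" "y \<in> carr D"
  shows "act (ytens H C D) h (tens C D x y) = sw H H (\<Delta>\<^bsub>H\<^esub> h) (\<lambda>h1 h2. tens C D (act C h1 x) (act D h2 y))"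
proof -
  interpret C: mod_coalg H C by fact
  show ?thesis by (simp add: ytens_def sw_tens[where U="tprod C D"])
qed

text \<open>The comultiplication of \<open>C \<otimes> D\<close> is H-linear because the braiding
  is, which rests on the Yetter-Drinfeld condition in \<open>C\<close>. For \<open>D\<close> a
  module coalgebra is enough, so the result applies to \<open>R \<otimes> H\<close>.\<close>

lemma mod_coalg_ytens:
  assumes "yd H C"
  shows "mod_coalg H (ytens H C D)"
proof -
  interpret C: yd H C by fact
  have M: "mod_coalg H C" by unfold_locales
  note act_ytens_tens[OF M, simp] bilinD[OF act_ytens_bilin[OF M], simp]
  have 1: "act (ytens H C D) \<one>\<^bsub>H\<^esub> v = v" if "v \<in> carr (tprod C D)" for v
    by (rule tprod_ext[OF _ _ vspace_tprod[of C D] _ _ _ that, where f = "act (ytens H C D) \<one>\<^bsub>H\<^esub>"])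
      (simp_all add: sw_tens[where U="tprod C D"] bilin_lin(2)[OF act_ytens_bilin[OF M]])
  have 2: "act (ytens H C D) (g \<cdot>\<^bsub>H\<^esub> h) v = act (ytens H C D) g (act (ytens H C D) h v)"
    if [simp]: "g \<in> carr H" "h \<in> carr H" and v: "v \<in> carr (tprod C D)" for g h v
  proof (rule eq_by_forms)
    fix \<phi> assume \<phi>: "lin (tprod C D) Kspace \<phi>"
    note [simp] = linD[OF \<phi>, unfolded scl_tprod scl_Kspace]
    show "\<phi> (act (ytens H C D) (g \<cdot>\<^bsub>H\<^esub> h) v) = \<phi> (act (ytens H C D) g (act (ytens H C D) h v))"
      apply (rule tprod_ext[OF _ _ vspace_Kspace _ _ _ v])
      apply simp_all
      apply (subst sw_swap)
      apply (rule refl)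
      done
  qed (simp_all add: v)
  have 3: "\<Delta>\<^bsub>ytens H C D\<^esub> (act (ytens H C D) h v) =
      sw H H (\<Delta>\<^bsub>H\<^esub> h) (\<lambda>h1 h2. sw (tprod C D) (tprod C D) (\<Delta>\<^bsub>ytens H C D\<^esub> v) (\<lambda>v1 v2.
        tens (tprod C D) (tprod C D) (act (ytens H C D) h1 v1) (act (ytens H C D) h2 v2)))"
    if [simp]: "h \<in> carr H" and v: "v \<in> carr (tprod C D)" for h v
  proof (rule eq_by_forms)
    fix \<phi> assume \<phi>: "lin (tprod (tprod C D) (tprod C D)) Kspace \<phi>"
    note [simp] = linD[OF \<phi>, unfolded scl_tprod scl_Kspace]
    let ?X = "tprod C D"
    \<comment> \<open>\<open>C.braid\<close> inside a threefold comultiplication of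
      \<open>k\<close>: coassociativity brings the first two factors together, they are exchanged,
      and the nesting is restored.\<close>
    have braid3: "sw H H (\<Delta>\<^bsub>H\<^esub> k) (\<lambda>p q. sw H C (\<rho>\<^bsub>C\<^esub> (act C p x)) (\<lambda>g x'. sw H H (\<Delta>\<^bsub>H\<^esub> q) (\<lambda>q1 q2.
        \<phi> (tens ?X ?X (tens C D a (act D g (act D q1 y))) (tens C D x' (act D q2 z)))))) =
      sw H H (\<Delta>\<^bsub>H\<^esub> k) (\<lambda>p q. sw H C (\<rho>\<^bsub>C\<^esub> x) (\<lambda>g x'. sw H H (\<Delta>\<^bsub>H\<^esub> q) (\<lambda>q1 q2.
        \<phi> (tens ?X ?X (tens C D a (act D p (act D g y))) (tens C D (act C q1 x') (act D q2 z))))))"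
      (is "?L = ?R")
      if [simp]: "k \<in> carr H" "y \<in> carr D" "z \<in> carr D" "a \<in> carr C" "x \<in> carr C" for k x y z a
    proof -
      let ?F = "\<lambda>p q r. sw H C (\<rho>\<^bsub>C\<^esub> (act C p x)) (\<lambda>g x'.
        \<phi> (tens ?X ?X (tens C D a (act D g (act D q y))) (tens C D x' (act D r z))))"
      have "?L = sw H H (\<Delta>\<^bsub>H\<^esub> k) (\<lambda>p q. sw H H (\<Delta>\<^bsub>H\<^esub> q) (\<lambda>q1 q2. ?F p q1 q2))"
        by (subst sw_swap[of H C _ H H]) (rule refl)
      also have "\<dots> = sw H H (\<Delta>\<^bsub>H\<^esub> k) (\<lambda>p q. sw H H (\<Delta>\<^bsub>H\<^esub> p) (\<lambda>p1 p2. ?F p1 p2 q))"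
        by (rule C.H.coassoc[symmetric]) (simp_all del: C.coact_act)
      also have "\<dots> = sw H H (\<Delta>\<^bsub>H\<^esub> k) (\<lambda>p q. sw H H (\<Delta>\<^bsub>H\<^esub> p) (\<lambda>p1 p2. sw H C (\<rho>\<^bsub>C\<^esub> x) (\<lambda>g x'.
        \<phi> (tens ?X ?X (tens C D a (act D p1 (act D g y))) (tens C D (act C p2 x') (act D q z))))))"
      proof (rule sw_cong)
        fix p q assume [simp]: "p \<in> carr H" "q \<in> carr H"
        show "sw H H (\<Delta>\<^bsub>H\<^esub> p) (\<lambda>p1 p2. ?F p1 p2 q) = sw H H (\<Delta>\<^bsub>H\<^esub> p) (\<lambda>p1 p2. sw H C (\<rho>\<^bsub>C\<^esub> x) (\<lambda>g x'.
        \<phi> (tens ?X ?X (tens C D a (act D p1 (act D g y))) (tens C D (act C p2 x') (act D q z)))))"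
          using C.braid[of p x "\<lambda>g x'. \<phi> (tens ?X ?X (tens C D a (act D g y)) (tens C D x' (act D q z)))"]
          by (simp del: C.coact_act)
      qed simp_all
      also have "\<dots> = ?R"
        by (simp add: C.H.coassoc sw_swap[of H C _ H H])
      finally show ?thesis .
    qed
    show "\<phi> (\<Delta>\<^bsub>ytens H C D\<^esub> (act (ytens H C D) h v)) =
      \<phi> (sw H H (\<Delta>\<^bsub>H\<^esub> h) (\<lambda>h1 h2. sw (tprod C D) (tprod C D) (\<Delta>\<^bsub>ytens H C D\<^esub> v) (\<lambda>v1 v2.
        tens (tprod C D) (tprod C D) (act (ytens H C D) h1 v1) (act (ytens H C D) h2 v2))))"
      apply (rule tprod_ext[OF _ _ vspace_Kspace _ _ _ v])
      apply (simp_all del: C.coact_act)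
      apply (simp add: swaps C.H.coassoc del: C.coact_act)
      apply (simp add: braid3 swaps del: C.coact_act)
      apply (rule sym)
      apply (subst sw_swap[of H H _ H H])
      apply (simp add: C.H.coassoc)
      done
  qed (simp_all add: v)
  have 4: "\<epsilon>\<^bsub>ytens H C D\<^esub> (act (ytens H C D) h v) = \<epsilon>\<^bsub>H\<^esub> h * \<epsilon>\<^bsub>ytens H C D\<^esub> v"
    if [simp]: "h \<in> carr H" and v: "v \<in> carr (tprod C D)" for h v
    apply (rule tprod_ext[OF _ _ vspace_Kspace _ _ _ v])
    apply (simp_all add: mult.assoc)
    apply (simp add: sw_mult[symmetric] C.H.counit mult.left_commute)
    done
  show ?thesis
    apply unfold_locales
    unfolding ytens_norm carr_ytens
    by (simp_all add: coalgebra_ytens 1 2 3 4 act_ytens_bilin[OF M] del: bilin_iff)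
qed

end

locale comod_yd = C: comod_coalg H C + D: yd H D
  for H :: "('k::field, 'h::ab_group_add, 'z) hopf_scheme"
    and C :: "('k, 'h, 'c::ab_group_add, 'y) ydcoalg_scheme"
    and D :: "('k, 'h, 'd::ab_group_add, 'x) ydcoalg_scheme"
begin
sublocale comod_mod H C D ..

lemmas swaps2 = sw_swap[of H D _ C C] sw_swap[of H D _ D D] sw_swap[of H D _ H C] sw_swap[of H H _ H D]

lemma coact_ytens_lin: "lin (tprod C D) (tprod H (tprod C D)) (\<rho>\<^bsub>ytens H C D\<^esub>)"
  by (simp add: ytens_def)

lemmas [simp] = linD[OF coact_ytens_lin, unfolded scl_tprod]

lemma coact_ytens_tens [simp]:
  assumes [simp]: "x \<in> carr C" "y \<in> carr D"
  shows "\<rho>\<^bsub>ytens H C D\<^esub> (tens C D x y) = sw H C (\<rho>\<^bsub>C\<^esub> x) (\<lambda>g x0. sw H D (\<rho>\<^bsub>D\<^esub> y) (\<lambda>g' y0.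
        tens H (tprod C D) (g \<cdot>\<^bsub>H\<^esub> g') (tens C D x0 y0)))"
  by (simp add: ytens_def sw_tens[where U="tprod H (tprod C D)"])

text \<open>Dual to \<open>mod_coalg_ytens\<close>: colinearity of the braiding comes from the
  Yetter-Drinfeld condition in \<open>D\<close>, the factor that is acted on.\<close>

lemma comod_coalg_ytens: "comod_coalg H (ytens H C D)"
proof -
  have 1: "sw H X (\<rho>\<^bsub>ytens H C D\<^esub> x) (\<lambda>g v0. sw H H (\<Delta>\<^bsub>H\<^esub> g) (\<lambda>g1 g2. tens H (tprod H X) g1 (tens H X g2 v0)))
          = sw H X (\<rho>\<^bsub>ytens H C D\<^esub> x) (\<lambda>g v0. tens H (tprod H X) g (\<rho>\<^bsub>ytens H C D\<^esub> v0))"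
    if x [simp]: "x \<in> carr (tprod C D)" and X: "X = tprod C D" for X x
    unfolding X
  proof (rule eq_by_forms)
    fix \<phi> assume \<phi>: "lin (tprod H (tprod H (tprod C D))) Kspace \<phi>"
    note [simp] = linD[OF \<phi>, unfolded scl_tprod scl_Kspace]
    show "\<phi> (sw H (tprod C D) (\<rho>\<^bsub>ytens H C D\<^esub> x) (\<lambda>g v0. sw H H (\<Delta>\<^bsub>H\<^esub> g) (\<lambda>g1 g2. tens H (tprod H (tprod C D)) g1 (tens H (tprod C D) g2 v0))))
          = \<phi> (sw H (tprod C D) (\<rho>\<^bsub>ytens H C D\<^esub> x) (\<lambda>g v0. tens H (tprod H (tprod C D)) g (\<rho>\<^bsub>ytens H C D\<^esub> v0)))"
      apply (rule tprod_ext[OF _ _ vspace_Kspace _ _ _ x])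
      apply (simp_all)
      apply (simp add: sw_swap[of H H _ H C] sw_swap[of H H _ H D] sw_swap[of H D _ H C] C.comod D.comod)
      done
  qed simp_all
  have 2: "sw H (tprod C D) (\<rho>\<^bsub>ytens H C D\<^esub> x) (\<lambda>g v0. tscale (\<epsilon>\<^bsub>H\<^esub> g) v0) = x"
    if x [simp]: "x \<in> carr (tprod C D)" for x
  proof (rule eq_by_forms)
    fix \<phi> assume \<phi>: "lin (tprod C D) Kspace \<phi>"
    note [simp] = linD[OF \<phi>, unfolded scl_tprod scl_Kspace]
    show "\<phi> (sw H (tprod C D) (\<rho>\<^bsub>ytens H C D\<^esub> x) (\<lambda>g v0. tscale (\<epsilon>\<^bsub>H\<^esub> g) v0)) = \<phi> x"
      apply (rule tprod_ext[OF _ _ vspace_Kspace _ _ _ x])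
      apply (simp_all add: \<phi>)
      apply (simp add: mult.assoc C.counit_coact D.counit_coact sw_mult[symmetric])
      done
  qed simp_all
  have 3: "sw H X (\<rho>\<^bsub>ytens H C D\<^esub> x) (\<lambda>g x0. tens H (tprod X X) g (\<Delta>\<^bsub>ytens H C D\<^esub> x0)) =
      sw X X (\<Delta>\<^bsub>ytens H C D\<^esub> x) (\<lambda>a b. sw H X (\<rho>\<^bsub>ytens H C D\<^esub> a) (\<lambda>g a0. sw H X (\<rho>\<^bsub>ytens H C D\<^esub> b) (\<lambda>k b0.
        tens H (tprod X X) (g \<cdot>\<^bsub>H\<^esub> k) (tens X X a0 b0))))"
    if x [simp]: "x \<in> carr (tprod C D)" and X: "X = tprod C D" for X x
    unfolding X
  proof (rule eq_by_forms)
    fix \<phi> assume \<phi>: "lin (tprod H (tprod (tprod C D) (tprod C D))) Kspace \<phi>"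
    note [simp] = linD[OF \<phi>, unfolded scl_tprod scl_Kspace]
    let ?X = "tprod C D"
    have braid3: "sw H H (\<Delta>\<^bsub>H\<^esub> u) (\<lambda>h1 h2. sw H D (\<rho>\<^bsub>D\<^esub> (act D h1 y)) (\<lambda>g w. sw H D (\<rho>\<^bsub>D\<^esub> z) (\<lambda>k z'.
        \<phi> (tens H (tprod ?X ?X) (a \<cdot>\<^bsub>H\<^esub> (g \<cdot>\<^bsub>H\<^esub> (h2 \<cdot>\<^bsub>H\<^esub> k))) (tens ?X ?X (tens C D b w) (tens C D c z')))))) =
      sw H H (\<Delta>\<^bsub>H\<^esub> u) (\<lambda>h1 h2. sw H D (\<rho>\<^bsub>D\<^esub> y) (\<lambda>g w. sw H D (\<rho>\<^bsub>D\<^esub> z) (\<lambda>k z'.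
        \<phi> (tens H (tprod ?X ?X) (a \<cdot>\<^bsub>H\<^esub> (h1 \<cdot>\<^bsub>H\<^esub> (g \<cdot>\<^bsub>H\<^esub> k))) (tens ?X ?X (tens C D b (act D h2 w)) (tens C D c z'))))))"
      if "u \<in> carr H" "y \<in> carr D" "z \<in> carr D" "a \<in> carr H" "b \<in> carr C" "c \<in> carr C" for u y z a b c
      using D.braid[of u y "\<lambda>g w. sw H D (\<rho>\<^bsub>D\<^esub> z) (\<lambda>k z'.
        \<phi> (tens H (tprod ?X ?X) (a \<cdot>\<^bsub>H\<^esub> (g \<cdot>\<^bsub>H\<^esub> k)) (tens ?X ?X (tens C D b w) (tens C D c z'))))"] that by (simp del: D.coact_act)
    show "\<phi> (sw H ?X (\<rho>\<^bsub>ytens H C D\<^esub> x) (\<lambda>g x0. tens H (tprod ?X ?X) g (\<Delta>\<^bsub>ytens H C D\<^esub> x0))) =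
      \<phi> (sw ?X ?X (\<Delta>\<^bsub>ytens H C D\<^esub> x) (\<lambda>a b. sw H ?X (\<rho>\<^bsub>ytens H C D\<^esub> a) (\<lambda>g a0. sw H ?X (\<rho>\<^bsub>ytens H C D\<^esub> b) (\<lambda>k b0.
        tens H (tprod ?X ?X) (g \<cdot>\<^bsub>H\<^esub> k) (tens ?X ?X a0 b0)))))"
      apply (rule tprod_ext[OF _ _ vspace_Kspace _ _ _ x])
      apply (simp_all del: D.coact_act)
      apply (simp add: swaps swaps2 C.comod D.comod C.cop_colin D.cop_colin del: D.coact_act)
      apply (subst (2) sw_swap[of H C _ H C])
      apply (simp add: swaps swaps2 C.comod D.comod braid3 del: D.coact_act)
      done
  qed simp_all
  have 4: "sw H (tprod C D) (\<rho>\<^bsub>ytens H C D\<^esub> x) (\<lambda>g c0. scl H (\<epsilon>\<^bsub>ytens H C D\<^esub> c0) g) = scl H (\<epsilon>\<^bsub>ytens H C D\<^esub> x) \<one>\<^bsub>H\<^esub>"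
    if x [simp]: "x \<in> carr (tprod C D)" for x
  proof (rule eq_by_forms)
    fix \<phi> assume \<phi>: "lin H Kspace \<phi>"
    note [simp] = linD[OF \<phi>, unfolded scl_Kspace]
    show "\<phi> (sw H (tprod C D) (\<rho>\<^bsub>ytens H C D\<^esub> x) (\<lambda>g c0. scl H (\<epsilon>\<^bsub>ytens H C D\<^esub> c0) g)) = \<phi> (scl H (\<epsilon>\<^bsub>ytens H C D\<^esub> x) \<one>\<^bsub>H\<^esub>)"
      apply (rule tprod_ext[OF _ _ vspace_Kspace _ _ _ x])
      apply (simp_all add: \<phi>)
      apply (simp add: mult.assoc C.cou_colin D.cou_colin sw_mult[symmetric])
      done
  qed simp_all
  show ?thesis
    apply unfold_locales
    unfolding ytens_norm carr_ytens scl_ytens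
    by (simp_all only: coalgebra_ytens 1 2 3 4 coact_ytens_lin)
qed

end

subsection \<open>The smash coalgebra\<close>

text \<open>Reads \<open>sw_id\<close> backwards under a form. It is needed when one side of an
  identity contains a bare \<Delta> or \<rho> and the other a sum over it.\<close>

lemma lin_expand: "lin (tprod V W) Kspace f \<Longrightarrow> t \<in> carr (tprod V W) \<Longrightarrow> vspace V \<Longrightarrow> vspace W \<Longrightarrow>
  f t = sw V W t (\<lambda>v w. f (tens V W v w))"
  using lin_sw'[of "tprod V W" Kspace f V W t "tens V W"] by (simp add: sw_id)

text \<open>With H acting on itself by left multiplication, the comultiplication of
  \<open>ytens H R (regular H)\<close> is that of the smash coalgebra, so coassociativity and the
  counit laws come from the braided tensor product. \<open>coact\<close> gets an arbitrary value
  because this comultiplication reads the coaction of the left factor.\<close>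

definition regular :: "('k, 'h, 'z) hopf_scheme \<Rightarrow> ('k, 'h, 'h) ydcoalg" where
  "regular H = \<lparr>carr = carr H, scl = scl H, cop = \<Delta>\<^bsub>H\<^esub>, cou = \<epsilon>\<^bsub>H\<^esub>, act = mul H, coact = undefined\<rparr>"

lemma regular_simps [simp]: "carr (regular H) = carr H" "scl (regular H) = scl H" "\<Delta>\<^bsub>regular H\<^esub> = \<Delta>\<^bsub>H\<^esub>"
  "\<epsilon>\<^bsub>regular H\<^esub> = \<epsilon>\<^bsub>H\<^esub>" "act (regular H) = mul H"
  by (simp_all add: regular_def)

lemmas regular_norm [simp] = sw_vs_cong[where V = "regular H" and V' = "H" for H, simplified]

lemma coalgebra_cong:
  assumes "carr C = carr C'" "scl C = scl C'" "\<And>x. x \<in> carr C \<Longrightarrow> \<Delta>\<^bsub>C\<^esub> x = \<Delta>\<^bsub>C'\<^esub> x" "\<And>x. x \<in> carr C \<Longrightarrow> \<epsilon>\<^bsub>C\<^esub> x = \<epsilon>\<^bsub>C'\<^esub> x"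
    "coalgebra C'"
  shows "coalgebra C"
proof -
  note n = sw_vs_cong[OF assms(1,2)]
  have v: "vspace C'" "lin C' (tprod C' C') (\<Delta>\<^bsub>C'\<^esub>)" "lin C' Kspace (\<epsilon>\<^bsub>C'\<^esub>)" using assms(5) by (simp_all add: coalgebra_def)
  have l: "lin C' (tprod C' C') (\<Delta>\<^bsub>C\<^esub>)" "lin C' Kspace (\<epsilon>\<^bsub>C\<^esub>)"
    using v assms(1-4) by (auto simp: lin_def)
  have "\<Delta>\<^bsub>C'\<^esub> x \<in> carr (tprod C' C')" if "x \<in> carr C'" for x using v that by (simp add: lin_def)
  then show ?thesis
    using assms(5) v l assms(1-4) unfolding coalgebra_def n assms(1,2) by simp
qed

context hopf_alg begin

lemma mod_coalg_regular: "mod_coalg H (regular H)"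
  apply unfold_locales
  unfolding regular_norm regular_simps
  by (simp_all add: H.bilin_mul hopf coalgebra_cong[of "regular H" H] H.coalgebra del: bilin_iff)

end

text \<open>\<open>A\<close> is any record with the smash coalgebra structure, whatever else it
  carries. The smash product and its twist are both instances and share all notions defined
  here.\<close>

locale smash_coalg = yd H R
  for H :: "('k::field, 'h::ab_group_add, 'z) hopf_scheme"
    and R :: "('k, 'h, 'r::ab_group_add, 'y) ydcoalg_scheme" +
  fixes A :: "('k, ('k, 'r, 'h) tensor, 'x) coalg_scheme"
  assumes carr_A [simp]: "carr A = carr (tprod R H)" and scl_A [simp]: "scl A = tscale"
    and cop_A: "x \<in> carr (tprod R H) \<Longrightarrow> \<Delta>\<^bsub>A\<^esub> x = sw R H x (\<lambda>r h. sw R R (\<Delta>\<^bsub>R\<^esub> r) (\<lambda>r1 r2. sw H R (\<rho>\<^bsub>R\<^esub> r2) (\<lambda>g r20.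
        sw H H (\<Delta>\<^bsub>H\<^esub> h) (\<lambda>h1 h2.
          tens (tprod R H) (tprod R H) (tens R H r1 (g \<cdot>\<^bsub>H\<^esub> h1)) (tens R H r20 h2)))))"
    and cou_A: "x \<in> carr (tprod R H) \<Longrightarrow> \<epsilon>\<^bsub>A\<^esub> x = sw R H x (\<lambda>r h. \<epsilon>\<^bsub>R\<^esub> r * \<epsilon>\<^bsub>H\<^esub> h)"
begin

lemmas A_norm [simp] = sw_vs_cong[OF carr_A, simplified]

sublocale reg: mod_coalg H "regular H" by (rule mod_coalg_regular)
sublocale Y: comod_mod H R "regular H" ..
sublocale Ym: mod_coalg H "ytens H R (regular H)"
  by (rule Y.mod_coalg_ytens) unfold_locales

lemma coalgebra_A: "coalgebra A"
proof (rule coalgebra_cong)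
  show "coalgebra (ytens H R (regular H))" by (rule Ym.coalgebra)
  show "\<Delta>\<^bsub>A\<^esub> x = \<Delta>\<^bsub>ytens H R (regular H)\<^esub> x" if "x \<in> carr A" for x
    using that by (simp add: cop_A ytens_def sw_swap[of H R _ H H])
  show "\<epsilon>\<^bsub>A\<^esub> x = \<epsilon>\<^bsub>ytens H R (regular H)\<^esub> x" if "x \<in> carr A" for x
    using that by (simp add: cou_A ytens_def)
qed simp_all

sublocale A: coalg A by unfold_locales (rule coalgebra_A)

lemmas A_simps [simp] = linD[OF A.lin_cop, unfolded A_norm carr_A scl_A scl_tprod] linD[OF A.lin_cou, unfolded A_norm carr_A scl_A scl_Kspace]

lemma cop_A_tens [simp]: "r \<in> carr R \<Longrightarrow> h \<in> carr H \<Longrightarrow> \<Delta>\<^bsub>A\<^esub> (tens R H r h) = sw R R (\<Delta>\<^bsub>R\<^esub> r) (\<lambda>r1 r2. sw H H (\<Delta>\<^bsub>H\<^esub> h) (\<lambda>h1 h2. sw H R (\<rho>\<^bsub>R\<^esub> r2) (\<lambda>g r20.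
          tens (tprod R H) (tprod R H) (tens R H r1 (g \<cdot>\<^bsub>H\<^esub> h1)) (tens R H r20 h2))))"
  by (simp add: cop_A sw_tens[where U="tprod (tprod R H) (tprod R H)"] sw_swap[of H R _ H H])

lemma cou_A_tens [simp]: "r \<in> carr R \<Longrightarrow> h \<in> carr H \<Longrightarrow> \<epsilon>\<^bsub>A\<^esub> (tens R H r h) = \<epsilon>\<^bsub>R\<^esub> r * \<epsilon>\<^bsub>H\<^esub> h"
  by (simp add: cou_A)

text \<open>\<open>lmul\<close> and \<open>rmul\<close> anticipate the products with
  \<open>1 # h\<close>, and \<open>prR\<close>, \<open>prH\<close> are the maps
  \<open>id # \<epsilon>\<close> and \<open>\<epsilon> # id\<close>. None of them refers to a
  product on \<open>A\<close>, so they are the same for a bialgebra and its twist.\<close>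

definition lmul :: "'h \<Rightarrow> ('k, 'r, 'h) tensor \<Rightarrow> ('k, 'r, 'h) tensor" where
  "lmul h x = sw R H x (\<lambda>r g. sw H H (\<Delta>\<^bsub>H\<^esub> h) (\<lambda>h1 h2. tens R H (act R h1 r) (h2 \<cdot>\<^bsub>H\<^esub> g)))"
definition rmul :: "('k, 'r, 'h) tensor \<Rightarrow> 'h \<Rightarrow> ('k, 'r, 'h) tensor" where
  "rmul x h = sw R H x (\<lambda>r g. tens R H r (g \<cdot>\<^bsub>H\<^esub> h))"
definition prR :: "('k, 'r, 'h) tensor \<Rightarrow> 'r" where
  "prR x = sw R H x (\<lambda>r h. scl R (\<epsilon>\<^bsub>H\<^esub> h) r)"
definition prH :: "('k, 'r, 'h) tensor \<Rightarrow> 'h" where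
  "prH x = sw R H x (\<lambda>r h. scl H (\<epsilon>\<^bsub>R\<^esub> r) h)"

lemma bilin_lmul: "bilin H (tprod R H) (tprod R H) lmul" by (simp add: lmul_def)
lemma bilin_rmul: "bilin (tprod R H) H (tprod R H) rmul" by (simp add: rmul_def)
lemma lin_prR: "lin (tprod R H) R prR" by (simp add: prR_def[abs_def])
lemma lin_prH: "lin (tprod R H) H prH" by (simp add: prH_def[abs_def])

lemmas [simp] = bilinD[OF bilin_lmul, unfolded scl_tprod] bilinD[OF bilin_rmul, unfolded scl_tprod] linD[OF lin_prR, unfolded scl_tprod] linD[OF lin_prH, unfolded scl_tprod]

lemma lmul_tens [simp]: "h \<in> carr H \<Longrightarrow> r \<in> carr R \<Longrightarrow> g \<in> carr H \<Longrightarrow> lmul h (tens R H r g) = sw H H (\<Delta>\<^bsub>H\<^esub> h) (\<lambda>h1 h2. tens R H (act R h1 r) (h2 \<cdot>\<^bsub>H\<^esub> g))"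
  by (simp add: lmul_def sw_tens[where U="tprod R H"])
lemma rmul_tens [simp]: "h \<in> carr H \<Longrightarrow> r \<in> carr R \<Longrightarrow> g \<in> carr H \<Longrightarrow> rmul (tens R H r g) h = tens R H r (g \<cdot>\<^bsub>H\<^esub> h)"
  by (simp add: rmul_def sw_tens[where U="tprod R H"])
lemma prR_tens [simp]: "h \<in> carr H \<Longrightarrow> r \<in> carr R \<Longrightarrow> prR (tens R H r h) = scl R (\<epsilon>\<^bsub>H\<^esub> h) r"
  by (simp add: prR_def sw_tens[where U=R])
lemma prH_tens [simp]: "h \<in> carr H \<Longrightarrow> r \<in> carr R \<Longrightarrow> prH (tens R H r h) = scl H (\<epsilon>\<^bsub>R\<^esub> r) h"
  by (simp add: prH_def sw_tens[where U=H])

lemma ext_A: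
  assumes "\<And>r h. r \<in> carr R \<Longrightarrow> h \<in> carr H \<Longrightarrow> f (tens R H r h) = g (tens R H r h)"
    "lin (tprod R H) Kspace f" "lin (tprod R H) Kspace g" "x \<in> carr (tprod R H)"
  shows "f x = g x"
  using tprod_ext[OF _ _ vspace_Kspace, of R H f g x] assms by simp

lemma rmul_rmul [simp]:
  assumes x: "x \<in> carr (tprod R H)" and [simp]: "h \<in> carr H" "k \<in> carr H" shows "rmul (rmul x h) k = rmul x (h \<cdot>\<^bsub>H\<^esub> k)"
proof (rule eq_by_forms)
  fix \<phi> assume \<phi>: "lin (tprod R H) Kspace \<phi>"
  note [simp] = linD[OF \<phi>, unfolded scl_tprod scl_Kspace]
  show "\<phi> (rmul (rmul x h) k) = \<phi> (rmul x (h \<cdot>\<^bsub>H\<^esub> k))"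
    by (rule ext_A[OF _ _ _ x]) simp_all
qed (simp_all add: x)

lemma rmul_one [simp]:
  assumes x: "x \<in> carr (tprod R H)" shows "rmul x \<one>\<^bsub>H\<^esub> = x"
proof (rule eq_by_forms)
  fix \<phi> assume \<phi>: "lin (tprod R H) Kspace \<phi>"
  note [simp] = linD[OF \<phi>, unfolded scl_tprod scl_Kspace]
  show "\<phi> (rmul x \<one>\<^bsub>H\<^esub>) = \<phi> x"
    by (rule ext_A[OF _ _ _ x]) (simp_all add: \<phi>)
qed (simp_all add: x)

text \<open>\<open>lmul\<close> is the diagonal action on \<open>R \<otimes> H\<close>; its module
  laws and its compatibility with \<Delta> are therefore those of the module coalgebra
  \<open>Ym\<close>.\<close>

lemma lmul_eq_act: "h \<in> carr H \<Longrightarrow> x \<in> carr (tprod R H) \<Longrightarrow> lmul h x = act (ytens H R (regular H)) h x"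
  by (simp add: lmul_def ytens_def)

lemma cop_lmul [simp]:
  assumes "h \<in> carr H" "x \<in> carr (tprod R H)"
  shows "\<Delta>\<^bsub>A\<^esub> (lmul h x) = sw H H (\<Delta>\<^bsub>H\<^esub> h) (\<lambda>h1 h2. sw (tprod R H) (tprod R H) (\<Delta>\<^bsub>A\<^esub> x) (\<lambda>x1 x2. tens (tprod R H) (tprod R H) (lmul h1 x1) (lmul h2 x2)))"
proof -
  have c: "\<Delta>\<^bsub>A\<^esub> x = \<Delta>\<^bsub>ytens H R (regular H)\<^esub> x" if "x \<in> carr (tprod R H)" for x
    using that by (simp add: cop_A ytens_def sw_swap[of H R _ H H])
  show ?thesis
    using Ym.cop_act[of h x, unfolded ytens_norm regular_norm carr_ytens] assms by (simp add: c[symmetric] lmul_eq_act[symmetric])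
qed

lemma lmul_lmul [simp]: "h \<in> carr H \<Longrightarrow> k \<in> carr H \<Longrightarrow> x \<in> carr (tprod R H) \<Longrightarrow> lmul h (lmul k x) = lmul (h \<cdot>\<^bsub>H\<^esub> k) x"
  using Ym.act_mul[of h k x] by (simp add: lmul_eq_act[symmetric])

lemma lmul_one [simp]: "x \<in> carr (tprod R H) \<Longrightarrow> lmul \<one>\<^bsub>H\<^esub> x = x"
  using Ym.act_unt[of x] by (simp add: lmul_eq_act)

lemma cop_rmul [simp]:
  assumes [simp]: "h \<in> carr H" and x: "x \<in> carr (tprod R H)"
  shows "\<Delta>\<^bsub>A\<^esub> (rmul x h) = sw (tprod R H) (tprod R H) (\<Delta>\<^bsub>A\<^esub> x) (\<lambda>x1 x2. sw H H (\<Delta>\<^bsub>H\<^esub> h) (\<lambda>h1 h2. tens (tprod R H) (tprod R H) (rmul x1 h1) (rmul x2 h2)))"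
proof (rule eq_by_forms)
  fix \<phi> assume \<phi>: "lin (tprod (tprod R H) (tprod R H)) Kspace \<phi>"
  note [simp] = linD[OF \<phi>, unfolded scl_tprod scl_Kspace]
  show "\<phi> (\<Delta>\<^bsub>A\<^esub> (rmul x h)) = \<phi> (sw (tprod R H) (tprod R H) (\<Delta>\<^bsub>A\<^esub> x) (\<lambda>x1 x2. sw H H (\<Delta>\<^bsub>H\<^esub> h) (\<lambda>h1 h2. tens (tprod R H) (tprod R H) (rmul x1 h1) (rmul x2 h2))))"
    by (rule ext_A[OF _ _ _ x]) (simp_all add: sw_swap[of H R _ H H])
qed (simp_all add: x)

lemma cou_lmul:
  assumes [simp]: "h \<in> carr H" and x: "x \<in> carr (tprod R H)" shows "\<epsilon>\<^bsub>A\<^esub> (lmul h x) = \<epsilon>\<^bsub>H\<^esub> h * \<epsilon>\<^bsub>A\<^esub> x"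
  by (rule ext_A[OF _ _ _ x])
    (simp_all add: mult.assoc mult.left_commute sw_mult[symmetric] H.counit)

lemma cou_rmul:
  assumes [simp]: "h \<in> carr H" and x: "x \<in> carr (tprod R H)" shows "\<epsilon>\<^bsub>A\<^esub> (rmul x h) = \<epsilon>\<^bsub>A\<^esub> x * \<epsilon>\<^bsub>H\<^esub> h"
  by (rule ext_A[OF _ _ _ x]) (simp_all add: mult.assoc)

lemma lmul_rmul:
  assumes [simp]: "h \<in> carr H" "k \<in> carr H" and x: "x \<in> carr (tprod R H)" shows "lmul h (rmul x k) = rmul (lmul h x) k"
proof (rule eq_by_forms)
  fix \<phi> assume \<phi>: "lin (tprod R H) Kspace \<phi>"
  note [simp] = linD[OF \<phi>, unfolded scl_tprod scl_Kspace]
  show "\<phi> (lmul h (rmul x k)) = \<phi> (rmul (lmul h x) k)"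
    by (rule ext_A[OF _ _ _ x]) (simp_all)
qed (simp_all add: x)

text \<open>The counits in \<open>prR\<close> and \<open>prH\<close> collapse the two inner tensor
  factors. Applied to a product, this recovers it from its components in \<open>R\<close> and
  \<open>H\<close>.\<close>

lemma decomp:
  assumes x: "x \<in> carr (tprod R H)"
  shows "sw (tprod R H) (tprod R H) (\<Delta>\<^bsub>A\<^esub> x) (\<lambda>x1 x2. tens R H (prR x1) (prH x2)) = x"
proof (rule eq_by_forms)
  fix \<phi> assume \<phi>: "lin (tprod R H) Kspace \<phi>"
  note [simp] = linD[OF \<phi>, unfolded scl_tprod scl_Kspace]
  show "\<phi> (sw (tprod R H) (tprod R H) (\<Delta>\<^bsub>A\<^esub> x) (\<lambda>x1 x2. tens R H (prR x1) (prH x2))) = \<phi> x"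
    apply (rule ext_A[OF _ _ _ x])
      apply (simp_all add: mult.assoc)
      apply (simp add: counit_coact cou_colin H.counit counit sw_mult[symmetric])
    done
qed (simp_all add: x)

abbreviation inc :: "'r \<Rightarrow> ('k, 'r, 'h) tensor" where "inc r \<equiv> tens R H r \<one>\<^bsub>H\<^esub>"

lemma prH_lmul:
  assumes [simp]: "h \<in> carr H" and x: "x \<in> carr (tprod R H)" shows "prH (lmul h x) = h \<cdot>\<^bsub>H\<^esub> prH x"
proof (rule eq_by_forms)
  fix \<phi> assume \<phi>: "lin H Kspace \<phi>"
  note [simp] = linD[OF \<phi>, unfolded scl_tprod scl_Kspace]
  show "\<phi> (prH (lmul h x)) = \<phi> (h \<cdot>\<^bsub>H\<^esub> prH x)"
    by (rule ext_A[OF _ _ _ x]) (simp_all add: mult.assoc mult.left_commute sw_mult[symmetric] H.counit)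
qed (simp_all add: x)

lemma prH_rmul:
  assumes [simp]: "h \<in> carr H" and x: "x \<in> carr (tprod R H)" shows "prH (rmul x h) = prH x \<cdot>\<^bsub>H\<^esub> h"
proof (rule eq_by_forms)
  fix \<phi> assume \<phi>: "lin H Kspace \<phi>"
  note [simp] = linD[OF \<phi>, unfolded scl_tprod scl_Kspace]
  show "\<phi> (prH (rmul x h)) = \<phi> (prH x \<cdot>\<^bsub>H\<^esub> h)"
    by (rule ext_A[OF _ _ _ x]) (simp_all)
qed (simp_all add: x)

lemma prR_lmul:
  assumes [simp]: "h \<in> carr H" and x: "x \<in> carr (tprod R H)" shows "prR (lmul h x) = act R h (prR x)"
proof (rule eq_by_forms)
  fix \<phi> assume \<phi>: "lin R Kspace \<phi>"
  note [simp] = linD[OF \<phi>, unfolded scl_tprod scl_Kspace]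
  show "\<phi> (prR (lmul h x)) = \<phi> (act R h (prR x))"
    by (rule ext_A[OF _ _ _ x]) (simp_all add: mult.assoc sw_mult[symmetric] H.counit)
qed (simp_all add: x)

lemma prR_rmul:
  assumes [simp]: "h \<in> carr H" and x: "x \<in> carr (tprod R H)" shows "prR (rmul x h) = scl R (\<epsilon>\<^bsub>H\<^esub> h) (prR x)"
proof (rule eq_by_forms)
  fix \<phi> assume \<phi>: "lin R Kspace \<phi>"
  note [simp] = linD[OF \<phi>, unfolded scl_tprod scl_Kspace]
  show "\<phi> (prR (rmul x h)) = \<phi> (scl R (\<epsilon>\<^bsub>H\<^esub> h) (prR x))"
    by (rule ext_A[OF _ _ _ x]) (simp_all add: mult_ac)
qed (simp_all add: x)

lemma cop_prR:
  assumes x: "x \<in> carr (tprod R H)"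
  shows "\<Delta>\<^bsub>R\<^esub> (prR x) = sw (tprod R H) (tprod R H) (\<Delta>\<^bsub>A\<^esub> x) (\<lambda>x1 x2. tens R R (prR x1) (prR x2))"
proof (rule eq_by_forms)
  fix \<phi> assume \<phi>: "lin (tprod R R) Kspace \<phi>"
  note [simp] = linD[OF \<phi>, unfolded scl_tprod scl_Kspace]
  show "\<phi> (\<Delta>\<^bsub>R\<^esub> (prR x)) = \<phi> (sw (tprod R H) (tprod R H) (\<Delta>\<^bsub>A\<^esub> x) (\<lambda>x1 x2. tens R R (prR x1) (prR x2)))"
    apply (rule ext_A[OF _ _ _ x])
    apply (simp_all add: mult.assoc)
    apply (simp add: sw_mult[symmetric] H.counit counit_coact lin_expand[OF \<phi>, of "\<Delta>\<^bsub>R\<^esub> _"])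
    done
qed (simp_all add: x)

lemma cop_prH:
  assumes x: "x \<in> carr (tprod R H)"
  shows "\<Delta>\<^bsub>H\<^esub> (prH x) = sw (tprod R H) (tprod R H) (\<Delta>\<^bsub>A\<^esub> x) (\<lambda>x1 x2. tens H H (prH x1) (prH x2))"
proof (rule eq_by_forms)
  fix \<phi> assume \<phi>: "lin (tprod H H) Kspace \<phi>"
  note [simp] = linD[OF \<phi>, unfolded scl_tprod scl_Kspace]
  show "\<phi> (\<Delta>\<^bsub>H\<^esub> (prH x)) = \<phi> (sw (tprod R H) (tprod R H) (\<Delta>\<^bsub>A\<^esub> x) (\<lambda>x1 x2. tens H H (prH x1) (prH x2)))"
    apply (rule ext_A[OF _ _ _ x])
    apply (simp_all add: mult.assoc)
    apply (simp add: sw_mult[symmetric] counit cou_colin lin_expand[OF \<phi>, of "\<Delta>\<^bsub>H\<^esub> _"])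
    done
qed (simp_all add: x)

text \<open>In the order opposite to \<open>decomp\<close> the inner factors survive and the
  coaction of \<open>R\<close> appears. Evaluated on products of elements \<open>r # 1\<close>, this
  is the source of axiom (c).\<close>

lemma prH_prR:
  assumes x [simp]: "x \<in> carr (tprod R H)" and F: "bilin H R Kspace F"
  shows "sw (tprod R H) (tprod R H) (\<Delta>\<^bsub>A\<^esub> x) (\<lambda>x1 x2. F (prH x1) (prR x2)) =
    sw R H x (\<lambda>r h. sw H R (\<rho>\<^bsub>R\<^esub> r) (\<lambda>g r'. F (g \<cdot>\<^bsub>H\<^esub> h) r'))"
proof -
  note [simp] = bilinD[OF F, unfolded scl_tprod scl_Kspace]
  show ?thesis
    apply (rule ext_A[OF _ _ _ x])
    apply (simp_all add: mult.assoc)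
    apply (simp add: sw_mult[symmetric] H.counit counit)
    done
qed

end

section \<open>The braided square \<open>R \<otimes> R\<close>\<close>

context yd begin

sublocale SQ: comod_yd H C C ..
sublocale SQm: mod_coalg H "ytens H C C" by (rule SQ.mod_coalg_ytens) unfold_locales
sublocale SQc: comod_coalg H "ytens H C C" by (rule SQ.comod_coalg_ytens)

lemmas SQ_rules [simp] = bilinD[OF SQm.bilin_act, unfolded ytens_norm carr_ytens scl_ytens]
lemmas SQ_coassoc = SQm.coassoc[unfolded ytens_norm carr_ytens]
lemmas SQ_counit = SQm.counit[unfolded ytens_norm carr_ytens]
lemmas SQ_counit_coact = SQc.counit_coact[unfolded ytens_norm carr_ytens]
lemmas SQ_cop_colin = SQc.cop_colin[unfolded ytens_norm carr_ytens]

lemma SQ_act_tens [simp]: "h \<in> carr H \<Longrightarrow> x \<in> carr C \<Longrightarrow> y \<in> carr C \<Longrightarrow>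
  act (ytens H C C) h (tens C C x y) = sw H H (\<Delta>\<^bsub>H\<^esub> h) (\<lambda>h1 h2. tens C C (act C h1 x) (act C h2 y))"
  by (rule SQ.act_ytens_tens) unfold_locales

end

subsection \<open>Bialgebra structure of the smash product\<close>

text \<open>The map \<open>\<mu>\<close> stands for \<open>r \<otimes> s \<mapsto> (r # 1) (s # 1)\<close>; axioms (a) to (f) of a pre-bialgebra
  with cocycle say exactly that \<open>\<mu>\<close> has the properties listed here.\<close>

locale smash_alg = smash_coalg H R A
  for H :: "('k::field, 'h::ab_group_add, 'z) hopf_scheme"
    and R :: "('k, 'h, 'r::ab_group_add, 'y) ydcoalg_scheme"
    and A :: "('k, ('k, 'r, 'h) tensor, 'x) bialg_scheme" +
  fixes \<mu> :: "('k, 'r, 'r) tensor \<Rightarrow> ('k, 'r, 'h) tensor" and u :: 'r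
  assumes lin_mu: "lin (tprod R R) (tprod R H) \<mu>"
    and cop_mu: "z \<in> carr (tprod R R) \<Longrightarrow> \<Delta>\<^bsub>A\<^esub> (\<mu> z) = sw (tprod R R) (tprod R R) (\<Delta>\<^bsub>ytens H R R\<^esub> z) (\<lambda>z1 z2.
         sw H (tprod R R) (\<rho>\<^bsub>ytens H R R\<^esub> z2) (\<lambda>g z20. tens (tprod R H) (tprod R H) (rmul (\<mu> z1) g) (\<mu> z20)))"
    and cou_mu: "z \<in> carr (tprod R R) \<Longrightarrow> \<epsilon>\<^bsub>A\<^esub> (\<mu> z) = \<epsilon>\<^bsub>ytens H R R\<^esub> z"
    and lmul_mu: "z \<in> carr (tprod R R) \<Longrightarrow> h \<in> carr H \<Longrightarrow>
       lmul h (\<mu> z) = sw H H (\<Delta>\<^bsub>H\<^esub> h) (\<lambda>h1 h2. rmul (\<mu> (act (ytens H R R) h1 z)) h2)"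
    and assoc_mu: "r \<in> carr R \<Longrightarrow> s \<in> carr R \<Longrightarrow> t \<in> carr R \<Longrightarrow>
       sw R H (\<mu> (tens R R r s)) (\<lambda>a g. sw H H (\<Delta>\<^bsub>H\<^esub> g) (\<lambda>g1 g2. rmul (\<mu> (tens R R a (act R g1 t))) g2)) =
       sw R H (\<mu> (tens R R s t)) (\<lambda>a g. rmul (\<mu> (tens R R r a)) g)"
    and mu_u: "r \<in> carr R \<Longrightarrow> \<mu> (tens R R r u) = tens R H r \<one>\<^bsub>H\<^esub>" "r \<in> carr R \<Longrightarrow> \<mu> (tens R R u r) = tens R H r \<one>\<^bsub>H\<^esub>"
    and u_carr [simp]: "u \<in> carr R" and cop_u [simp]: "\<Delta>\<^bsub>R\<^esub> u = tens R R u u" and cou_u [simp]: "\<epsilon>\<^bsub>R\<^esub> u = 1"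
    and act_u [simp]: "h \<in> carr H \<Longrightarrow> act R h u = scl R (\<epsilon>\<^bsub>H\<^esub> h) u" and coact_u [simp]: "\<rho>\<^bsub>R\<^esub> u = tens H R \<one>\<^bsub>H\<^esub> u"
    and mul_A: "x \<in> carr (tprod R H) \<Longrightarrow> y \<in> carr (tprod R H) \<Longrightarrow> x \<cdot>\<^bsub>A\<^esub> y = sw R H x (\<lambda>r h. sw R H y (\<lambda>s h'. sw H H (\<Delta>\<^bsub>H\<^esub> h) (\<lambda>h1 h2.
       rmul (\<mu> (tens R R r (act R h1 s))) (h2 \<cdot>\<^bsub>H\<^esub> h'))))"
    and unt_A: "\<one>\<^bsub>A\<^esub> = tens R H u \<one>\<^bsub>H\<^esub>"
begin

lemmas mu_rules [simp] = linD[OF lin_mu, unfolded scl_tprod]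

text \<open>Left multiplication by \<open>r # 1\<close>. By \<open>mul_tens\<close> the product of
  \<open>A\<close> is \<open>L\<close> composed with \<open>lmul\<close>, so the bialgebra axioms
  reduce to statements about these two operations.\<close>

definition L where "L r y = sw R H y (\<lambda>s g. rmul (\<mu> (tens R R r s)) g)"

lemma bilin_L: "bilin R (tprod R H) (tprod R H) L" by (simp add: L_def)
lemmas L_rules [simp] = bilinD[OF bilin_L, unfolded scl_tprod]

lemma L_tens [simp]: "r \<in> carr R \<Longrightarrow> s \<in> carr R \<Longrightarrow> g \<in> carr H \<Longrightarrow> L r (tens R H s g) = rmul (\<mu> (tens R R r s)) g"
  by (simp add: L_def sw_tens[where U="tprod R H"])

lemma bilin_A: "bilin (tprod R H) (tprod R H) (tprod R H) (mul A)"
proof -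
  have "bilin (tprod R H) (tprod R H) (tprod R H) (\<lambda>x y. sw R H x (\<lambda>r h. sw R H y (\<lambda>s h'. sw H H (\<Delta>\<^bsub>H\<^esub> h) (\<lambda>h1 h2.
       rmul (\<mu> (tens R R r (act R h1 s))) (h2 \<cdot>\<^bsub>H\<^esub> h')))))" by simp
  then show ?thesis by (simp add: bilin_def lin_def mul_A)
qed
lemmas A_mul_rules [simp] = bilinD[OF bilin_A, unfolded scl_tprod]

lemma mul_tens:
  assumes [simp]: "r \<in> carr R" "h \<in> carr H" and y: "y \<in> carr (tprod R H)"
  shows "tens R H r h \<cdot>\<^bsub>A\<^esub> y = L r (lmul h y)"
proof (rule eq_by_forms)
  fix \<phi> assume \<phi>: "lin (tprod R H) Kspace \<phi>"
  note [simp] = linD[OF \<phi>, unfolded scl_tprod scl_Kspace]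
  show "\<phi> (tens R H r h \<cdot>\<^bsub>A\<^esub> y) = \<phi> (L r (lmul h y))"
    by (rule ext_A[OF _ _ _ y]) (simp_all add: mul_A)
qed (simp_all add: y)

lemma L_rmul:
  assumes [simp]: "r \<in> carr R" "h \<in> carr H" and y: "y \<in> carr (tprod R H)"
  shows "L r (rmul y h) = rmul (L r y) h"
proof (rule eq_by_forms)
  fix \<phi> assume \<phi>: "lin (tprod R H) Kspace \<phi>"
  note [simp] = linD[OF \<phi>, unfolded scl_tprod scl_Kspace]
  show "\<phi> (L r (rmul y h)) = \<phi> (rmul (L r y) h)"
    by (rule ext_A[OF _ _ _ y]) (simp_all)
qed (simp_all add: y)

lemma lmul_L:
  assumes [simp]: "r \<in> carr R" "h \<in> carr H" and y: "y \<in> carr (tprod R H)"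
  shows "lmul h (L r y) = sw H H (\<Delta>\<^bsub>H\<^esub> h) (\<lambda>h1 h2. L (act R h1 r) (lmul h2 y))"
proof (rule eq_by_forms)
  fix \<phi> assume \<phi>: "lin (tprod R H) Kspace \<phi>"
  note [simp] = linD[OF \<phi>, unfolded scl_tprod scl_Kspace]
  show "\<phi> (lmul h (L r y)) = \<phi> (sw H H (\<Delta>\<^bsub>H\<^esub> h) (\<lambda>h1 h2. L (act R h1 r) (lmul h2 y)))"
    by (rule ext_A[OF _ _ _ y]) (simp_all add: lmul_rmul lmul_mu H.coassoc)
qed (simp_all add: y)

lemma lmul_mul:
  assumes [simp]: "h \<in> carr H" and x: "x \<in> carr (tprod R H)" and y [simp]: "y \<in> carr (tprod R H)"
  shows "lmul h x \<cdot>\<^bsub>A\<^esub> y = lmul h (x \<cdot>\<^bsub>A\<^esub> y)"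
proof (rule eq_by_forms)
  fix \<phi> assume \<phi>: "lin (tprod R H) Kspace \<phi>"
  note [simp] = linD[OF \<phi>, unfolded scl_tprod scl_Kspace]
  show "\<phi> (lmul h x \<cdot>\<^bsub>A\<^esub> y) = \<phi> (lmul h (x \<cdot>\<^bsub>A\<^esub> y))"
    by (rule ext_A[OF _ _ _ x]) (simp_all add: mul_tens lmul_L)
qed (simp_all add: x)

lemma rmul_mul:
  assumes [simp]: "h \<in> carr H" and x: "x \<in> carr (tprod R H)" and y [simp]: "y \<in> carr (tprod R H)"
  shows "rmul x h \<cdot>\<^bsub>A\<^esub> y = x \<cdot>\<^bsub>A\<^esub> lmul h y"
proof (rule eq_by_forms)
  fix \<phi> assume \<phi>: "lin (tprod R H) Kspace \<phi>"
  note [simp] = linD[OF \<phi>, unfolded scl_tprod scl_Kspace]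
  show "\<phi> (rmul x h \<cdot>\<^bsub>A\<^esub> y) = \<phi> (x \<cdot>\<^bsub>A\<^esub> lmul h y)"
    by (rule ext_A[OF _ _ _ x]) (simp_all add: mul_tens)
qed (simp_all add: x)

lemma mul_rmul:
  assumes [simp]: "h \<in> carr H" and x: "x \<in> carr (tprod R H)" and y [simp]: "y \<in> carr (tprod R H)"
  shows "x \<cdot>\<^bsub>A\<^esub> rmul y h = rmul (x \<cdot>\<^bsub>A\<^esub> y) h"
proof (rule eq_by_forms)
  fix \<phi> assume \<phi>: "lin (tprod R H) Kspace \<phi>"
  note [simp] = linD[OF \<phi>, unfolded scl_tprod scl_Kspace]
  show "\<phi> (x \<cdot>\<^bsub>A\<^esub> rmul y h) = \<phi> (rmul (x \<cdot>\<^bsub>A\<^esub> y) h)"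
    by (rule ext_A[OF _ _ _ x]) (simp_all add: mul_tens L_rmul lmul_rmul)
qed (simp_all add: x)

text \<open>Both sides commute with right multiplication by H, so \<open>y = t # 1\<close> suffices,
  and this case is \<open>assoc_mu\<close>. Associativity then grows in the left factor: to
  \<open>r # 1\<close> times anything in \<open>L_mul\<close>, to arbitrary elements in
  \<open>assoc\<close>.\<close>

lemma mu_mul:
  assumes [simp]: "r \<in> carr R" "s \<in> carr R" and y: "y \<in> carr (tprod R H)"
  shows "\<mu> (tens R R r s) \<cdot>\<^bsub>A\<^esub> y = L r (L s y)"
proof (rule eq_by_forms)
  fix \<phi> assume \<phi>: "lin (tprod R H) Kspace \<phi>"
  note [simp] = linD[OF \<phi>, unfolded scl_tprod scl_Kspace]
  show "\<phi> (\<mu> (tens R R r s) \<cdot>\<^bsub>A\<^esub> y) = \<phi> (L r (L s y))"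
  proof (rule ext_A[OF _ _ _ y])
    fix t h assume [simp]: "t \<in> carr R" "h \<in> carr H"
    have e: "tens R H t h = rmul (inc t) h" by simp
    have "\<mu> (tens R R r s) \<cdot>\<^bsub>A\<^esub> inc t = L r (\<mu> (tens R R s t))"
      using assoc_mu[of r s t] by (simp add: mul_A L_def sw_tens[where U="tprod R H"])
    then show "\<phi> (\<mu> (tens R R r s) \<cdot>\<^bsub>A\<^esub> tens R H t h) = \<phi> (L r (L s (tens R H t h)))"
      unfolding e by (simp add: mul_rmul L_rmul del: rmul_tens)
  qed simp_all
qed (simp_all add: y)

lemma L_mul:
  assumes [simp]: "r \<in> carr R" and x: "x \<in> carr (tprod R H)" and y [simp]: "y \<in> carr (tprod R H)"
  shows "L r x \<cdot>\<^bsub>A\<^esub> y = L r (x \<cdot>\<^bsub>A\<^esub> y)"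
proof (rule eq_by_forms)
  fix \<phi> assume \<phi>: "lin (tprod R H) Kspace \<phi>"
  note [simp] = linD[OF \<phi>, unfolded scl_tprod scl_Kspace]
  show "\<phi> (L r x \<cdot>\<^bsub>A\<^esub> y) = \<phi> (L r (x \<cdot>\<^bsub>A\<^esub> y))"
    by (rule ext_A[OF _ _ _ x]) (simp_all add: mul_tens rmul_mul mu_mul)
qed (simp_all add: x)

lemma assoc:
  assumes x: "x \<in> carr (tprod R H)" and y [simp]: "y \<in> carr (tprod R H)" and z [simp]: "z \<in> carr (tprod R H)"
  shows "x \<cdot>\<^bsub>A\<^esub> y \<cdot>\<^bsub>A\<^esub> z = x \<cdot>\<^bsub>A\<^esub> (y \<cdot>\<^bsub>A\<^esub> z)"
proof (rule eq_by_forms)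
  fix \<phi> assume \<phi>: "lin (tprod R H) Kspace \<phi>"
  note [simp] = linD[OF \<phi>, unfolded scl_tprod scl_Kspace]
  show "\<phi> (x \<cdot>\<^bsub>A\<^esub> y \<cdot>\<^bsub>A\<^esub> z) = \<phi> (x \<cdot>\<^bsub>A\<^esub> (y \<cdot>\<^bsub>A\<^esub> z))"
    by (rule ext_A[OF _ _ _ x]) (simp_all add: mul_tens L_mul lmul_mul)
qed (simp_all add: x)

lemma L_u: assumes x: "x \<in> carr (tprod R H)" shows "L u x = x"
proof (rule eq_by_forms)
  fix \<phi> assume \<phi>: "lin (tprod R H) Kspace \<phi>"
  note [simp] = linD[OF \<phi>, unfolded scl_tprod scl_Kspace]
  show "\<phi> (L u x) = \<phi> x"
    by (rule ext_A[OF _ _ _ x]) (simp_all add: mu_u \<phi>)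
qed (simp_all add: x)

lemma sigma_mul: "h \<in> carr H \<Longrightarrow> x \<in> carr (tprod R H) \<Longrightarrow> tens R H u h \<cdot>\<^bsub>A\<^esub> x = lmul h x"
  by (simp add: mul_tens L_u)

lemma mul_unt: assumes x: "x \<in> carr (tprod R H)" shows "x \<cdot>\<^bsub>A\<^esub> inc u = x"
proof (rule eq_by_forms)
  fix \<phi> assume \<phi>: "lin (tprod R H) Kspace \<phi>"
  note [simp] = linD[OF \<phi>, unfolded scl_tprod scl_Kspace]
  show "\<phi> (x \<cdot>\<^bsub>A\<^esub> inc u) = \<phi> x"
    apply (rule ext_A[OF _ _ _ x])
    apply (simp_all add: mu_u \<phi> mul_tens)
    apply (simp add: H.counit)
    done
qed (simp_all add: x)

lemma mul_sigma: "h \<in> carr H \<Longrightarrow> x \<in> carr (tprod R H) \<Longrightarrow> x \<cdot>\<^bsub>A\<^esub> tens R H u h = rmul x h"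
  using mul_rmul[of h x "inc u"] by (simp add: mul_unt)

text \<open>Multiplicativity of \<Delta> for a left factor \<open>r # 1\<close>: the right side
  multiplies \<open>y1\<close> by \<open>r1 # g\<close> and \<open>y2\<close> by
  \<open>r20 # 1\<close>, the components of the comultiplication of \<open>r # 1\<close>.\<close>

lemma cop_L:
  assumes [simp]: "r \<in> carr R" and y: "y \<in> carr (tprod R H)"
  shows "\<Delta>\<^bsub>A\<^esub> (L r y) = sw R R (\<Delta>\<^bsub>R\<^esub> r) (\<lambda>r1 r2. sw H R (\<rho>\<^bsub>R\<^esub> r2) (\<lambda>g r20. sw (tprod R H) (tprod R H) (\<Delta>\<^bsub>A\<^esub> y) (\<lambda>y1 y2.
    tens (tprod R H) (tprod R H) (L r1 (lmul g y1)) (L r20 y2))))"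
proof (rule eq_by_forms)
  fix \<phi> assume \<phi>: "lin (tprod (tprod R H) (tprod R H)) Kspace \<phi>"
  note [simp] = linD[OF \<phi>, unfolded scl_tprod scl_Kspace]
  show "\<phi> (\<Delta>\<^bsub>A\<^esub> (L r y)) = \<phi> (sw R R (\<Delta>\<^bsub>R\<^esub> r) (\<lambda>r1 r2. sw H R (\<rho>\<^bsub>R\<^esub> r2) (\<lambda>g r20. sw (tprod R H) (tprod R H) (\<Delta>\<^bsub>A\<^esub> y) (\<lambda>y1 y2.
    tens (tprod R H) (tprod R H) (L r1 (lmul g y1)) (L r20 y2)))))"
    apply (rule ext_A[OF _ _ _ y])
    apply (simp_all add: cop_mu)
    apply (simp add: comod sw_swap[of H H _ H R] sw_swap[of H R _ R R])
    apply (subst sw_swap[of H H _ H H])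
    apply (rule refl)
    done
qed (simp_all add: y)

lemma cop_mul_A:
  assumes x: "x \<in> carr (tprod R H)" and y [simp]: "y \<in> carr (tprod R H)"
  shows "\<Delta>\<^bsub>A\<^esub> (x \<cdot>\<^bsub>A\<^esub> y) = sw (tprod R H) (tprod R H) (\<Delta>\<^bsub>A\<^esub> x) (\<lambda>x1 x2. sw (tprod R H) (tprod R H) (\<Delta>\<^bsub>A\<^esub> y) (\<lambda>y1 y2.
    tens (tprod R H) (tprod R H) (x1 \<cdot>\<^bsub>A\<^esub> y1) (x2 \<cdot>\<^bsub>A\<^esub> y2)))"
proof (rule eq_by_forms)
  fix \<phi> assume \<phi>: "lin (tprod (tprod R H) (tprod R H)) Kspace \<phi>"
  note [simp] = linD[OF \<phi>, unfolded scl_tprod scl_Kspace]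
  show "\<phi> (\<Delta>\<^bsub>A\<^esub> (x \<cdot>\<^bsub>A\<^esub> y)) = \<phi> (sw (tprod R H) (tprod R H) (\<Delta>\<^bsub>A\<^esub> x) (\<lambda>x1 x2. sw (tprod R H) (tprod R H) (\<Delta>\<^bsub>A\<^esub> y) (\<lambda>y1 y2.
    tens (tprod R H) (tprod R H) (x1 \<cdot>\<^bsub>A\<^esub> y1) (x2 \<cdot>\<^bsub>A\<^esub> y2))))"
    apply (rule ext_A[OF _ _ _ x])
    apply (simp_all add: mul_tens cop_L)
    apply (simp add: sw_swap[of H H _ H R])
    done
qed (simp_all add: x)

lemma cou_mul_A:
  assumes x: "x \<in> carr (tprod R H)" and y [simp]: "y \<in> carr (tprod R H)"
  shows "\<epsilon>\<^bsub>A\<^esub> (x \<cdot>\<^bsub>A\<^esub> y) = \<epsilon>\<^bsub>A\<^esub> x * \<epsilon>\<^bsub>A\<^esub> y"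
proof -
  have L: "\<epsilon>\<^bsub>A\<^esub> (L r y) = \<epsilon>\<^bsub>R\<^esub> r * \<epsilon>\<^bsub>A\<^esub> y" if [simp]: "r \<in> carr R" and y: "y \<in> carr (tprod R H)" for r y
    by (rule ext_A[OF _ _ _ y]) (simp_all add: cou_rmul cou_mu)
  show ?thesis
    apply (rule ext_A[OF _ _ _ x])
    apply (simp_all add: mul_tens L cou_lmul)
    done
qed

lemma cop_unt_A: "\<Delta>\<^bsub>A\<^esub> (inc u) = tens (tprod R H) (tprod R H) (inc u) (inc u)"
proof (rule eq_by_forms)
  fix \<phi> assume \<phi>: "lin (tprod (tprod R H) (tprod R H)) Kspace \<phi>"
  note [simp] = linD[OF \<phi>, unfolded scl_tprod scl_Kspace]
  show "\<phi> (\<Delta>\<^bsub>A\<^esub> (inc u)) = \<phi> (tens (tprod R H) (tprod R H) (inc u) (inc u))" by simp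
qed simp_all

lemma bialgebra_A: "bialgebra A"
  unfolding bialgebra_def A_norm carr_A
  by (simp_all add: coalgebra_A bilin_A assoc unt_A mul_unt sigma_mul cop_mul_A cou_mul_A cop_unt_A del: cop_A_tens bilin_iff)

end

text \<open>Product, cocycle and unit are separate parameters instead of record fields. The
  Yetter-Drinfeld coalgebra \<open>R\<close> can then stay fixed while its product changes to the
  twisted one.\<close>

locale pbc = yd H R
  for H :: "('k::field, 'h::ab_group_add, 'z) hopf_scheme"
    and R :: "('k, 'h, 'r::ab_group_add, 'y) ydcoalg_scheme" +
  fixes m :: "('k, 'r, 'r) tensor \<Rightarrow> 'r" and \<xi> :: "('k, 'r, 'r) tensor \<Rightarrow> 'h" and u :: 'r
  assumes lin_m: "lin (tprod R R) R m" and lin_xi: "lin (tprod R R) H \<xi>"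
    and cop_m [simp]: "z \<in> carr (tprod R R) \<Longrightarrow> \<Delta>\<^bsub>R\<^esub> (m z) = sw (tprod R R) (tprod R R) (\<Delta>\<^bsub>ytens H R R\<^esub> z) (\<lambda>a b. tens R R (m a) (m b))"
    and cou_m [simp]: "z \<in> carr (tprod R R) \<Longrightarrow> \<epsilon>\<^bsub>R\<^esub> (m z) = \<epsilon>\<^bsub>ytens H R R\<^esub> z"
    and act_m: "h \<in> carr H \<Longrightarrow> z \<in> carr (tprod R R) \<Longrightarrow> m (act (ytens H R R) h z) = act R h (m z)"
    and m_u [simp]: "r \<in> carr R \<Longrightarrow> m (tens R R r u) = r" "r \<in> carr R \<Longrightarrow> m (tens R R u r) = r"
    and cop_xi: "z \<in> carr (tprod R R) \<Longrightarrow> \<Delta>\<^bsub>H\<^esub> (\<xi> z) = sw (tprod R R) (tprod R R) (\<Delta>\<^bsub>ytens H R R\<^esub> z) (\<lambda>z1 z2.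
         sw H (tprod R R) (\<rho>\<^bsub>ytens H R R\<^esub> z2) (\<lambda>g z20. tens H H (\<xi> z1 \<cdot>\<^bsub>H\<^esub> g) (\<xi> z20)))"
    and cou_xi [simp]: "z \<in> carr (tprod R R) \<Longrightarrow> \<epsilon>\<^bsub>H\<^esub> (\<xi> z) = \<epsilon>\<^bsub>ytens H R R\<^esub> z"
    and act_xi: "h \<in> carr H \<Longrightarrow> z \<in> carr (tprod R R) \<Longrightarrow>
      \<xi> (act (ytens H R R) h z) = sw H H (\<Delta>\<^bsub>H\<^esub> h) (\<lambda>h1 h2. h1 \<cdot>\<^bsub>H\<^esub> \<xi> z \<cdot>\<^bsub>H\<^esub> \<S>\<^bsub>H\<^esub> h2)"
    and ax_c': "z \<in> carr (tprod R R) \<Longrightarrow>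
        sw (tprod R R) (tprod R R) (\<Delta>\<^bsub>ytens H R R\<^esub> z) (\<lambda>z1 z2. sw H R (\<rho>\<^bsub>R\<^esub> (m z1)) (\<lambda>g r0. tens H R (g \<cdot>\<^bsub>H\<^esub> \<xi> z2) r0))
          = sw (tprod R R) (tprod R R) (\<Delta>\<^bsub>ytens H R R\<^esub> z) (\<lambda>z1 z2. sw H (tprod R R) (\<rho>\<^bsub>ytens H R R\<^esub> z2) (\<lambda>g z20.
              tens H R (\<xi> z1 \<cdot>\<^bsub>H\<^esub> g) (m z20)))"
    and ax_d: "r \<in> carr R \<Longrightarrow> s \<in> carr R \<Longrightarrow> t \<in> carr R \<Longrightarrow> m (tens R R r (m (tens R R s t)))
          = sw (tprod R R) (tprod R R) (\<Delta>\<^bsub>ytens H R R\<^esub> (tens R R r s)) (\<lambda>z1 z2. m (tens R R (m z1) (act R (\<xi> z2) t)))"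
    and ax_e: "r \<in> carr R \<Longrightarrow> s \<in> carr R \<Longrightarrow> t \<in> carr R \<Longrightarrow>
       sw (tprod R R) (tprod R R) (\<Delta>\<^bsub>ytens H R R\<^esub> (tens R R s t)) (\<lambda>w1 w2. \<xi> (tens R R r (m w1)) \<cdot>\<^bsub>H\<^esub> \<xi> w2)
          = sw (tprod R R) (tprod R R) (\<Delta>\<^bsub>ytens H R R\<^esub> (tens R R r s)) (\<lambda>z1 z2. sw H H (\<Delta>\<^bsub>H\<^esub> (\<xi> z2)) (\<lambda>x1 x2.
              \<xi> (tens R R (m z1) (act R x1 t)) \<cdot>\<^bsub>H\<^esub> x2))"
    and xi_u [simp]: "r \<in> carr R \<Longrightarrow> \<xi> (tens R R r u) = scl H (\<epsilon>\<^bsub>R\<^esub> r) \<one>\<^bsub>H\<^esub>"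
      "r \<in> carr R \<Longrightarrow> \<xi> (tens R R u r) = scl H (\<epsilon>\<^bsub>R\<^esub> r) \<one>\<^bsub>H\<^esub>"
    and u_carr [simp]: "u \<in> carr R" and cop_u [simp]: "\<Delta>\<^bsub>R\<^esub> u = tens R R u u" and cou_u [simp]: "\<epsilon>\<^bsub>R\<^esub> u = 1"
    and act_u [simp]: "h \<in> carr H \<Longrightarrow> act R h u = scl R (\<epsilon>\<^bsub>H\<^esub> h) u" and coact_u [simp]: "\<rho>\<^bsub>R\<^esub> u = tens H R \<one>\<^bsub>H\<^esub> u"
begin

abbreviation RR where "RR \<equiv> tprod R R"
abbreviation \<Delta>\<^sub>2 where "\<Delta>\<^sub>2 z \<equiv> \<Delta>\<^bsub>ytens H R R\<^esub> z"
abbreviation \<rho>\<^sub>2 where "\<rho>\<^sub>2 z \<equiv> \<rho>\<^bsub>ytens H R R\<^esub> z"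

lemmas m_rules [simp] = linD[OF lin_m, unfolded scl_tprod] linD[OF lin_xi, unfolded scl_tprod]

lemma ax_c:
  assumes [simp]: "z \<in> carr RR" and F: "bilin H R Kspace F"
  shows "sw RR RR (\<Delta>\<^sub>2 z) (\<lambda>z1 z2. sw H R (\<rho>\<^bsub>R\<^esub> (m z1)) (\<lambda>g r0. F (g \<cdot>\<^bsub>H\<^esub> \<xi> z2) r0))
          = sw RR RR (\<Delta>\<^sub>2 z) (\<lambda>z1 z2. sw H RR (\<rho>\<^sub>2 z2) (\<lambda>g z20. F (\<xi> z1 \<cdot>\<^bsub>H\<^esub> g) (m z20)))"
proof -
  note [simp] = bilinD[OF F, unfolded scl_tprod scl_Kspace]
  show ?thesis using arg_cong[OF ax_c'[OF assms(1)], of "\<lambda>t. sw H R t F"] by simp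
qed

text \<open>Axiom (b) multiplied on the right by a further factor of \<open>h\<close>, which cancels
  the antipode; compare \<open>braid\<close>.\<close>

lemma ax_b:
  assumes [simp]: "h \<in> carr H" "z \<in> carr RR" and F: "lin H Kspace F"
  shows "sw H H (\<Delta>\<^bsub>H\<^esub> h) (\<lambda>h1 h2. F (\<xi> (act (ytens H R R) h1 z) \<cdot>\<^bsub>H\<^esub> h2)) = F (h \<cdot>\<^bsub>H\<^esub> \<xi> z)"
proof -
  note [simp] = linD[OF F, unfolded scl_tprod scl_Kspace]
  have [simp]: "sw H H (\<Delta>\<^bsub>H\<^esub> k) (\<lambda>p q. F (a \<cdot>\<^bsub>H\<^esub> (\<xi> z \<cdot>\<^bsub>H\<^esub> (\<S>\<^bsub>H\<^esub> p \<cdot>\<^bsub>H\<^esub> q)))) = \<epsilon>\<^bsub>H\<^esub> k * F (a \<cdot>\<^bsub>H\<^esub> \<xi> z)"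
    if "a \<in> carr H" "k \<in> carr H" for a k
    using antip(1)[of k "\<lambda>u. F (a \<cdot>\<^bsub>H\<^esub> (\<xi> z \<cdot>\<^bsub>H\<^esub> u))"] that by simp
  show ?thesis
    by (simp add: act_xi H.coassoc) (simp add: sw_mult[symmetric] H.counit)
qed

definition M where "M z = sw RR RR (\<Delta>\<^sub>2 z) (\<lambda>z1 z2. tens R H (m z1) (\<xi> z2))"

lemma lin_M: "lin RR (tprod R H) M" by (simp add: M_def[abs_def])
lemmas M_rules [simp] = linD[OF lin_M, unfolded scl_tprod]

text \<open>Axiom (c) for the first two of three components of \<open>w\<close>, with the coaction
  of the third carried along. Colinearity of \<open>\<Delta>\<^sub>2\<close> then merges the
  coactions of the last two. This moves a coaction of \<open>m\<close> past a value of \<xi> inside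
  longer expressions.\<close>

lemma move_c:
  assumes [simp]: "w \<in> carr RR" and F: "\<And>b c. b \<in> carr H \<Longrightarrow> c \<in> carr RR \<Longrightarrow> lin R Kspace (\<lambda>a. F a b c)"
    "\<And>a c. a \<in> carr R \<Longrightarrow> c \<in> carr RR \<Longrightarrow> lin H Kspace (\<lambda>b. F a b c)"
    "\<And>a b. a \<in> carr R \<Longrightarrow> b \<in> carr H \<Longrightarrow> lin RR Kspace (\<lambda>c. F a b c)"
  shows "sw RR RR (\<Delta>\<^sub>2 w) (\<lambda>p q. sw RR RR (\<Delta>\<^sub>2 q) (\<lambda>q1 q2. sw H R (\<rho>\<^bsub>R\<^esub> (m p)) (\<lambda>g r. sw H RR (\<rho>\<^sub>2 q2) (\<lambda>k t. F r (g \<cdot>\<^bsub>H\<^esub> (\<xi> q1 \<cdot>\<^bsub>H\<^esub> k)) t)))) =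
    sw RR RR (\<Delta>\<^sub>2 w) (\<lambda>p q. sw H RR (\<rho>\<^sub>2 q) (\<lambda>g s. sw RR RR (\<Delta>\<^sub>2 s) (\<lambda>s1 s2. F (m s1) (\<xi> p \<cdot>\<^bsub>H\<^esub> g) s2)))"
proof -
  note [simp] = lin_comp[OF F(1)] lin_comp[OF F(2)] lin_comp[OF F(3)]
  let ?G = "\<lambda>p q1 q2. sw H R (\<rho>\<^bsub>R\<^esub> (m p)) (\<lambda>g r. sw H RR (\<rho>\<^sub>2 q2) (\<lambda>k t. F r (g \<cdot>\<^bsub>H\<^esub> (\<xi> q1 \<cdot>\<^bsub>H\<^esub> k)) t))"
  have "sw RR RR (\<Delta>\<^sub>2 w) (\<lambda>p q. sw RR RR (\<Delta>\<^sub>2 q) (\<lambda>q1 q2. ?G p q1 q2)) = sw RR RR (\<Delta>\<^sub>2 w) (\<lambda>p q. sw RR RR (\<Delta>\<^sub>2 p) (\<lambda>p1 p2. ?G p1 p2 q))"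
    by (rule SQ_coassoc[symmetric]) simp_all
  also have "\<dots> = sw RR RR (\<Delta>\<^sub>2 w) (\<lambda>p q. sw RR RR (\<Delta>\<^sub>2 p) (\<lambda>p1 p2. sw H RR (\<rho>\<^sub>2 p2) (\<lambda>g r. sw H RR (\<rho>\<^sub>2 q) (\<lambda>k t. F (m r) (\<xi> p1 \<cdot>\<^bsub>H\<^esub> (g \<cdot>\<^bsub>H\<^esub> k)) t))))"
  proof (rule sw_cong)
    fix p q assume [simp]: "p \<in> carr RR" "q \<in> carr RR"
    show "sw RR RR (\<Delta>\<^sub>2 p) (\<lambda>p1 p2. ?G p1 p2 q) = sw RR RR (\<Delta>\<^sub>2 p) (\<lambda>p1 p2. sw H RR (\<rho>\<^sub>2 p2) (\<lambda>g r. sw H RR (\<rho>\<^sub>2 q) (\<lambda>k t. F (m r) (\<xi> p1 \<cdot>\<^bsub>H\<^esub> (g \<cdot>\<^bsub>H\<^esub> k)) t)))"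
      using ax_c[of p "\<lambda>v r. sw H RR (\<rho>\<^sub>2 q) (\<lambda>k t. F r (v \<cdot>\<^bsub>H\<^esub> k) t)"] by simp
  qed simp_all
  also have "\<dots> = sw RR RR (\<Delta>\<^sub>2 w) (\<lambda>p q. sw H RR (\<rho>\<^sub>2 q) (\<lambda>g s. sw RR RR (\<Delta>\<^sub>2 s) (\<lambda>s1 s2. F (m s1) (\<xi> p \<cdot>\<^bsub>H\<^esub> g) s2)))"
    by (simp add: SQ_coassoc SQ_cop_colin)
  finally show ?thesis .
qed

end

locale pbc_smash = pbc H R m \<xi> u + smash_coalg H R A
  for H :: "('k::field, 'h::ab_group_add, 'z) hopf_scheme"
    and R :: "('k, 'h, 'r::ab_group_add, 'y) ydcoalg_scheme" and m \<xi> u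
    and A :: "('k, ('k, 'r, 'h) tensor, 'x) bialg_scheme" +
  assumes mul_A: "x \<in> carr (tprod R H) \<Longrightarrow> y \<in> carr (tprod R H) \<Longrightarrow> x \<cdot>\<^bsub>A\<^esub> y =
    sw R H x (\<lambda>r h. sw R H y (\<lambda>s h'.
        sw H H (\<Delta>\<^bsub>H\<^esub> h) (\<lambda>h1 h2. sw R R (\<Delta>\<^bsub>R\<^esub> r) (\<lambda>r1 r2. sw H R (\<rho>\<^bsub>R\<^esub> r2) (\<lambda>g r20.
          sw R R (\<Delta>\<^bsub>R\<^esub> (act R h1 s)) (\<lambda>s1 s2.
            tens R H (m (tens R R r1 (act R g s1)))
                     (\<xi> (tens R R r20 s2) \<cdot>\<^bsub>H\<^esub> h2 \<cdot>\<^bsub>H\<^esub> h')))))))"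
    and unt_A: "\<one>\<^bsub>A\<^esub> = tens R H u \<one>\<^bsub>H\<^esub>"
begin

text \<open>Axiom (a) splits \<xi>, the coalgebra map property splits \<open>m\<close>, and the two
  inner components then stand in the wrong order; exchanging them is axiom (c).\<close>

lemma cop_M:
  assumes z [simp]: "z \<in> carr RR"
  shows "\<Delta>\<^bsub>A\<^esub> (M z) = sw RR RR (\<Delta>\<^sub>2 z) (\<lambda>z1 z2.
         sw H RR (\<rho>\<^sub>2 z2) (\<lambda>g z20. tens (tprod R H) (tprod R H) (rmul (M z1) g) (M z20)))"
proof (rule eq_by_forms)
  fix \<phi> assume \<phi>: "lin (tprod (tprod R H) (tprod R H)) Kspace \<phi>"
  note [simp] = linD[OF \<phi>, unfolded scl_tprod scl_Kspace]
  have mc: "sw RR RR (\<Delta>\<^sub>2 w) (\<lambda>p q. sw RR RR (\<Delta>\<^sub>2 q) (\<lambda>q1 q2. sw H RR (\<rho>\<^sub>2 q2) (\<lambda>k t. sw H R (\<rho>\<^bsub>R\<^esub> (m p)) (\<lambda>g r.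
        \<phi> (tens (tprod R H) (tprod R H) (tens R H a (g \<cdot>\<^bsub>H\<^esub> (\<xi> q1 \<cdot>\<^bsub>H\<^esub> k))) (tens R H r (\<xi> t))))))) =
    sw RR RR (\<Delta>\<^sub>2 w) (\<lambda>p q. sw H RR (\<rho>\<^sub>2 q) (\<lambda>g s. sw RR RR (\<Delta>\<^sub>2 s) (\<lambda>s1 s2.
        \<phi> (tens (tprod R H) (tprod R H) (tens R H a (\<xi> p \<cdot>\<^bsub>H\<^esub> g)) (tens R H (m s1) (\<xi> s2))))))"
    if "w \<in> carr RR" "a \<in> carr R" for w a
    using that move_c[of w "\<lambda>r g t. \<phi> (tens (tprod R H) (tprod R H) (tens R H a g) (tens R H r (\<xi> t)))"]
    by (simp add: sw_swap[of H RR _ H R])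
  show "\<phi> (\<Delta>\<^bsub>A\<^esub> (M z)) = \<phi> (sw RR RR (\<Delta>\<^sub>2 z) (\<lambda>z1 z2.
         sw H RR (\<rho>\<^sub>2 z2) (\<lambda>g z20. tens (tprod R H) (tprod R H) (rmul (M z1) g) (M z20))))"
    unfolding M_def
    apply (simp add: cop_xi SQ_coassoc)
    apply (simp add: mc)
    apply (rule sym)
    apply (subst sw_swap[of RR RR _ RR RR])
    apply (simp add: SQ_coassoc sw_swap[of H RR _ RR RR])
    done
qed (simp_all)

lemma lmul_M:
  assumes z [simp]: "z \<in> carr RR" "h \<in> carr H"
  shows "lmul h (M z) = sw H H (\<Delta>\<^bsub>H\<^esub> h) (\<lambda>h1 h2. rmul (M (act (ytens H R R) h1 z)) h2)"
proof (rule eq_by_forms)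
  fix \<phi> assume \<phi>: "lin (tprod R H) Kspace \<phi>"
  note [simp] = linD[OF \<phi>, unfolded scl_tprod scl_Kspace]
  have b: "sw H H (\<Delta>\<^bsub>H\<^esub> k) (\<lambda>h1 h2. \<phi> (tens R H a (\<xi> (act (ytens H R R) h1 w) \<cdot>\<^bsub>H\<^esub> h2))) = \<phi> (tens R H a (k \<cdot>\<^bsub>H\<^esub> \<xi> w))"
    if "k \<in> carr H" "w \<in> carr RR" "a \<in> carr R" for k w a
    using that by (intro ax_b) simp_all
  show "\<phi> (lmul h (M z)) = \<phi> (sw H H (\<Delta>\<^bsub>H\<^esub> h) (\<lambda>h1 h2. rmul (M (act (ytens H R R) h1 z)) h2))"
    unfolding M_def
    apply (simp add: act_m)
    apply (simp add: H.coassoc b sw_swap[of H H _ RR RR])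
    done
qed (simp_all)

lemma cou_M:
  assumes z [simp]: "z \<in> carr RR"
  shows "\<epsilon>\<^bsub>A\<^esub> (M z) = \<epsilon>\<^bsub>ytens H R R\<^esub> z"
  by (simp add: M_def SQ_counit)

lemma M_u: shows "r \<in> carr R \<Longrightarrow> M (tens R R r u) = tens R H r \<one>\<^bsub>H\<^esub>" "r \<in> carr R \<Longrightarrow> M (tens R R u r) = tens R H r \<one>\<^bsub>H\<^esub>"
proof -
  have 1: "\<phi> (M (tens R R r u)) = \<phi> (tens R H r \<one>\<^bsub>H\<^esub>)" "\<phi> (M (tens R R u r)) = \<phi> (tens R H r \<one>\<^bsub>H\<^esub>)"
    if [simp]: "r \<in> carr R" and \<phi>: "lin (tprod R H) Kspace \<phi>" for r \<phi>
  proof -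
    note [simp] = linD[OF \<phi>, unfolded scl_tprod scl_Kspace]
    show "\<phi> (M (tens R R r u)) = \<phi> (tens R H r \<one>\<^bsub>H\<^esub>)" "\<phi> (M (tens R R u r)) = \<phi> (tens R H r \<one>\<^bsub>H\<^esub>)"
      unfolding M_def
      by (simp_all add: mult.assoc) (simp_all add: sw_mult[symmetric] counit counit_coact cou_colin)
  qed
  show "M (tens R R r u) = tens R H r \<one>\<^bsub>H\<^esub>" if "r \<in> carr R"
    by (rule eq_by_forms[OF vspace_tprod[of R H]]) (use 1 that in simp_all)
  show "M (tens R R u r) = tens R H r \<one>\<^bsub>H\<^esub>" if "r \<in> carr R"
    by (rule eq_by_forms[OF vspace_tprod[of R H]]) (use 1 that in simp_all)
qed

text \<open>Axioms (d) and (e) are the components of associativity in \<open>R\<close> and in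
  \<open>H\<close>. To use them together, the left side is sorted into an (d)-expression in the
  first components and an (e)-expression in the second components of \<open>r \<otimes> s\<close>
  and \<open>t\<close>. The sorting needs (a) to split \<xi> and (c) to reorder.\<close>

lemma assoc_M:
  assumes [simp]: "r \<in> carr R" "s \<in> carr R" "t \<in> carr R"
  shows "sw R H (M (tens R R r s)) (\<lambda>a g. sw H H (\<Delta>\<^bsub>H\<^esub> g) (\<lambda>g1 g2. rmul (M (tens R R a (act R g1 t))) g2)) =
       sw R H (M (tens R R s t)) (\<lambda>a g. rmul (M (tens R R r a)) g)"
proof (rule eq_by_forms)
  fix \<phi> assume \<phi>: "lin (tprod R H) Kspace \<phi>"
  note [simp] = linD[OF \<phi>, unfolded scl_tprod scl_Kspace]
  \<comment> \<open>The right sides of (d) and (e) and the left side of (e), with pure tensors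
    replaced by arbitrary elements of \<open>R \<otimes> R\<close>, so that they can be recognised
    inside Sweedler sums.\<close>
  define Fz where "Fz z t = sw RR RR (\<Delta>\<^sub>2 z) (\<lambda>z1 z2. m (tens R R (m z1) (act R (\<xi> z2) t)))" for z t
  define Gz where "Gz z t = sw RR RR (\<Delta>\<^sub>2 z) (\<lambda>z1 z2. sw H H (\<Delta>\<^bsub>H\<^esub> (\<xi> z2)) (\<lambda>x1 x2. \<xi> (tens R R (m z1) (act R x1 t)) \<cdot>\<^bsub>H\<^esub> x2))" for z t
  define Gw where "Gw r w = sw RR RR (\<Delta>\<^sub>2 w) (\<lambda>w1 w2. \<xi> (tens R R r (m w1)) \<cdot>\<^bsub>H\<^esub> \<xi> w2)" for r w
  have Fz: "bilin RR R R Fz" by (simp add: Fz_def)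
  have Gz: "bilin RR R H Gz" by (simp add: Gz_def)
  have Gw: "bilin R RR H Gw" by (simp add: Gw_def)
  have Fz_tens: "Fz (tens R R x y) v = m (tens R R x (m (tens R R y v)))" if "x \<in> carr R" "y \<in> carr R" "v \<in> carr R" for x y v
    using that ax_d by (simp only: Fz_def)
  have Gz_tens: "Gz (tens R R x y) v = Gw x (tens R R y v)" if "x \<in> carr R" "y \<in> carr R" "v \<in> carr R" for x y v
    using that ax_e by (simp only: Gz_def Gw_def)
  have Gw_fold: "sw RR RR (\<Delta>\<^sub>2 q) (\<lambda>w1 w2. \<phi> (tens R H a (\<xi> (tens R R x (m w1)) \<cdot>\<^bsub>H\<^esub> \<xi> w2))) = \<phi> (tens R H a (Gw x q))"
    if "q \<in> carr RR" "a \<in> carr R" "x \<in> carr R" for q a x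
    using that by (simp add: Gw_def)
  \<comment> \<open>Kept opaque, so that the comultiplications of \<open>r \<otimes> s\<close> and
    \<open>s \<otimes> t\<close> are not expanded before the sums are sorted.\<close>
  define z where "z = tens R R r s"
  define w where "w = tens R R s t"
  have z [simp]: "z \<in> carr RR" by (simp add: z_def)
  have w [simp]: "w \<in> carr RR" by (simp add: w_def)
  have mc: "sw RR RR (\<Delta>\<^sub>2 w) (\<lambda>p q. sw RR RR (\<Delta>\<^sub>2 q) (\<lambda>q1 q2. sw H RR (\<rho>\<^sub>2 q2) (\<lambda>k q20. sw H R (\<rho>\<^bsub>R\<^esub> (m p)) (\<lambda>g r. sw H H (\<Delta>\<^bsub>H\<^esub> (\<xi> q20)) (\<lambda>x2 x3.
        \<phi> (tens R H (m (tens R R a (act R g (act R (\<xi> q1) (act R k t1))))) (\<xi> (tens R R r (act R x2 t2)) \<cdot>\<^bsub>H\<^esub> x3))))))) =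
    sw RR RR (\<Delta>\<^sub>2 w) (\<lambda>p q. sw H RR (\<rho>\<^sub>2 q) (\<lambda>g s. sw RR RR (\<Delta>\<^sub>2 s) (\<lambda>s1 s2. sw H H (\<Delta>\<^bsub>H\<^esub> (\<xi> s2)) (\<lambda>x2 x3.
        \<phi> (tens R H (m (tens R R a (act R (\<xi> p) (act R g t1)))) (\<xi> (tens R R (m s1) (act R x2 t2)) \<cdot>\<^bsub>H\<^esub> x3))))))"
    if "w \<in> carr RR" "a \<in> carr R" "t1 \<in> carr R" "t2 \<in> carr R" for w a t1 t2
    using that move_c[of w "\<lambda>r g q20. sw H H (\<Delta>\<^bsub>H\<^esub> (\<xi> q20)) (\<lambda>x2 x3.
        \<phi> (tens R H (m (tens R R a (act R g t1))) (\<xi> (tens R R r (act R x2 t2)) \<cdot>\<^bsub>H\<^esub> x3)))"]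
    by (simp add: sw_swap[of H RR _ H R])
  \<comment> \<open>Axiom (a) is applied to the outer comultiplication alone; the inner one of
    \<open>\<xi> q20\<close> must survive, since it belongs to \<open>Gz\<close>.\<close>
  have xi3: "sw H H (\<Delta>\<^bsub>H\<^esub> (\<xi> q)) (\<lambda>x1 x'. sw H H (\<Delta>\<^bsub>H\<^esub> x') (F x1)) =
     sw RR RR (\<Delta>\<^sub>2 q) (\<lambda>q1 q2. sw H RR (\<rho>\<^sub>2 q2) (\<lambda>k q20. sw H H (\<Delta>\<^bsub>H\<^esub> (\<xi> q20)) (\<lambda>x2 x3. F (\<xi> q1 \<cdot>\<^bsub>H\<^esub> k) x2 x3)))"
     if [simp]: "q \<in> carr RR" and F: "\<And>b c. b \<in> carr H \<Longrightarrow> c \<in> carr H \<Longrightarrow> lin H Kspace (\<lambda>a. F a b c)"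
    "\<And>a c. a \<in> carr H \<Longrightarrow> c \<in> carr H \<Longrightarrow> lin H Kspace (\<lambda>b. F a b c)"
    "\<And>a b. a \<in> carr H \<Longrightarrow> b \<in> carr H \<Longrightarrow> lin H Kspace (\<lambda>c. F a b c)"
     for q F
  proof -
    note [simp] = lin_comp[OF F(1)] lin_comp[OF F(2)] lin_comp[OF F(3)]
    have "bilin H H Kspace (\<lambda>x1 x'. sw H H (\<Delta>\<^bsub>H\<^esub> x') (F x1))" by simp
    then show ?thesis by (subst cop_xi) simp_all
  qed
  have "\<phi> (sw R H (M z) (\<lambda>a g. sw H H (\<Delta>\<^bsub>H\<^esub> g) (\<lambda>g1 g2. rmul (M (tens R R a (act R g1 t))) g2))) =
      sw RR RR (\<Delta>\<^sub>2 z) (\<lambda>z1 z2. sw H RR (\<rho>\<^sub>2 z2) (\<lambda>k z20. sw R R (\<Delta>\<^bsub>R\<^esub> t) (\<lambda>t1 t2.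
        \<phi> (tens R H (Fz z1 (act R k t1)) (Gz z20 t2)))))"
    unfolding M_def Fz_def Gz_def
    apply (simp add: H.coassoc)
    apply (simp add: SQ_coassoc H.coassoc sw_swap[of H R _ RR RR] sw_swap[of H H _ RR RR] sw_swap[of H H _ R R] sw_swap[of H R _ R R])
    apply (simp add: xi3)
    apply (simp add: sw_swap[of H H _ H R] sw_swap[of RR RR _ R R] sw_swap[of H RR _ R R] mc)
    apply (rule sym)
    apply (subst sw_swap[of RR RR _ RR RR])
    apply (simp add: SQ_coassoc sw_swap[of H RR _ RR RR])
    done
  also have "\<dots> = \<phi> (sw R H (M w) (\<lambda>a g. rmul (M (tens R R r a)) g))"
    unfolding M_def
    apply (simp add: act_m[symmetric] SQ_coassoc sw_swap[of RR RR _ R R] sw_swap[of RR RR _ H R] Gw_fold)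
    apply (simp add: z_def w_def bilinD[OF Fz] bilinD[OF Gz] bilinD[OF Gw] Fz_tens Gz_tens comod
     sw_swap[of H R _ R R] sw_swap[of H H _ H R] sw_swap[of H H _ R R])
    done
  finally show "\<phi> (sw R H (M (tens R R r s)) (\<lambda>a g. sw H H (\<Delta>\<^bsub>H\<^esub> g) (\<lambda>g1 g2. rmul (M (tens R R a (act R g1 t))) g2))) =
       \<phi> (sw R H (M (tens R R s t)) (\<lambda>a g. rmul (M (tens R R r a)) g))"
    by (simp add: z_def w_def)
qed simp_all

lemma mul_A_M:
  assumes x [simp]: "x \<in> carr (tprod R H)" and y [simp]: "y \<in> carr (tprod R H)"
  shows "x \<cdot>\<^bsub>A\<^esub> y = sw R H x (\<lambda>r h. sw R H y (\<lambda>s h'. sw H H (\<Delta>\<^bsub>H\<^esub> h) (\<lambda>h1 h2.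
       rmul (M (tens R R r (act R h1 s))) (h2 \<cdot>\<^bsub>H\<^esub> h'))))"
proof (rule eq_by_forms)
  fix \<phi> assume \<phi>: "lin (tprod R H) Kspace \<phi>"
  note [simp] = linD[OF \<phi>, unfolded scl_tprod scl_Kspace]
  show "\<phi> (x \<cdot>\<^bsub>A\<^esub> y) = \<phi> (sw R H x (\<lambda>r h. sw R H y (\<lambda>s h'. sw H H (\<Delta>\<^bsub>H\<^esub> h) (\<lambda>h1 h2.
       rmul (M (tens R R r (act R h1 s))) (h2 \<cdot>\<^bsub>H\<^esub> h')))))"
    unfolding mul_A[OF x y] M_def
    apply (simp)
    apply (simp add: sw_swap[of H R _ H H] sw_swap[of H R _ R R])
    done
qed (simp_all add: mul_A)

sublocale smash_alg H R A M u
  by unfold_locales (simp_all add: lin_M cop_M cou_M lmul_M assoc_M M_u mul_A_M unt_A)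

end

subsection \<open>Twisting a bialgebra by a cocycle\<close>

lemma carr_ctens [simp]: "carr (ctens C D) = carr (tprod C D)"
  and scl_ctens [simp]: "scl (ctens C D) = tscale"
  by (simp_all add: ctens_def)

lemmas ctens_norm [simp] = sw_vs_cong[where V = "ctens C D" and V' = "tprod C D" for C D, simplified]

locale coalg_pair = C: coalg C + D: coalg D
  for C :: "('k::field, 'c::ab_group_add, 'z) coalg_scheme" and D :: "('k, 'd::ab_group_add, 'y) coalg_scheme"
begin

lemma cop_ctens_lin [simp]: "lin (tprod C D) (tprod (tprod C D) (tprod C D)) (\<Delta>\<^bsub>ctens C D\<^esub>)"
  by (simp add: ctens_def)
lemma cou_ctens_lin [simp]: "lin (tprod C D) Kspace (\<epsilon>\<^bsub>ctens C D\<^esub>)"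
  by (simp add: ctens_def)
lemmas [simp] = linD[OF cop_ctens_lin, unfolded scl_tprod] linD[OF cou_ctens_lin, unfolded scl_tprod scl_Kspace]

lemma cop_ctens_tens [simp]:
  assumes [simp]: "x \<in> carr C" "y \<in> carr D"
  shows "\<Delta>\<^bsub>ctens C D\<^esub> (tens C D x y) = sw C C (\<Delta>\<^bsub>C\<^esub> x) (\<lambda>x1 x2. sw D D (\<Delta>\<^bsub>D\<^esub> y) (\<lambda>y1 y2.
          tens (tprod C D) (tprod C D) (tens C D x1 y1) (tens C D x2 y2)))"
  by (simp add: ctens_def sw_tens[where U="tprod (tprod C D) (tprod C D)"])

lemma cou_ctens_tens [simp]:
  assumes [simp]: "x \<in> carr C" "y \<in> carr D"
  shows "\<epsilon>\<^bsub>ctens C D\<^esub> (tens C D x y) = \<epsilon>\<^bsub>C\<^esub> x * \<epsilon>\<^bsub>D\<^esub> y"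
  by (simp add: ctens_def)

lemma coalgebra_ctens: "coalgebra (ctens C D)"
proof -
  have 1: "sw X X (\<Delta>\<^bsub>ctens C D\<^esub> x) (\<lambda>a b. sw X X (\<Delta>\<^bsub>ctens C D\<^esub> a) (\<lambda>c d. tens X (tprod X X) c (tens X X d b)))
          = sw X X (\<Delta>\<^bsub>ctens C D\<^esub> x) (\<lambda>a b. tens X (tprod X X) a (\<Delta>\<^bsub>ctens C D\<^esub> b))"
    if x: "x \<in> carr (tprod C D)" and X: "X = tprod C D" for x X
    unfolding X
  proof (rule eq_by_forms)
    fix \<phi> assume \<phi>: "lin (tprod (tprod C D) (tprod (tprod C D) (tprod C D))) Kspace \<phi>"
    note [simp] = linD[OF \<phi>, unfolded scl_tprod scl_Kspace]
    let ?X = "tprod C D"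
    show "\<phi> (sw ?X ?X (\<Delta>\<^bsub>ctens C D\<^esub> x) (\<lambda>a b. sw ?X ?X (\<Delta>\<^bsub>ctens C D\<^esub> a) (\<lambda>c d. tens ?X (tprod ?X ?X) c (tens ?X ?X d b)))) =
      \<phi> (sw ?X ?X (\<Delta>\<^bsub>ctens C D\<^esub> x) (\<lambda>a b. tens ?X (tprod ?X ?X) a (\<Delta>\<^bsub>ctens C D\<^esub> b)))"
      apply (rule tprod_ext[OF _ _ vspace_Kspace _ _ _ x])
      apply (simp_all)
      apply (simp add: sw_swap[of D D _ C C] C.coassoc D.coassoc)
      done
  qed (simp_all add: x)
  have 2: "sw X X (\<Delta>\<^bsub>ctens C D\<^esub> x) (\<lambda>a b. tscale (\<epsilon>\<^bsub>ctens C D\<^esub> a) b) = x \<and>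
        sw X X (\<Delta>\<^bsub>ctens C D\<^esub> x) (\<lambda>a b. tscale (\<epsilon>\<^bsub>ctens C D\<^esub> b) a) = x"
    if x [simp]: "x \<in> carr (tprod C D)" and X: "X = tprod C D" for X x
    unfolding X
  proof (intro conjI; rule eq_by_forms)
    fix \<phi> assume \<phi>: "lin (tprod C D) Kspace \<phi>"
    note [simp] = linD[OF \<phi>, unfolded scl_tprod scl_Kspace]
    show "\<phi> (sw (tprod C D) (tprod C D) (\<Delta>\<^bsub>ctens C D\<^esub> x) (\<lambda>a b. tscale (\<epsilon>\<^bsub>ctens C D\<^esub> a) b)) = \<phi> x"
      by (rule tprod_ext[OF _ _ vspace_Kspace _ _ _ x], simp_all add: \<phi>)
         (simp add: mult.assoc C.counit D.counit sw_mult[symmetric])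
    show "\<phi> (sw (tprod C D) (tprod C D) (\<Delta>\<^bsub>ctens C D\<^esub> x) (\<lambda>a b. tscale (\<epsilon>\<^bsub>ctens C D\<^esub> b) a)) = \<phi> x"
      by (rule tprod_ext[OF _ _ vspace_Kspace _ _ _ x], simp_all add: \<phi>)
         (simp add: mult.assoc C.counit D.counit sw_mult[symmetric])
  qed (simp_all)
  show ?thesis
    using 1 2 unfolding coalgebra_def ctens_norm carr_ctens by simp
qed

sublocale CD: coalg "ctens C D" by unfold_locales (rule coalgebra_ctens)

lemmas CD_coassoc = CD.coassoc[unfolded ctens_norm carr_ctens]
lemmas CD_counit = CD.counit[unfolded ctens_norm carr_ctens]

end

section \<open>Uniqueness of convolution inverses\<close>

context coalg begin

text \<open>\<open>V' = V' * (V * U') = (V' * V) * U' = U'\<close>. A left and a right inverse given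
  by different formulas agree; every comparison of inverses below has this shape.\<close>

lemma conv_inv_unique:
  assumes V: "lin C Kspace V" "lin C Kspace V'" "lin C Kspace U'"
    and VV: "\<And>x. x \<in> carr C \<Longrightarrow> sw C C (\<Delta>\<^bsub>C\<^esub> x) (\<lambda>a b. V' a * V b) = \<epsilon>\<^bsub>C\<^esub> x"
    and UU: "\<And>x. x \<in> carr C \<Longrightarrow> sw C C (\<Delta>\<^bsub>C\<^esub> x) (\<lambda>a b. V a * U' b) = \<epsilon>\<^bsub>C\<^esub> x"
    and x [simp]: "x \<in> carr C"
  shows "V' x = U' x"
proof -
  note [simp] = linD[OF V(1), unfolded scl_Kspace] linD[OF V(2), unfolded scl_Kspace] linD[OF V(3), unfolded scl_Kspace]
  have "V' x = sw C C (\<Delta>\<^bsub>C\<^esub> x) (\<lambda>a b. V' a * \<epsilon>\<^bsub>C\<^esub> b)"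
    using V by (simp add: counit)
  also have "\<dots> = sw C C (\<Delta>\<^bsub>C\<^esub> x) (\<lambda>a b. sw C C (\<Delta>\<^bsub>C\<^esub> b) (\<lambda>c d. V' a * V c * U' d))"
    by (simp add: UU[symmetric] sw_mult mult.assoc)
  also have "\<dots> = sw C C (\<Delta>\<^bsub>C\<^esub> x) (\<lambda>a b. sw C C (\<Delta>\<^bsub>C\<^esub> a) (\<lambda>c d. V' c * V d * U' b))"
    by (rule coassoc[symmetric]) (use V in simp_all)
  also have "\<dots> = sw C C (\<Delta>\<^bsub>C\<^esub> x) (\<lambda>a b. \<epsilon>\<^bsub>C\<^esub> a * U' b)"
    by (simp add: VV sw_mult(2)[symmetric])
  also have "\<dots> = U' x" using V by (simp add: counit)
  finally show ?thesis .
qed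

end

locale twist = bialg B for B :: "('k::field, 'b::ab_group_add, 'z) bialg_scheme" +
  fixes \<gamma> \<gamma>' :: "('k, 'b, 'b) tensor \<Rightarrow> 'k"
  assumes lin_g: "lin (tprod B B) Kspace \<gamma>" and lin_g': "lin (tprod B B) Kspace \<gamma>'"
    and inv1: "w \<in> carr (tprod B B) \<Longrightarrow> sw (tprod B B) (tprod B B) (\<Delta>\<^bsub>ctens B B\<^esub> w) (\<lambda>a b. \<gamma> a * \<gamma>' b) = \<epsilon>\<^bsub>ctens B B\<^esub> w"
    and inv2: "w \<in> carr (tprod B B) \<Longrightarrow> sw (tprod B B) (tprod B B) (\<Delta>\<^bsub>ctens B B\<^esub> w) (\<lambda>a b. \<gamma>' a * \<gamma> b) = \<epsilon>\<^bsub>ctens B B\<^esub> w"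
    and cocycle: "x \<in> carr B \<Longrightarrow> y \<in> carr B \<Longrightarrow> z \<in> carr B \<Longrightarrow>
     sw B B (\<Delta>\<^bsub>B\<^esub> y) (\<lambda>y1 y2. sw B B (\<Delta>\<^bsub>B\<^esub> z) (\<lambda>z1 z2.
            \<gamma> (tens B B y1 z1) * \<gamma> (tens B B x (y2 \<cdot>\<^bsub>B\<^esub> z2))))
          = sw B B (\<Delta>\<^bsub>B\<^esub> x) (\<lambda>x1 x2. sw B B (\<Delta>\<^bsub>B\<^esub> y) (\<lambda>y1 y2.
            \<gamma> (tens B B x1 y1) * \<gamma> (tens B B (x2 \<cdot>\<^bsub>B\<^esub> y2) z)))"
    and g_unt [simp]: "x \<in> carr B \<Longrightarrow> \<gamma> (tens B B x \<one>\<^bsub>B\<^esub>) = \<epsilon>\<^bsub>B\<^esub> x" "x \<in> carr B \<Longrightarrow> \<gamma> (tens B B \<one>\<^bsub>B\<^esub> x) = \<epsilon>\<^bsub>B\<^esub> x"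
begin

abbreviation E where "E \<equiv> tprod B B"
abbreviation DE where "DE \<equiv> \<Delta>\<^bsub>ctens B B\<^esub>"

sublocale E: coalg_pair B B ..
sublocale T: coalg_pair "ctens B B" B ..

lemmas [simp] = linD[OF lin_g, unfolded scl_tprod scl_Kspace] linD[OF lin_g', unfolded scl_tprod scl_Kspace]
lemmas [simp] = linD[OF T.cop_ctens_lin, unfolded ctens_norm] linD[OF T.cou_ctens_lin, unfolded ctens_norm]

definition p where "p w = sw B B w (\<lambda>x y. x \<cdot>\<^bsub>B\<^esub> y)"
lemma lin_p: "lin E B p" by (simp add: p_def[abs_def])
lemmas [simp] = linD[OF lin_p, unfolded scl_tprod]
lemma p_tens [simp]: "x \<in> carr B \<Longrightarrow> y \<in> carr B \<Longrightarrow> p (tens B B x y) = x \<cdot>\<^bsub>B\<^esub> y"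
  by (simp add: p_def sw_tens[where U=B])
lemma cop_p [simp]:
  assumes w: "w \<in> carr E" shows "\<Delta>\<^bsub>B\<^esub> (p w) = sw E E (DE w) (\<lambda>a b. tens B B (p a) (p b))"
proof (rule eq_by_forms)
  fix \<phi> assume \<phi>: "lin (tprod B B) Kspace \<phi>"
  note [simp] = linD[OF \<phi>, unfolded scl_tprod scl_Kspace]
  show "\<phi> (\<Delta>\<^bsub>B\<^esub> (p w)) = \<phi> (sw E E (DE w) (\<lambda>a b. tens B B (p a) (p b)))"
    by (rule tprod_ext[OF _ _ vspace_Kspace _ _ _ w]) simp_all
qed (simp_all add: w)
lemma cou_p [simp]:
  assumes w: "w \<in> carr E" shows "\<epsilon>\<^bsub>B\<^esub> (p w) = \<epsilon>\<^bsub>ctens B B\<^esub> w"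
  by (rule tprod_ext[OF _ _ vspace_Kspace _ _ _ w]) simp_all

text \<open>Half of the twist: \<open>q\<close> is the convolution of \<gamma> with the product
  \<open>p\<close>, and \<open>tp\<close> below convolves \<open>q\<close> with
  \<open>\<gamma>'\<close> on the right. Stopping halfway isolates the one cancellation that is
  needed, \<open>inv_q\<close>.\<close>

definition q where "q w = sw E E (DE w) (\<lambda>w1 w2. scl B (\<gamma> w1) (p w2))"
lemma lin_q: "lin E B q" by (simp add: q_def[abs_def])
lemmas [simp] = linD[OF lin_q, unfolded scl_tprod]

lemma inv_q:
  assumes [simp]: "w \<in> carr E" and F: "lin B Kspace F"
  shows "sw E E (DE w) (\<lambda>a b. \<gamma>' a * F (q b)) = F (p w)"
proof -
  note [simp] = linD[OF F, unfolded scl_Kspace]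
  have "sw E E (DE w) (\<lambda>a b. \<gamma>' a * F (q b)) = sw E E (DE w) (\<lambda>a b. sw E E (DE b) (\<lambda>c d. \<gamma>' a * \<gamma> c * F (p d)))"
    by (simp add: q_def sw_mult mult.assoc)
  also have "\<dots> = sw E E (DE w) (\<lambda>a b. sw E E (DE a) (\<lambda>c d. \<gamma>' c * \<gamma> d * F (p b)))"
    by (rule E.CD_coassoc[symmetric]) simp_all
  also have "\<dots> = sw E E (DE w) (\<lambda>a b. \<epsilon>\<^bsub>ctens B B\<^esub> a * F (p b))"
    by (simp add: sw_mult(2)[symmetric] inv2)
  also have "\<dots> = F (p w)" by (simp add: E.CD_counit)
  finally show ?thesis .
qed

lemma cop_q:
  assumes w [simp]: "w \<in> carr E" shows "\<Delta>\<^bsub>B\<^esub> (q w) = sw E E (DE w) (\<lambda>a b. tens B B (q a) (p b))"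
proof (rule eq_by_forms)
  fix \<phi> assume \<phi>: "lin (tprod B B) Kspace \<phi>"
  note [simp] = linD[OF \<phi>, unfolded scl_tprod scl_Kspace]
  show "\<phi> (\<Delta>\<^bsub>B\<^esub> (q w)) = \<phi> (sw E E (DE w) (\<lambda>a b. tens B B (q a) (p b)))"
    unfolding q_def by (simp add: E.CD_coassoc sw_mult)
qed (simp_all)

definition tp where "tp w = sw E E (DE w) (\<lambda>w1 w2. scl B (\<gamma>' w2) (q w1))"
lemma lin_tp: "lin E B tp" by (simp add: tp_def[abs_def])
lemmas [simp] = linD[OF lin_tp, unfolded scl_tprod]

text \<open>Between the two copies of \<open>tp\<close> on the right stand \<open>\<gamma>'\<close>
  and \<gamma> on neighbouring components; they cancel by \<open>inv_q\<close>. What remains is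
  \<open>cop_q\<close> with a trailing \<open>\<gamma>'\<close>.\<close>

lemma cop_tp:
  assumes w [simp]: "w \<in> carr E" shows "\<Delta>\<^bsub>B\<^esub> (tp w) = sw E E (DE w) (\<lambda>a b. tens B B (tp a) (tp b))"
proof (rule eq_by_forms)
  fix \<phi> assume \<phi>: "lin (tprod B B) Kspace \<phi>"
  note [simp] = linD[OF \<phi>, unfolded scl_tprod scl_Kspace]
  have i: "sw E E (DE v) (\<lambda>a b. sw E E (DE b) (\<lambda>c d. \<gamma>' a * (\<gamma>' d * \<phi> (tens B B x (q c))))) =
     sw E E (DE v) (\<lambda>c d. \<gamma>' d * \<phi> (tens B B x (p c)))" if [simp]: "v \<in> carr E" "x \<in> carr B" for v x
  proof -
    have "sw E E (DE v) (\<lambda>a b. sw E E (DE b) (\<lambda>c d. \<gamma>' a * (\<gamma>' d * \<phi> (tens B B x (q c))))) =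
      sw E E (DE v) (\<lambda>a b. sw E E (DE a) (\<lambda>c d. \<gamma>' c * (\<gamma>' b * \<phi> (tens B B x (q d)))))"
      by (rule E.CD_coassoc[symmetric]) simp_all
    also have "\<dots> = sw E E (DE v) (\<lambda>c d. \<gamma>' d * \<phi> (tens B B x (p c)))"
      using inv_q[of _ "\<lambda>y. \<gamma>' _ * \<phi> (tens B B x y)"] by simp
    finally show ?thesis .
  qed
  show "\<phi> (\<Delta>\<^bsub>B\<^esub> (tp w)) = \<phi> (sw E E (DE w) (\<lambda>a b. tens B B (tp a) (tp b)))"
    unfolding tp_def
    apply (simp add: cop_q E.CD_coassoc sw_mult)
    apply (rule sym)
    apply (subst sw_swap[of E E _ E E])
    apply (simp add: E.CD_coassoc mult.assoc mult.left_commute i)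
    done
qed (simp_all)

lemma cou_tp:
  assumes w [simp]: "w \<in> carr E" shows "\<epsilon>\<^bsub>B\<^esub> (tp w) = \<epsilon>\<^bsub>ctens B B\<^esub> w"
  by (simp add: tp_def q_def E.CD_counit sw_mult(2)[symmetric] inv1 mult.commute[of "\<gamma>' _"])

lemma ext_T:
  assumes "\<And>x y z. x \<in> carr B \<Longrightarrow> y \<in> carr B \<Longrightarrow> z \<in> carr B \<Longrightarrow> f (tens E B (tens B B x y) z) = g (tens E B (tens B B x y) z)"
    "lin (tprod E B) Kspace f" "lin (tprod E B) Kspace g" "t \<in> carr (tprod E B)"
  shows "f t = g t"
proof (rule tprod_ext[OF _ _ vspace_Kspace assms(2,3) _ assms(4)])
  fix w z assume [simp]: "w \<in> carr E" "z \<in> carr B"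
  show "f (tens E B w z) = g (tens E B w z)"
    by (rule tprod_ext[where f = "\<lambda>w. f (tens E B w z)" and g = "\<lambda>w. g (tens E B w z)" and V = B and W = B and U = Kspace])
      (simp_all add: assms(1) lin_comp[OF assms(2)] lin_comp[OF assms(3)])
qed simp_all

text \<open>\<open>U\<close> and \<open>V\<close> are the two sides of the cocycle identity, and \<open>U'\<close> and \<open>V'\<close> their convolution
  inverses, so that \<open>U = V\<close> forces \<open>U' = V'\<close>.\<close>

definition U where "U x v = sw E E (DE v) (\<lambda>v1 v2. \<gamma> v1 * \<gamma> (tens B B x (p v2)))"
definition U' where "U' x v = sw E E (DE v) (\<lambda>v1 v2. \<gamma>' (tens B B x (p v1)) * \<gamma>' v2)"
definition V where "V w z = sw E E (DE w) (\<lambda>v1 v2. \<gamma> v1 * \<gamma> (tens B B (p v2) z))"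
definition V' where "V' w z = sw E E (DE w) (\<lambda>v1 v2. \<gamma>' (tens B B (p v1) z) * \<gamma>' v2)"

lemma bilin_UV: "bilin B E Kspace U" "bilin B E Kspace U'" "bilin E B Kspace V" "bilin E B Kspace V'"
  by (simp_all add: U_def U'_def V_def V'_def)
lemmas [simp] = bilinD[OF bilin_UV(1), unfolded scl_tprod scl_Kspace] bilinD[OF bilin_UV(2), unfolded scl_tprod scl_Kspace]
  bilinD[OF bilin_UV(3), unfolded scl_tprod scl_Kspace] bilinD[OF bilin_UV(4), unfolded scl_tprod scl_Kspace]

lemma UV: "x \<in> carr B \<Longrightarrow> y \<in> carr B \<Longrightarrow> z \<in> carr B \<Longrightarrow> V (tens B B x y) z = U x (tens B B y z)"
  by (simp add: U_def V_def cocycle)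

lemma inv_gen:
  assumes [simp]: "x \<in> carr B" "z \<in> carr B"
  shows "sw B B (\<Delta>\<^bsub>B\<^esub> x) (\<lambda>x1 x2. sw B B (\<Delta>\<^bsub>B\<^esub> z) (\<lambda>z1 z2. \<gamma> (tens B B x1 z1) * \<gamma>' (tens B B x2 z2))) = \<epsilon>\<^bsub>B\<^esub> x * \<epsilon>\<^bsub>B\<^esub> z"
   "sw B B (\<Delta>\<^bsub>B\<^esub> x) (\<lambda>x1 x2. sw B B (\<Delta>\<^bsub>B\<^esub> z) (\<lambda>z1 z2. \<gamma>' (tens B B x1 z1) * \<gamma> (tens B B x2 z2))) = \<epsilon>\<^bsub>B\<^esub> x * \<epsilon>\<^bsub>B\<^esub> z"
  using inv1[of "tens B B x z"] inv2[of "tens B B x z"] by simp_all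

text \<open>The factors cancel from the inside out: the middle pair is inverse at
  \<open>x \<otimes> p v\<close> because \<open>p\<close> is a coalgebra map, and the outer pair is
  then \<gamma> convolved with \<open>\<gamma>'\<close>.\<close>

lemma UU':
  assumes [simp]: "x \<in> carr B" "v \<in> carr E"
  shows "sw B B (\<Delta>\<^bsub>B\<^esub> x) (\<lambda>x1 x2. sw E E (DE v) (\<lambda>v1 v2. U x1 v1 * U' x2 v2)) = \<epsilon>\<^bsub>B\<^esub> x * \<epsilon>\<^bsub>ctens B B\<^esub> v"
proof -
  have core: "sw E E (DE v) (\<lambda>v1 v2. sw B B (\<Delta>\<^bsub>B\<^esub> x) (\<lambda>x1 x2. \<gamma> (tens B B x1 (p v1)) * \<gamma>' (tens B B x2 (p v2)))) = \<epsilon>\<^bsub>B\<^esub> x * \<epsilon>\<^bsub>ctens B B\<^esub> v"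
    if "v \<in> carr E" for v
    using inv_gen(1)[of x "p v"] that by (simp add: sw_swap[of B B _ E E])
  have s1: "sw E E (DE r) (\<lambda>a b. sw E E (DE b) (\<lambda>c d. sw B B (\<Delta>\<^bsub>B\<^esub> x) (\<lambda>x1 x2. \<gamma> (tens B B x1 (p a)) * (\<gamma>' (tens B B x2 (p c)) * \<gamma>' d)))) = \<epsilon>\<^bsub>B\<^esub> x * \<gamma>' r"
    if [simp]: "r \<in> carr E" for r
  proof -
    have "sw E E (DE r) (\<lambda>a b. sw E E (DE b) (\<lambda>c d. sw B B (\<Delta>\<^bsub>B\<^esub> x) (\<lambda>x1 x2. \<gamma> (tens B B x1 (p a)) * (\<gamma>' (tens B B x2 (p c)) * \<gamma>' d)))) =
      sw E E (DE r) (\<lambda>a b. sw E E (DE a) (\<lambda>c d. sw B B (\<Delta>\<^bsub>B\<^esub> x) (\<lambda>x1 x2. \<gamma> (tens B B x1 (p c)) * (\<gamma>' (tens B B x2 (p d)) * \<gamma>' b))))"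
      by (rule E.CD_coassoc[symmetric]) simp_all
    also have "\<dots> = sw E E (DE r) (\<lambda>a b. (\<epsilon>\<^bsub>B\<^esub> x * \<epsilon>\<^bsub>ctens B B\<^esub> a) * \<gamma>' b)"
      by (simp add: sw_mult(2)[symmetric] mult.assoc[symmetric] core)
    also have "\<dots> = \<epsilon>\<^bsub>B\<^esub> x * \<gamma>' r"
      by (simp add: mult.assoc sw_mult(1)[symmetric] E.CD_counit lin_g')
    finally show ?thesis .
  qed
  show ?thesis
    apply (simp add: U_def U'_def sw_mult E.CD_coassoc)
    apply (subst sw_swap[of E E _ E E])
    apply (simp add: E.CD_coassoc sw_swap[of B B _ E E])
    apply (simp add: mult.assoc s1 sw_mult(1)[symmetric])
    apply (simp add: mult.left_commute[of _ "\<epsilon>\<^bsub>B\<^esub> x"] sw_mult(1)[symmetric] inv1)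
    done
qed

text \<open>In the order \<open>V' * V\<close> the inner pair is \<open>\<gamma>'\<close> against
  \<gamma> on \<open>w\<close> itself; the outer pair then cancels at
  \<open>p w \<otimes> z\<close>. Together with \<open>UU'\<close> this provides a left inverse of
  \<open>V\<close> and a right inverse of \<open>U\<close>, as \<open>conv_inv_unique\<close>
  demands.\<close>

lemma VV':
  assumes [simp]: "z \<in> carr B" "w \<in> carr E"
  shows "sw E E (DE w) (\<lambda>w1 w2. sw B B (\<Delta>\<^bsub>B\<^esub> z) (\<lambda>z1 z2. V' w1 z1 * V w2 z2)) = \<epsilon>\<^bsub>ctens B B\<^esub> w * \<epsilon>\<^bsub>B\<^esub> z"
proof -
  have core: "sw E E (DE r) (\<lambda>a b. sw E E (DE b) (\<lambda>c d. \<gamma>' a * (\<gamma> c * F d))) = F r"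
    if [simp]: "r \<in> carr E" and F: "lin E Kspace F" for r F
  proof -
    note [simp] = lin_comp[OF F] F
    have "sw E E (DE r) (\<lambda>a b. sw E E (DE b) (\<lambda>c d. \<gamma>' a * (\<gamma> c * F d))) =
      sw E E (DE r) (\<lambda>a b. sw E E (DE a) (\<lambda>c d. \<gamma>' c * (\<gamma> d * F b)))"
      by (rule E.CD_coassoc[symmetric]) simp_all
    also have "\<dots> = F r"
      by (simp add: sw_mult(2)[symmetric] mult.assoc[symmetric] inv2 E.CD_counit)
    finally show ?thesis .
  qed
  have core': "sw E E (DE r) (\<lambda>a b. sw E E (DE b) (\<lambda>c d. \<gamma>' a * (\<gamma> c * (\<gamma>' (tens B B (p s) z1) * \<gamma> (tens B B (p d) z2))))) = \<gamma>' (tens B B (p s) z1) * \<gamma> (tens B B (p r) z2)"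
    if "r \<in> carr E" "s \<in> carr E" "z1 \<in> carr B" "z2 \<in> carr B" for r s z1 z2
    using that by (intro core) simp_all
  show ?thesis
    apply (simp add: V_def V'_def sw_mult E.CD_coassoc sw_swap[of B B _ E E])
    apply (subst sw_swap[of E E _ E E])
    apply (simp add: E.CD_coassoc)
    apply (simp add: mult.assoc)
    apply (simp add: mult.left_commute[of "\<gamma>' (tens B B _ _)"])
    apply (simp add: sw_swap[of E E _ B B] core')
    using inv_gen(2)[of "p w" z] apply (simp add: sw_swap[of E E _ B B])
    done
qed

lemma UV':
  assumes [simp]: "x \<in> carr B" "y \<in> carr B" "z \<in> carr B"
  shows "V' (tens B B x y) z = U' x (tens B B y z)"
proof -
  let ?T = "tprod E B"
  define VV where "VV t = sw E B t V" for t
  define WW where "WW t = sw E B t V'" for t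
  \<comment> \<open>\<open>U'\<close> takes an element of \<open>B\<close> and one of
    \<open>B \<otimes> B\<close>; it is rebracketed so that both inverses live on the coalgebra
    \<open>(B \<otimes> B) \<otimes> B\<close>.\<close>
  define UU where "UU t = sw E B t (\<lambda>w z. sw B B w (\<lambda>x y. U' x (tens B B y z)))" for t
  have l: "lin ?T Kspace VV" "lin ?T Kspace WW" "lin ?T Kspace UU"
    by (simp_all add: VV_def[abs_def] WW_def[abs_def] UU_def[abs_def])
  note [simp] = linD[OF l(1), unfolded scl_tprod scl_Kspace] linD[OF l(2), unfolded scl_tprod scl_Kspace] linD[OF l(3), unfolded scl_tprod scl_Kspace]
  note T_lin [simp] = linD[OF T.cop_ctens_lin, unfolded ctens_norm] linD[OF T.cou_ctens_lin, unfolded ctens_norm]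
  have VV [simp]: "VV (tens E B w z) = V w z" if "w \<in> carr E" "z \<in> carr B" for w z
    using that by (simp add: VV_def)
  have WW [simp]: "WW (tens E B w z) = V' w z" if "w \<in> carr E" "z \<in> carr B" for w z
    using that by (simp add: WW_def)
  have UU [simp]: "UU (tens E B (tens B B x y) z) = U' x (tens B B y z)" if "x \<in> carr B" "y \<in> carr B" "z \<in> carr B" for x y z
    using that by (simp add: UU_def)
  have "WW t = UU t" if t: "t \<in> carr ?T" for t
  proof (rule T.CD.conv_inv_unique[where V = VV])
    fix t assume t: "t \<in> carr (ctens (ctens B B) B)"
    show "sw (ctens (ctens B B) B) (ctens (ctens B B) B) (\<Delta>\<^bsub>ctens (ctens B B) B\<^esub> t) (\<lambda>a b. WW a * VV b) = \<epsilon>\<^bsub>ctens (ctens B B) B\<^esub> t"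
      unfolding ctens_norm
      apply (rule tprod_ext[where V = E and W = B and U=Kspace])
      using t apply (simp_all add: T.cop_ctens_tens[unfolded ctens_norm carr_ctens] T.cou_ctens_tens[unfolded ctens_norm carr_ctens] VV')
      done
    show "sw (ctens (ctens B B) B) (ctens (ctens B B) B) (\<Delta>\<^bsub>ctens (ctens B B) B\<^esub> t) (\<lambda>a b. VV a * UU b) = \<epsilon>\<^bsub>ctens (ctens B B) B\<^esub> t"
      unfolding ctens_norm
      apply (rule ext_T)
      using t apply (simp_all add: T.cop_ctens_tens[unfolded ctens_norm carr_ctens] T.cou_ctens_tens[unfolded ctens_norm carr_ctens] UV)
      subgoal for x y z using UU'[of x "tens B B y z"] by simp
      done
  qed (use t l in simp_all)
  from this[of "tens E B (tens B B x y) z"] show ?thesis by simp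
qed

definition tmul where "tmul x y = tp (tens B B x y)"
lemma bilin_tmul: "bilin B B B tmul" by (simp add: tmul_def)
lemmas [simp] = bilinD[OF bilin_tmul]

text \<open>The two bracketings surround the untwisted threefold product with \<open>V\<close>,
  \<open>V'\<close> and with \<open>U\<close>, \<open>U'\<close>. The first pair agrees with the
  second by the cocycle identity and by \<open>UV'\<close>, and the untwisted products agree by
  associativity.\<close>

lemma tmul_assoc:
  assumes [simp]: "x \<in> carr B" "y \<in> carr B" "z \<in> carr B"
  shows "tmul (tmul x y) z = tmul x (tmul y z)"
proof (rule eq_by_forms)
  fix \<phi> assume \<phi>: "lin B Kspace \<phi>"
  note [simp] = linD[OF \<phi>, unfolded scl_tprod scl_Kspace]
  define w where "w = tens B B x y"
  define v where "v = tens B B y z"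
  have w [simp]: "w \<in> carr E" by (simp add: w_def)
  have v [simp]: "v \<in> carr E" by (simp add: v_def)
  have "\<phi> (tmul (tp w) z) = sw E E (DE w) (\<lambda>w1 w'. sw B B (\<Delta>\<^bsub>B\<^esub> z) (\<lambda>z1 z'. sw E E (DE w') (\<lambda>w2 w3. sw B B (\<Delta>\<^bsub>B\<^esub> z') (\<lambda>z2 z3.
     V w1 z1 * (V' w3 z3 * \<phi> (p w2 \<cdot>\<^bsub>B\<^esub> z2))))))"
    unfolding tmul_def tp_def q_def V_def V'_def
    apply (simp add: E.CD_coassoc sw_mult)
    apply (simp add: E.CD_coassoc coassoc sw_swap[of B B _ E E])
    apply (subst sw_swap[of E E _ E E])
    apply (simp add: E.CD_coassoc)
    apply (rule sym)
    apply (subst sw_swap[of E E _ E E])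
    apply (subst sw_swap[of E E _ E E])
    apply (simp add: E.CD_coassoc mult_ac)
    done
  moreover have "\<phi> (tmul x (tp v)) = sw B B (\<Delta>\<^bsub>B\<^esub> x) (\<lambda>x1 x'. sw E E (DE v) (\<lambda>v1 v'. sw B B (\<Delta>\<^bsub>B\<^esub> x') (\<lambda>x2 x3. sw E E (DE v') (\<lambda>v2 v3.
     U x1 v1 * (U' x3 v3 * \<phi> (x2 \<cdot>\<^bsub>B\<^esub> p v2))))))"
    unfolding tmul_def tp_def q_def U_def U'_def
    apply (simp add: E.CD_coassoc sw_mult)
    apply (simp add: E.CD_coassoc coassoc sw_swap[of B B _ E E])
    apply (subst sw_swap[of E E _ E E])
    apply (subst sw_swap[of E E _ E E])
    apply (simp add: E.CD_coassoc mult_ac)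
    done
  ultimately show "\<phi> (tmul (tmul x y) z) = \<phi> (tmul x (tmul y z))"
    unfolding w_def v_def by (simp add: UV UV' tmul_def)
qed simp_all

text \<open>At \<open>x \<otimes> 1\<close> and \<open>1 \<otimes> x\<close> the factor \<gamma> in
  \<open>inv_gen\<close> is the counit, which leaves \<open>\<gamma>'\<close> alone on the left
  side.\<close>

lemma g'_unt [simp]:
  assumes [simp]: "x \<in> carr B"
  shows "\<gamma>' (tens B B x \<one>\<^bsub>B\<^esub>) = \<epsilon>\<^bsub>B\<^esub> x" "\<gamma>' (tens B B \<one>\<^bsub>B\<^esub> x) = \<epsilon>\<^bsub>B\<^esub> x"
  using inv_gen(1)[of x "\<one>\<^bsub>B\<^esub>"] inv_gen(1)[of "\<one>\<^bsub>B\<^esub>" x] by (simp_all add: counit)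

lemma tmul_unt:
  assumes [simp]: "x \<in> carr B"
  shows "tmul x \<one>\<^bsub>B\<^esub> = x" "tmul \<one>\<^bsub>B\<^esub> x = x"
proof -
  have 1: "\<phi> (tmul x \<one>\<^bsub>B\<^esub>) = \<phi> x" "\<phi> (tmul \<one>\<^bsub>B\<^esub> x) = \<phi> x" if \<phi>: "lin B Kspace \<phi>" for \<phi>
  proof -
    note [simp] = linD[OF \<phi>, unfolded scl_tprod scl_Kspace] \<phi>
    show "\<phi> (tmul x \<one>\<^bsub>B\<^esub>) = \<phi> x" "\<phi> (tmul \<one>\<^bsub>B\<^esub> x) = \<phi> x"
      unfolding tmul_def tp_def q_def
      by simp_all (simp_all add: counit sw_mult(1)[symmetric])
  qed
  show "tmul x \<one>\<^bsub>B\<^esub> = x" "tmul \<one>\<^bsub>B\<^esub> x = x"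
     by (rule eq_by_forms[OF vsp], use 1 in simp_all)+
qed

lemma cop_tmul:
  assumes [simp]: "x \<in> carr B" "y \<in> carr B"
  shows "\<Delta>\<^bsub>B\<^esub> (tmul x y) = sw B B (\<Delta>\<^bsub>B\<^esub> x) (\<lambda>x1 x2. sw B B (\<Delta>\<^bsub>B\<^esub> y) (\<lambda>y1 y2. tens B B (tmul x1 y1) (tmul x2 y2)))"
proof (rule eq_by_forms)
  fix \<phi> assume \<phi>: "lin (tprod B B) Kspace \<phi>"
  note [simp] = linD[OF \<phi>, unfolded scl_tprod scl_Kspace]
  show "\<phi> (\<Delta>\<^bsub>B\<^esub> (tmul x y)) = \<phi> (sw B B (\<Delta>\<^bsub>B\<^esub> x) (\<lambda>x1 x2. sw B B (\<Delta>\<^bsub>B\<^esub> y) (\<lambda>y1 y2. tens B B (tmul x1 y1) (tmul x2 y2))))"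
    unfolding tmul_def by (simp add: cop_tp)
qed simp_all

lemma tmul_eq:
  assumes [simp]: "x \<in> carr B" "y \<in> carr B"
  shows "tmul x y = sw B B (\<Delta>\<^bsub>B\<^esub> x) (\<lambda>x1 x'. sw B B (\<Delta>\<^bsub>B\<^esub> x') (\<lambda>x2 x3.
     sw B B (\<Delta>\<^bsub>B\<^esub> y) (\<lambda>y1 y'. sw B B (\<Delta>\<^bsub>B\<^esub> y') (\<lambda>y2 y3.
       scl B (\<gamma> (tens B B x1 y1) * \<gamma>' (tens B B x3 y3)) (x2 \<cdot>\<^bsub>B\<^esub> y2)))))"
proof (rule eq_by_forms)
  fix \<phi> assume \<phi>: "lin B Kspace \<phi>"
  note [simp] = linD[OF \<phi>, unfolded scl_tprod scl_Kspace]
  have "\<phi> (tmul x y) = sw E E (DE (tens B B x y)) (\<lambda>w1 w'. sw E E (DE w') (\<lambda>w2 w3. \<gamma> w1 * \<gamma>' w3 * \<phi> (p w2)))"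
    unfolding tmul_def tp_def q_def
    by (simp add: E.CD_coassoc sw_mult mult_ac del: E.cop_ctens_tens)
  also have "\<dots> = \<phi> (sw B B (\<Delta>\<^bsub>B\<^esub> x) (\<lambda>x1 x'. sw B B (\<Delta>\<^bsub>B\<^esub> x') (\<lambda>x2 x3.
     sw B B (\<Delta>\<^bsub>B\<^esub> y) (\<lambda>y1 y'. sw B B (\<Delta>\<^bsub>B\<^esub> y') (\<lambda>y2 y3.
       scl B (\<gamma> (tens B B x1 y1) * \<gamma>' (tens B B x3 y3)) (x2 \<cdot>\<^bsub>B\<^esub> y2))))))"
    apply simp
    apply (subst (2) sw_swap[of B B _ B B])
    apply (rule refl)
    done
  finally show "\<phi> (tmul x y) = \<phi> (sw B B (\<Delta>\<^bsub>B\<^esub> x) (\<lambda>x1 x'. sw B B (\<Delta>\<^bsub>B\<^esub> x') (\<lambda>x2 x3.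
     sw B B (\<Delta>\<^bsub>B\<^esub> y) (\<lambda>y1 y'. sw B B (\<Delta>\<^bsub>B\<^esub> y') (\<lambda>y2 y3.
       scl B (\<gamma> (tens B B x1 y1) * \<gamma>' (tens B B x3 y3)) (x2 \<cdot>\<^bsub>B\<^esub> y2))))))" .
qed simp_all

lemma bialgebra_twist:
  assumes "carr B' = carr B" "scl B' = scl B" "\<Delta>\<^bsub>B'\<^esub> = \<Delta>\<^bsub>B\<^esub>" "\<epsilon>\<^bsub>B'\<^esub> = \<epsilon>\<^bsub>B\<^esub>" "\<one>\<^bsub>B'\<^esub> = \<one>\<^bsub>B\<^esub>"
    and m: "\<And>x y. x \<in> carr B \<Longrightarrow> y \<in> carr B \<Longrightarrow> x \<cdot>\<^bsub>B'\<^esub> y = tmul x y"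
  shows "bialgebra B'"
proof -
  have c: "coalgebra B'" by (rule coalgebra_cong[OF _ _ _ _ coalgebra]) (simp_all add: assms)
  have b: "bilin B B B (mul B')" using bilin_tmul by (simp add: bilin_def lin_def m)
  have e: "\<epsilon>\<^bsub>B\<^esub> (tmul x y) = \<epsilon>\<^bsub>B\<^esub> x * \<epsilon>\<^bsub>B\<^esub> y" if "x \<in> carr B" "y \<in> carr B" for x y
    using that by (simp add: tmul_def cou_tp)
  show ?thesis
    unfolding bialgebra_def sw_vs_cong[OF assms(1,2)] assms
    using c b by (simp add: m tmul_assoc tmul_unt cop_tmul e)
qed

text \<open>Both sides are convolution inverse to \<open>h \<otimes> w \<mapsto> \<gamma> (a h w)\<close> on \<open>H \<otimes> B \<otimes> B\<close>.\<close>

lemma g'_transfer: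
  assumes "coalg H" and a: "bilin H E E a" and b: "bilin H E E b"
    and Da: "\<And>h w. h \<in> carr H \<Longrightarrow> w \<in> carr E \<Longrightarrow> DE (a h w) = sw H H (\<Delta>\<^bsub>H\<^esub> h) (\<lambda>h1 h2. sw E E (DE w) (\<lambda>w1 w2. tens E E (a h1 w1) (a h2 w2)))"
    and Db: "\<And>h w. h \<in> carr H \<Longrightarrow> w \<in> carr E \<Longrightarrow> DE (b h w) = sw H H (\<Delta>\<^bsub>H\<^esub> h) (\<lambda>h1 h2. sw E E (DE w) (\<lambda>w1 w2. tens E E (b h1 w1) (b h2 w2)))"
    and ea: "\<And>h w. h \<in> carr H \<Longrightarrow> w \<in> carr E \<Longrightarrow> \<epsilon>\<^bsub>ctens B B\<^esub> (a h w) = \<epsilon>\<^bsub>H\<^esub> h * \<epsilon>\<^bsub>ctens B B\<^esub> w"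
    and eb: "\<And>h w. h \<in> carr H \<Longrightarrow> w \<in> carr E \<Longrightarrow> \<epsilon>\<^bsub>ctens B B\<^esub> (b h w) = \<epsilon>\<^bsub>H\<^esub> h * \<epsilon>\<^bsub>ctens B B\<^esub> w"
    and g: "\<And>h w. h \<in> carr H \<Longrightarrow> w \<in> carr E \<Longrightarrow> \<gamma> (a h w) = \<gamma> (b h w)"
    and h [simp]: "h \<in> carr H" "w \<in> carr E"
  shows "\<gamma>' (a h w) = \<gamma>' (b h w)"
proof -
  interpret H: coalg H by fact
  interpret HE: coalg_pair H "ctens B B" ..
  note [simp] = bilinD[OF a, unfolded scl_tprod scl_Kspace] bilinD[OF b, unfolded scl_tprod scl_Kspace]
  \<comment> \<open>Composing with a coalgebra map from \<open>H \<otimes> E\<close> to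
    \<open>E\<close> preserves convolution inverses, and both \<open>a\<close> and \<open>b\<close>
    induce such maps.\<close>
  define V where "V t = sw H E t (\<lambda>h w. \<gamma> (a h w))" for t
  define W where "W t = sw H E t (\<lambda>h w. \<gamma>' (a h w))" for t
  define U where "U t = sw H E t (\<lambda>h w. \<gamma>' (b h w))" for t
  have l: "lin (tprod H E) Kspace V" "lin (tprod H E) Kspace W" "lin (tprod H E) Kspace U"
    by (simp_all add: V_def[abs_def] W_def[abs_def] U_def[abs_def])
  note [simp] = linD[OF l(1), unfolded scl_tprod scl_Kspace] linD[OF l(2), unfolded scl_tprod scl_Kspace] linD[OF l(3), unfolded scl_tprod scl_Kspace]
  have [simp]: "V (tens H E h w) = \<gamma> (a h w)" "W (tens H E h w) = \<gamma>' (a h w)" "U (tens H E h w) = \<gamma>' (b h w)"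
    if "h \<in> carr H" "w \<in> carr E" for h w
    using that by (simp_all add: V_def W_def U_def)
  have "W t = U t" if t: "t \<in> carr (tprod H E)" for t
  proof (rule HE.CD.conv_inv_unique[where V = V])
    fix t assume t: "t \<in> carr (ctens H (ctens B B))"
    note [simp] = linD[OF HE.cop_ctens_lin, unfolded ctens_norm] linD[OF HE.cou_ctens_lin, unfolded ctens_norm]
    show "sw (ctens H (ctens B B)) (ctens H (ctens B B)) (\<Delta>\<^bsub>ctens H (ctens B B)\<^esub> t) (\<lambda>a b. W a * V b) = \<epsilon>\<^bsub>ctens H (ctens B B)\<^esub> t"
      unfolding ctens_norm
      apply (rule tprod_ext[where V = H and W = E and U=Kspace])
      using t apply (simp_all add: HE.cop_ctens_tens[unfolded ctens_norm carr_ctens] HE.cou_ctens_tens[unfolded ctens_norm carr_ctens])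
      subgoal for h w
        using inv2[of "a h w"] by (simp add: Da ea)
      done
    show "sw (ctens H (ctens B B)) (ctens H (ctens B B)) (\<Delta>\<^bsub>ctens H (ctens B B)\<^esub> t) (\<lambda>a b. V a * U b) = \<epsilon>\<^bsub>ctens H (ctens B B)\<^esub> t"
      unfolding ctens_norm
      apply (rule tprod_ext[where V = H and W = E and U=Kspace])
      using t apply (simp_all add: HE.cop_ctens_tens[unfolded ctens_norm carr_ctens] HE.cou_ctens_tens[unfolded ctens_norm carr_ctens])
      subgoal for h w
        using inv1[of "b h w"] by (simp add: Db eb g)
      done
  qed (use t l in simp_all)
  from this[of "tens H E h w"] show ?thesis by simp
qed

end

subsection \<open>Bialgebras on the smash coalgebra\<close>

text \<open>By \<open>mul_eq\<close> below, these bialgebras are precisely the smash products \<open>R #\<^sub>\<xi> H\<close>.\<close>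

locale smash_bialg = smash_coalg H R B + B: bialg B
  for H :: "('k::field, 'h::ab_group_add, 'z) hopf_scheme"
    and R :: "('k, 'h, 'r::ab_group_add, 'y) ydcoalg_scheme"
    and B :: "('k, ('k, 'r, 'h) tensor, 'x) bialg_scheme" +
  fixes u :: 'r
  assumes u_carr [simp]: "u \<in> carr R" and cop_u [simp]: "\<Delta>\<^bsub>R\<^esub> u = tens R R u u" and cou_u [simp]: "\<epsilon>\<^bsub>R\<^esub> u = 1"
    and act_u [simp]: "h \<in> carr H \<Longrightarrow> act R h u = scl R (\<epsilon>\<^bsub>H\<^esub> h) u" and coact_u [simp]: "\<rho>\<^bsub>R\<^esub> u = tens H R \<one>\<^bsub>H\<^esub> u"
    and unt_B: "\<one>\<^bsub>B\<^esub> = tens R H u \<one>\<^bsub>H\<^esub>"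
    and sigma_mul: "h \<in> carr H \<Longrightarrow> x \<in> carr (tprod R H) \<Longrightarrow> tens R H u h \<cdot>\<^bsub>B\<^esub> x = lmul h x"
    and mul_sigma: "h \<in> carr H \<Longrightarrow> x \<in> carr (tprod R H) \<Longrightarrow> x \<cdot>\<^bsub>B\<^esub> tens R H u h = rmul x h"
begin

lemmas B_rules [simp] = bilinD[OF B.bilin_mul, unfolded A_norm carr_A scl_A]

abbreviation RR where "RR \<equiv> tprod R R"
abbreviation \<Delta>\<^sub>2 where "\<Delta>\<^sub>2 z \<equiv> \<Delta>\<^bsub>ytens H R R\<^esub> z"
abbreviation \<rho>\<^sub>2 where "\<rho>\<^sub>2 z \<equiv> \<rho>\<^bsub>ytens H R R\<^esub> z"

definition \<mu> where "\<mu> z = sw R R z (\<lambda>r s. inc r \<cdot>\<^bsub>B\<^esub> inc s)"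
definition mB where "mB z = prR (\<mu> z)"
definition xB where "xB z = prH (\<mu> z)"

lemma lin_mu: "lin RR (tprod R H) \<mu>" by (simp add: \<mu>_def[abs_def])
lemmas [simp] = linD[OF lin_mu, unfolded scl_tprod]
lemma lin_mB: "lin RR R mB" by (simp add: mB_def[abs_def])
lemmas [simp] = linD[OF lin_mB, unfolded scl_tprod]
lemma lin_xB: "lin RR H xB" by (simp add: xB_def[abs_def])
lemmas [simp] = linD[OF lin_xB, unfolded scl_tprod]

lemma mu_tens: "r \<in> carr R \<Longrightarrow> s \<in> carr R \<Longrightarrow> \<mu> (tens R R r s) = inc r \<cdot>\<^bsub>B\<^esub> inc s"
  by (simp add: \<mu>_def sw_tens[where U="tprod R H"])

lemma lmul_B: "h \<in> carr H \<Longrightarrow> x \<in> carr (tprod R H) \<Longrightarrow> y \<in> carr (tprod R H) \<Longrightarrow> lmul h x \<cdot>\<^bsub>B\<^esub> y = lmul h (x \<cdot>\<^bsub>B\<^esub> y)"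
  by (simp add: sigma_mul[symmetric])
lemma rmul_B: "h \<in> carr H \<Longrightarrow> x \<in> carr (tprod R H) \<Longrightarrow> y \<in> carr (tprod R H) \<Longrightarrow> rmul x h \<cdot>\<^bsub>B\<^esub> y = x \<cdot>\<^bsub>B\<^esub> lmul h y"
  by (simp add: sigma_mul[symmetric] mul_sigma[symmetric])
lemma B_rmul: "h \<in> carr H \<Longrightarrow> x \<in> carr (tprod R H) \<Longrightarrow> y \<in> carr (tprod R H) \<Longrightarrow> x \<cdot>\<^bsub>B\<^esub> rmul y h = rmul (x \<cdot>\<^bsub>B\<^esub> y) h"
  by (simp add: mul_sigma[symmetric])

text \<open>Since \<open>r # h\<close> is the product of \<open>r # 1\<close> and
  \<open>1 # h\<close>, associativity lets \<open>h\<close> act on the right factor through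
  \<open>lmul\<close>; a product is thus determined by \<open>\<mu>\<close>.\<close>

lemma tens_B:
  assumes [simp]: "r \<in> carr R" "s \<in> carr R" "h \<in> carr H" "k \<in> carr H"
  shows "tens R H r h \<cdot>\<^bsub>B\<^esub> tens R H s k = sw H H (\<Delta>\<^bsub>H\<^esub> h) (\<lambda>h1 h2. rmul (\<mu> (tens R R r (act R h1 s))) (h2 \<cdot>\<^bsub>H\<^esub> k))"
proof -
  have e: "tens R H x h = rmul (inc x) h" if "x \<in> carr R" "h \<in> carr H" for x h using that by simp
  have "tens R H r h \<cdot>\<^bsub>B\<^esub> tens R H s k = inc r \<cdot>\<^bsub>B\<^esub> lmul h (tens R H s k)"
    unfolding e[of r h, OF assms(1,3)] by (simp add: rmul_B del: rmul_tens)
  also have "\<dots> = sw H H (\<Delta>\<^bsub>H\<^esub> h) (\<lambda>h1 h2. inc r \<cdot>\<^bsub>B\<^esub> tens R H (act R h1 s) (h2 \<cdot>\<^bsub>H\<^esub> k))"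
    by simp
  also have "\<dots> = sw H H (\<Delta>\<^bsub>H\<^esub> h) (\<lambda>h1 h2. rmul (\<mu> (tens R R r (act R h1 s))) (h2 \<cdot>\<^bsub>H\<^esub> k))"
  proof (rule sw_cong)
    fix h1 h2 assume [simp]: "h1 \<in> carr H" "h2 \<in> carr H"
    show "inc r \<cdot>\<^bsub>B\<^esub> tens R H (act R h1 s) (h2 \<cdot>\<^bsub>H\<^esub> k) = rmul (\<mu> (tens R R r (act R h1 s))) (h2 \<cdot>\<^bsub>H\<^esub> k)"
      using B_rmul[of "h2 \<cdot>\<^bsub>H\<^esub> k" "inc r" "inc (act R h1 s)"] by (simp add: mu_tens)
  qed simp_all
  finally show ?thesis .
qed

lemma cop_mu:
  assumes z: "z \<in> carr RR"
  shows "\<Delta>\<^bsub>B\<^esub> (\<mu> z) = sw RR RR (\<Delta>\<^sub>2 z) (\<lambda>z1 z2. sw H RR (\<rho>\<^sub>2 z2) (\<lambda>g z20. tens (tprod R H) (tprod R H) (rmul (\<mu> z1) g) (\<mu> z20)))"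
proof (rule eq_by_forms)
  fix \<phi> assume \<phi>: "lin (tprod (tprod R H) (tprod R H)) Kspace \<phi>"
  note [simp] = linD[OF \<phi>, unfolded scl_tprod scl_Kspace]
  show "\<phi> (\<Delta>\<^bsub>B\<^esub> (\<mu> z)) = \<phi> (sw RR RR (\<Delta>\<^sub>2 z) (\<lambda>z1 z2. sw H RR (\<rho>\<^sub>2 z2) (\<lambda>g z20. tens (tprod R H) (tprod R H) (rmul (\<mu> z1) g) (\<mu> z20))))"
    apply (rule tprod_ext[OF _ _ vspace_Kspace _ _ _ z])
    apply simp_all
    apply (simp add: mu_tens B.cop_mul[unfolded A_norm carr_A scl_A])
    apply (simp add: tens_B mu_tens[symmetric] comod sw_swap[of H R _ R R] sw_swap[of H H _ H R])
    done
qed (simp_all add: z)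

lemma cou_mu:
  assumes z: "z \<in> carr RR"
  shows "\<epsilon>\<^bsub>B\<^esub> (\<mu> z) = \<epsilon>\<^bsub>ytens H R R\<^esub> z"
  by (rule tprod_ext[OF _ _ vspace_Kspace _ _ _ z]) (simp_all add: mu_tens)

lemma lmul_mu:
  assumes z: "z \<in> carr RR" and [simp]: "h \<in> carr H"
  shows "lmul h (\<mu> z) = sw H H (\<Delta>\<^bsub>H\<^esub> h) (\<lambda>h1 h2. rmul (\<mu> (act (ytens H R R) h1 z)) h2)"
proof (rule eq_by_forms)
  fix \<phi> assume \<phi>: "lin (tprod R H) Kspace \<phi>"
  note [simp] = linD[OF \<phi>, unfolded scl_tprod scl_Kspace]
  show "\<phi> (lmul h (\<mu> z)) = \<phi> (sw H H (\<Delta>\<^bsub>H\<^esub> h) (\<lambda>h1 h2. rmul (\<mu> (act (ytens H R R) h1 z)) h2))"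
    apply (rule tprod_ext[OF _ _ vspace_Kspace _ _ _ z])
    apply simp_all
    apply (simp add: mu_tens lmul_B[symmetric])
    apply (simp add: tens_B mu_tens[symmetric] H.coassoc)
    done
qed (simp_all add: z)

text \<open>\<open>decomp\<close> at \<open>\<mu> z\<close>: \<open>prR\<close> turns the right
  multiplication occurring in \<open>cop_mu\<close> into a counit, and the coaction
  disappears.\<close>

lemma mu_decomp:
  assumes z [simp]: "z \<in> carr RR"
  shows "\<mu> z = sw RR RR (\<Delta>\<^sub>2 z) (\<lambda>z1 z2. tens R H (mB z1) (xB z2))"
proof (rule eq_by_forms)
  fix \<phi> assume \<phi>: "lin (tprod R H) Kspace \<phi>"
  note [simp] = linD[OF \<phi>, unfolded scl_tprod scl_Kspace]
  have "\<phi> (\<mu> z) = \<phi> (sw (tprod R H) (tprod R H) (\<Delta>\<^bsub>B\<^esub> (\<mu> z)) (\<lambda>x1 x2. tens R H (prR x1) (prH x2)))"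
    by (simp only: decomp lin_carr[OF lin_mu] z)
  then show "\<phi> (\<mu> z) = \<phi> (sw RR RR (\<Delta>\<^sub>2 z) (\<lambda>z1 z2. tens R H (mB z1) (xB z2)))"
    by (simp add: cop_mu prR_rmul mB_def[symmetric] xB_def[symmetric]) (simp add: SQ_counit_coact)
qed simp_all

text \<open>\<open>lmul_mu\<close> solved for the action by means of the antipode. Its component in
  \<open>R\<close> is H-linearity of \<open>mB\<close>, its component in \<open>H\<close> is axiom
  (b).\<close>

lemma act_mu:
  assumes [simp]: "z \<in> carr RR" "h \<in> carr H"
  shows "\<mu> (act (ytens H R R) h z) = sw H H (\<Delta>\<^bsub>H\<^esub> h) (\<lambda>h1 h2. rmul (lmul h1 (\<mu> z)) (\<S>\<^bsub>H\<^esub> h2))"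
proof (rule eq_by_forms)
  fix \<phi> assume \<phi>: "lin (tprod R H) Kspace \<phi>"
  note [simp] = linD[OF \<phi>, unfolded scl_tprod scl_Kspace]
  have [simp]: "sw H H (\<Delta>\<^bsub>H\<^esub> k) (\<lambda>p q. \<phi> (rmul x (p \<cdot>\<^bsub>H\<^esub> \<S>\<^bsub>H\<^esub> q))) = \<epsilon>\<^bsub>H\<^esub> k * \<phi> x"
    if "x \<in> carr (tprod R H)" "k \<in> carr H" for x k
    using antip(2)[of k "\<lambda>u. \<phi> (rmul x u)"] that by simp
  show "\<phi> (\<mu> (act (ytens H R R) h z)) = \<phi> (sw H H (\<Delta>\<^bsub>H\<^esub> h) (\<lambda>h1 h2. rmul (lmul h1 (\<mu> z)) (\<S>\<^bsub>H\<^esub> h2)))"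
    by (simp add: lmul_mu H.coassoc H.counit)
qed simp_all

lemma act_mB:
  assumes [simp]: "z \<in> carr RR" "h \<in> carr H"
  shows "mB (act (ytens H R R) h z) = act R h (mB z)"
proof (rule eq_by_forms)
  fix \<phi> assume \<phi>: "lin R Kspace \<phi>"
  note [simp] = linD[OF \<phi>, unfolded scl_tprod scl_Kspace]
  have [simp]: "\<epsilon>\<^bsub>H\<^esub> (\<S>\<^bsub>H\<^esub> k) = \<epsilon>\<^bsub>H\<^esub> k" if [simp]: "k \<in> carr H" for k
  proof -
    have "\<epsilon>\<^bsub>H\<^esub> k = \<epsilon>\<^bsub>H\<^esub> (sw H H (\<Delta>\<^bsub>H\<^esub> k) (\<lambda>p q. \<S>\<^bsub>H\<^esub> p \<cdot>\<^bsub>H\<^esub> q))" by (simp add: antip')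
    then show ?thesis by (simp add: H.counit)
  qed
  show "\<phi> (mB (act (ytens H R R) h z)) = \<phi> (act R h (mB z))"
    by (simp add: mB_def act_mu prR_rmul prR_lmul H.counit)
qed simp_all

lemma act_xB:
  assumes [simp]: "z \<in> carr RR" "h \<in> carr H"
  shows "xB (act (ytens H R R) h z) = sw H H (\<Delta>\<^bsub>H\<^esub> h) (\<lambda>h1 h2. h1 \<cdot>\<^bsub>H\<^esub> xB z \<cdot>\<^bsub>H\<^esub> \<S>\<^bsub>H\<^esub> h2)"
  by (simp add: xB_def act_mu prH_rmul prH_lmul)

lemma cop_mB:
  assumes [simp]: "z \<in> carr RR"
  shows "\<Delta>\<^bsub>R\<^esub> (mB z) = sw RR RR (\<Delta>\<^sub>2 z) (\<lambda>a b. tens R R (mB a) (mB b))"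
proof (rule eq_by_forms)
  fix \<phi> assume \<phi>: "lin (tprod R R) Kspace \<phi>"
  note [simp] = linD[OF \<phi>, unfolded scl_tprod scl_Kspace]
  show "\<phi> (\<Delta>\<^bsub>R\<^esub> (mB z)) = \<phi> (sw RR RR (\<Delta>\<^sub>2 z) (\<lambda>a b. tens R R (mB a) (mB b)))"
    by (simp add: mB_def cop_prR cop_mu prR_rmul) (simp add: SQ_counit_coact)
qed simp_all

lemma cop_xB:
  assumes [simp]: "z \<in> carr RR"
  shows "\<Delta>\<^bsub>H\<^esub> (xB z) = sw RR RR (\<Delta>\<^sub>2 z) (\<lambda>z1 z2.
         sw H RR (\<rho>\<^sub>2 z2) (\<lambda>g z20. tens H H (xB z1 \<cdot>\<^bsub>H\<^esub> g) (xB z20)))"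
proof (rule eq_by_forms)
  fix \<phi> assume \<phi>: "lin (tprod H H) Kspace \<phi>"
  note [simp] = linD[OF \<phi>, unfolded scl_tprod scl_Kspace]
  show "\<phi> (\<Delta>\<^bsub>H\<^esub> (xB z)) = \<phi> (sw RR RR (\<Delta>\<^sub>2 z) (\<lambda>z1 z2.
         sw H RR (\<rho>\<^sub>2 z2) (\<lambda>g z20. tens H H (xB z1 \<cdot>\<^bsub>H\<^esub> g) (xB z20))))"
    by (simp add: xB_def cop_prH cop_mu prH_rmul)
qed simp_all

lemma cou_pr:
  assumes x: "x \<in> carr (tprod R H)"
  shows "\<epsilon>\<^bsub>R\<^esub> (prR x) = \<epsilon>\<^bsub>B\<^esub> x" "\<epsilon>\<^bsub>H\<^esub> (prH x) = \<epsilon>\<^bsub>B\<^esub> x"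
  by (rule ext_A[OF _ _ _ x]; simp)+

text \<open>The comultiplication of \<open>\<mu> z\<close>, projected to \<open>H\<close> on the
  left and to \<open>R\<close> on the right, is computed twice: by \<open>cop_mu\<close>, and by
  \<open>prH_prR\<close> after decomposing \<open>\<mu> z\<close>.\<close>

lemma ax_cB:
  assumes [simp]: "z \<in> carr RR"
  shows "sw RR RR (\<Delta>\<^sub>2 z) (\<lambda>z1 z2. sw H R (\<rho>\<^bsub>R\<^esub> (mB z1)) (\<lambda>g r0. tens H R (g \<cdot>\<^bsub>H\<^esub> xB z2) r0))
          = sw RR RR (\<Delta>\<^sub>2 z) (\<lambda>z1 z2. sw H RR (\<rho>\<^sub>2 z2) (\<lambda>g z20. tens H R (xB z1 \<cdot>\<^bsub>H\<^esub> g) (mB z20)))"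
proof (rule eq_by_forms)
  fix \<phi> assume \<phi>: "lin (tprod H R) Kspace \<phi>"
  note [simp] = linD[OF \<phi>, unfolded scl_tprod scl_Kspace]
  have "sw (tprod R H) (tprod R H) (\<Delta>\<^bsub>B\<^esub> (\<mu> z)) (\<lambda>x1 x2. \<phi> (tens H R (prH x1) (prR x2))) =
    sw R H (\<mu> z) (\<lambda>r h. sw H R (\<rho>\<^bsub>R\<^esub> r) (\<lambda>g r'. \<phi> (tens H R (g \<cdot>\<^bsub>H\<^esub> h) r')))"
    by (rule prH_prR) simp_all
  moreover have "sw R H (\<mu> z) (\<lambda>r h. sw H R (\<rho>\<^bsub>R\<^esub> r) (\<lambda>g r'. \<phi> (tens H R (g \<cdot>\<^bsub>H\<^esub> h) r'))) =
     sw RR RR (\<Delta>\<^sub>2 z) (\<lambda>z1 z2. sw H R (\<rho>\<^bsub>R\<^esub> (mB z1)) (\<lambda>g r0. \<phi> (tens H R (g \<cdot>\<^bsub>H\<^esub> xB z2) r0)))"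
    by (subst mu_decomp) simp_all
  ultimately show "\<phi> (sw RR RR (\<Delta>\<^sub>2 z) (\<lambda>z1 z2. sw H R (\<rho>\<^bsub>R\<^esub> (mB z1)) (\<lambda>g r0. tens H R (g \<cdot>\<^bsub>H\<^esub> xB z2) r0)))
          = \<phi> (sw RR RR (\<Delta>\<^sub>2 z) (\<lambda>z1 z2. sw H RR (\<rho>\<^sub>2 z2) (\<lambda>g z20. tens H R (xB z1 \<cdot>\<^bsub>H\<^esub> g) (mB z20))))"
    by (simp add: cop_mu prH_rmul mB_def[symmetric] xB_def[symmetric])
qed simp_all

lemma inc_mul_tens:
  assumes [simp]: "r \<in> carr R" "a \<in> carr R" "h \<in> carr H"
  shows "inc r \<cdot>\<^bsub>B\<^esub> tens R H a h = rmul (\<mu> (tens R R r a)) h"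
  using B_rmul[of h "inc r" "inc a"] by (simp add: mu_tens)

lemma tens_mul_inc:
  assumes [simp]: "t \<in> carr R" "a \<in> carr R" "h \<in> carr H"
  shows "tens R H a h \<cdot>\<^bsub>B\<^esub> inc t = sw H H (\<Delta>\<^bsub>H\<^esub> h) (\<lambda>h1 h2. rmul (\<mu> (tens R R a (act R h1 t))) h2)"
  by (simp add: tens_B)

text \<open>Associativity for \<open>r # 1\<close>, \<open>s # 1\<close>, \<open>t # 1\<close> with
  the inner product decomposed on each side. Applying \<open>prR\<close> gives (d), applying
  \<open>prH\<close> gives (e).\<close>

lemma assoc_pr:
  assumes [simp]: "r \<in> carr R" "s \<in> carr R" "t \<in> carr R"
  shows "sw RR RR (\<Delta>\<^sub>2 (tens R R s t)) (\<lambda>w1 w2. rmul (\<mu> (tens R R r (mB w1))) (xB w2))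
    = sw RR RR (\<Delta>\<^sub>2 (tens R R r s)) (\<lambda>z1 z2. sw H H (\<Delta>\<^bsub>H\<^esub> (xB z2)) (\<lambda>x1 x2. rmul (\<mu> (tens R R (mB z1) (act R x1 t))) x2))"
    (is "?L = ?R")
proof -
  have "?L = inc r \<cdot>\<^bsub>B\<^esub> \<mu> (tens R R s t)"
    by (subst mu_decomp) (simp_all add: inc_mul_tens del: SQ.cop_ytens_tens)
  also have "\<dots> = \<mu> (tens R R r s) \<cdot>\<^bsub>B\<^esub> inc t" by (simp add: mu_tens)
  also have "\<dots> = ?R"
    by (subst mu_decomp) (simp_all add: tens_mul_inc del: SQ.cop_ytens_tens)
  finally show ?thesis .
qed

sublocale BP: pbc H R mB xB u
proof unfold_locales
  fix r s t assume [simp]: "r \<in> carr R" "s \<in> carr R" "t \<in> carr R"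
  have [simp]: "tens R R s t \<in> carr RR" "tens R R r s \<in> carr RR" by simp_all
  show "mB (tens R R r (mB (tens R R s t)))
          = sw RR RR (\<Delta>\<^sub>2 (tens R R r s)) (\<lambda>z1 z2. mB (tens R R (mB z1) (act R (xB z2) t)))"
  proof (rule eq_by_forms)
    fix \<phi> assume \<phi>: "lin R Kspace \<phi>"
    note [simp] = linD[OF \<phi>, unfolded scl_tprod scl_Kspace]
    show "\<phi> (mB (tens R R r (mB (tens R R s t))))
          = \<phi> (sw RR RR (\<Delta>\<^sub>2 (tens R R r s)) (\<lambda>z1 z2. mB (tens R R (mB z1) (act R (xB z2) t))))"
      using arg_cong[OF assoc_pr[of r s t], of "\<lambda>x. \<phi> (prR x)"]
      apply (simp add: prR_rmul xB_def[symmetric] mB_def[symmetric] del: SQ.cop_ytens_tens)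
      \<comment> \<open>Under \<open>prR\<close> the factors from H on the right have become
        counits: on the left this collapses the comultiplication of \<open>s \<otimes> t\<close>, on
        the right that of \<open>xB z2\<close>.\<close>
      apply (simp add: cou_pr cou_mu xB_def SQ_counit H.counit del: SQ.cop_ytens_tens)
      done
  qed simp_all
  show "sw RR RR (\<Delta>\<^sub>2 (tens R R s t)) (\<lambda>w1 w2. xB (tens R R r (mB w1)) \<cdot>\<^bsub>H\<^esub> xB w2)
          = sw RR RR (\<Delta>\<^sub>2 (tens R R r s)) (\<lambda>z1 z2. sw H H (\<Delta>\<^bsub>H\<^esub> (xB z2)) (\<lambda>x1 x2.
              xB (tens R R (mB z1) (act R x1 t)) \<cdot>\<^bsub>H\<^esub> x2))"
    using arg_cong[OF assoc_pr[of r s t], of "prH"]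
    by (simp add: prH_rmul xB_def[symmetric] del: SQ.cop_ytens_tens)
next
  have 1: "\<mu> (tens R R r u) = inc r" "\<mu> (tens R R u r) = inc r" if "r \<in> carr R" for r
    using that by (simp_all add: mu_tens sigma_mul mul_sigma del: lmul_tens)
  fix r assume "r \<in> carr R"
  then show "mB (tens R R r u) = r" "mB (tens R R u r) = r"  "xB (tens R R r u) = scl H (\<epsilon>\<^bsub>R\<^esub> r) \<one>\<^bsub>H\<^esub>"
     "xB (tens R R u r) = scl H (\<epsilon>\<^bsub>R\<^esub> r) \<one>\<^bsub>H\<^esub>"
    by (simp_all add: mB_def xB_def 1)
qed (simp_all add: lin_mB lin_xB cop_mB cop_xB act_mB act_xB ax_cB, simp_all add: mB_def xB_def cou_pr cou_mu)

lemma mul_eq: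
  assumes x: "x \<in> carr (tprod R H)" and y [simp]: "y \<in> carr (tprod R H)"
  shows "x \<cdot>\<^bsub>B\<^esub> y = sw R H x (\<lambda>r h. sw R H y (\<lambda>s h'.
        sw H H (\<Delta>\<^bsub>H\<^esub> h) (\<lambda>h1 h2. sw R R (\<Delta>\<^bsub>R\<^esub> r) (\<lambda>r1 r2. sw H R (\<rho>\<^bsub>R\<^esub> r2) (\<lambda>g r20.
          sw R R (\<Delta>\<^bsub>R\<^esub> (act R h1 s)) (\<lambda>s1 s2.
            tens R H (mB (tens R R r1 (act R g s1)))
                     (xB (tens R R r20 s2) \<cdot>\<^bsub>H\<^esub> h2 \<cdot>\<^bsub>H\<^esub> h')))))))"
    (is "_ = ?R x y")
proof (rule eq_by_forms)
  fix \<phi> assume \<phi>: "lin (tprod R H) Kspace \<phi>"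
  note [simp] = linD[OF \<phi>, unfolded scl_tprod scl_Kspace]
  have d: "\<phi> (rmul (\<mu> z) k) = sw RR RR (\<Delta>\<^sub>2 z) (\<lambda>z1 z2. \<phi> (tens R H (mB z1) (xB z2 \<cdot>\<^bsub>H\<^esub> k)))" if "z \<in> carr RR" "k \<in> carr H" for z k
    using that by (subst mu_decomp) simp_all
  show "\<phi> (x \<cdot>\<^bsub>B\<^esub> y) = \<phi> (?R x y)"
  proof (rule ext_A[OF _ _ _ x])
    fix r h assume [simp]: "r \<in> carr R" "h \<in> carr H"
    show "\<phi> (tens R H r h \<cdot>\<^bsub>B\<^esub> y) = \<phi> (?R (tens R H r h) y)"
      apply (rule ext_A[OF _ _ _ y])
      apply (simp_all add: tens_B d)
      apply (simp add: sw_swap[of H R _ H H] sw_swap[of H R _ R R])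
      done
  qed simp_all
qed (simp_all add: x)

end

subsection \<open>Twisting a smash product\<close>

text \<open>The twist enters through its fields, with the inverse \<open>\<gamma>'\<close> as a
  parameter. \<open>bal\<close> is H-bilinearity of \<gamma>, with the products by
  \<open>1 # h\<close> written as \<open>lmul\<close> and \<open>rmul\<close>.\<close>

locale pbc_twist = pbc_smash H R m \<xi> u A + T: twist A \<gamma> \<gamma>'
  for H :: "('k::field, 'h::ab_group_add, 'z) hopf_scheme"
    and R :: "('k, 'h, 'r::ab_group_add, 'y) ydcoalg_scheme" and m \<xi> u
    and A :: "('k, ('k, 'r, 'h) tensor, 'x) bialg_scheme" and \<gamma> \<gamma>' +
  fixes At :: "('k, ('k, 'r, 'h) tensor, 'w) bialg_scheme"
  assumes At [simp]: "carr At = carr (tprod R H)" "scl At = tscale" "\<Delta>\<^bsub>At\<^esub> = \<Delta>\<^bsub>A\<^esub>" "\<epsilon>\<^bsub>At\<^esub> = \<epsilon>\<^bsub>A\<^esub>" "\<one>\<^bsub>At\<^esub> = \<one>\<^bsub>A\<^esub>"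
    and mul_At: "x \<in> carr (tprod R H) \<Longrightarrow> y \<in> carr (tprod R H) \<Longrightarrow> x \<cdot>\<^bsub>At\<^esub> y = sw A A (\<Delta>\<^bsub>A\<^esub> x) (\<lambda>x1 x'. sw A A (\<Delta>\<^bsub>A\<^esub> x') (\<lambda>x2 x3.
     sw A A (\<Delta>\<^bsub>A\<^esub> y) (\<lambda>y1 y'. sw A A (\<Delta>\<^bsub>A\<^esub> y') (\<lambda>y2 y3.
       scl A (\<gamma> (tens A A x1 y1) * \<gamma>' (tens A A x3 y3)) (x2 \<cdot>\<^bsub>A\<^esub> y2)))))"
    and bal: "h \<in> carr H \<Longrightarrow> h' \<in> carr H \<Longrightarrow> a \<in> carr (tprod R H) \<Longrightarrow> a' \<in> carr (tprod R H) \<Longrightarrow>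
     \<gamma> (tens (tprod R H) (tprod R H) (lmul h a) (rmul a' h')) = \<epsilon>\<^bsub>H\<^esub> h * \<gamma> (tens (tprod R H) (tprod R H) a a') * \<epsilon>\<^bsub>H\<^esub> h'"
begin

abbreviation AH where "AH \<equiv> tprod R H"
abbreviation E where "E \<equiv> tprod AH AH"

lemmas T_norm [simp] = linD[OF T.lin_g, unfolded A_norm carr_A scl_A scl_tprod scl_Kspace]
  linD[OF T.lin_g', unfolded A_norm carr_A scl_A scl_tprod scl_Kspace]
  bilinD[OF T.bilin_tmul, unfolded A_norm carr_A scl_A scl_tprod scl_Kspace]
  linD[OF T.E.cop_ctens_lin, unfolded A_norm carr_A scl_A scl_tprod scl_Kspace]
  linD[OF T.E.cou_ctens_lin, unfolded A_norm carr_A scl_A scl_tprod scl_Kspace]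
lemmas DE_tens [simp] = T.E.cop_ctens_tens[unfolded A_norm carr_A] T.E.cou_ctens_tens[unfolded A_norm carr_A]

section \<open>Invariance of the cocycle and of its inverse under H\<close>

lemma g_l: "h \<in> carr H \<Longrightarrow> a \<in> carr AH \<Longrightarrow> b \<in> carr AH \<Longrightarrow> \<gamma> (tens AH AH (lmul h a) b) = \<epsilon>\<^bsub>H\<^esub> h * \<gamma> (tens AH AH a b)"
  using bal[of h "\<one>\<^bsub>H\<^esub>" a b] by simp
lemma g_r: "h \<in> carr H \<Longrightarrow> a \<in> carr AH \<Longrightarrow> b \<in> carr AH \<Longrightarrow> \<gamma> (tens AH AH a (rmul b h)) = \<epsilon>\<^bsub>H\<^esub> h * \<gamma> (tens AH AH a b)"
  using bal[of "\<one>\<^bsub>H\<^esub>" h a b] by simp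

lemma sigma_lmul: "h \<in> carr H \<Longrightarrow> tens R H u h = lmul h (inc u)"
  using sigma_mul[of h "inc u"] mul_unt[of "tens R H u h"] by simp

lemma g_u:
  assumes "h \<in> carr H" "x \<in> carr AH"
  shows "\<gamma> (tens AH AH (tens R H u h) x) = \<epsilon>\<^bsub>H\<^esub> h * \<epsilon>\<^bsub>A\<^esub> x"
    "\<gamma> (tens AH AH x (tens R H u h)) = \<epsilon>\<^bsub>H\<^esub> h * \<epsilon>\<^bsub>A\<^esub> x"
proof -
  show "\<gamma> (tens AH AH (tens R H u h) x) = \<epsilon>\<^bsub>H\<^esub> h * \<epsilon>\<^bsub>A\<^esub> x"
    unfolding sigma_lmul[OF assms(1)] using assms g_l[of h "inc u" x] T.g_unt(2)[of x] by (simp add: unt_A del: lmul_tens)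
  show "\<gamma> (tens AH AH x (tens R H u h)) = \<epsilon>\<^bsub>H\<^esub> h * \<epsilon>\<^bsub>A\<^esub> x"
    using assms g_r[of h x "inc u"] T.g_unt(1)[of x] by (simp add: unt_A)
qed

text \<open>The cocycle identity with \<open>1 # h\<close> in the middle: by \<open>g_u\<close> one
  factor on each side reduces to counits, and what is left is the balancing of \<gamma> over
  H.\<close>

lemma g_m:
  assumes [simp]: "h \<in> carr H" "a \<in> carr AH" "b \<in> carr AH"
  shows "\<gamma> (tens AH AH (rmul a h) b) = \<gamma> (tens AH AH a (lmul h b))"
  using T.cocycle[of a "tens R H u h" b, unfolded A_norm carr_A]
  by (simp add: sigma_mul mul_sigma g_u)
    (simp add: sw_mult(1)[symmetric] mult.assoc A.counit[unfolded A_norm carr_A] H.counit)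

text \<open>Each invariance of \<gamma> says that \<gamma> takes equal values along two of these
  actions of H on \<open>A \<otimes> A\<close>; the trivial one, \<open>acte\<close>, accounts for a
  factor \<open>\<epsilon> h\<close>. As all five are compatible with \<Delta> and \<epsilon>,
  \<open>T.g'_transfer\<close> carries the invariance over to \<open>\<gamma>'\<close>.\<close>

definition actl where "actl h w = sw AH AH w (\<lambda>a b. tens AH AH (lmul h a) b)"
definition actr where "actr h w = sw AH AH w (\<lambda>a b. tens AH AH a (rmul b h))"
definition actm where "actm h w = sw AH AH w (\<lambda>a b. tens AH AH (rmul a h) b)"
definition actn where "actn h w = sw AH AH w (\<lambda>a b. tens AH AH a (lmul h b))"
definition acte where "acte h w = tscale (\<epsilon>\<^bsub>H\<^esub> h) w"

lemma act_bilin: "bilin H E E actl" "bilin H E E actr" "bilin H E E actm" "bilin H E E actn" "bilin H E E acte"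
  by (simp_all add: actl_def actr_def actm_def actn_def acte_def)

lemma act_tens:
  assumes [simp]: "h \<in> carr H" "a \<in> carr AH" "b \<in> carr AH"
  shows "actl h (tens AH AH a b) = tens AH AH (lmul h a) b" "actr h (tens AH AH a b) = tens AH AH a (rmul b h)"
   "actm h (tens AH AH a b) = tens AH AH (rmul a h) b" "actn h (tens AH AH a b) = tens AH AH a (lmul h b)"
   "acte h (tens AH AH a b) = tscale (\<epsilon>\<^bsub>H\<^esub> h) (tens AH AH a b)"
  by (simp_all add: actl_def actr_def actm_def actn_def acte_def sw_tens[where U = "tprod AH AH"])

lemma act_ok:
  assumes h [simp]: "h \<in> carr H" and w [simp]: "w \<in> carr E" and a: "a \<in> {actl, actr, actm, actn, acte}"
  shows "\<Delta>\<^bsub>ctens A A\<^esub> (a h w) = sw H H (\<Delta>\<^bsub>H\<^esub> h) (\<lambda>h1 h2. sw E E (\<Delta>\<^bsub>ctens A A\<^esub> w) (\<lambda>w1 w2. tens E E (a h1 w1) (a h2 w2)))"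
     (is ?A) and "\<epsilon>\<^bsub>ctens A A\<^esub> (a h w) = \<epsilon>\<^bsub>H\<^esub> h * \<epsilon>\<^bsub>ctens A A\<^esub> w" (is ?B)
proof -
  note act_rules [simp] = act_bilin[THEN bilinD(1)] act_bilin[THEN bilinD(2)] act_bilin[THEN bilinD(3)]
     act_bilin[THEN bilinD(4)] act_bilin[THEN bilinD(5)] act_bilin[THEN bilinD(6), unfolded scl_tprod] act_bilin[THEN bilinD(7), unfolded scl_tprod]
  have al: "bilin H E E a" using a act_bilin by blast
  note [simp] = bilinD[OF al, unfolded scl_tprod]
  show ?A
  proof (rule eq_by_forms)
    fix \<phi> assume \<phi>: "lin (tprod E E) Kspace \<phi>"
    note [simp] = linD[OF \<phi>, unfolded scl_tprod scl_Kspace]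
    let ?P = "\<lambda>a. \<phi> (\<Delta>\<^bsub>ctens A A\<^esub> (a h w)) = \<phi> (sw H H (\<Delta>\<^bsub>H\<^esub> h) (\<lambda>h1 h2. sw E E (\<Delta>\<^bsub>ctens A A\<^esub> w) (\<lambda>w1 w2. tens E E (a h1 w1) (a h2 w2))))"
    have "?P actl"
      by (rule tprod_ext[OF _ _ vspace_Kspace _ _ _ w], simp_all) (simp add: act_tens)
    moreover have "?P actr"
      by (rule tprod_ext[OF _ _ vspace_Kspace _ _ _ w], simp_all) (simp add: act_tens sw_swap[of H H _ AH AH])
    moreover have "?P actm"
      by (rule tprod_ext[OF _ _ vspace_Kspace _ _ _ w], simp_all) (simp add: act_tens sw_swap[of H H _ AH AH])
    moreover have "?P actn"
      by (rule tprod_ext[OF _ _ vspace_Kspace _ _ _ w], simp_all) (simp add: act_tens sw_swap[of H H _ AH AH])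
    moreover have "?P acte"
      by (rule tprod_ext[OF _ _ vspace_Kspace _ _ _ w], simp_all) (simp add: act_tens sw_swap[of H H _ AH AH] sw_mult(1)[symmetric] mult.assoc H.counit)
    ultimately show "?P a" using a by blast
  qed simp_all
  show ?B
    by (rule tprod_ext[OF _ _ vspace_Kspace _ _ _ w]; use a in \<open>auto simp add: act_tens cou_lmul cou_rmul\<close>)
qed

lemma g'_m:
  assumes [simp]: "h \<in> carr H" "a \<in> carr AH" "b \<in> carr AH"
  shows "\<gamma>' (tens AH AH (lmul h a) b) = \<epsilon>\<^bsub>H\<^esub> h * \<gamma>' (tens AH AH a b)"
    "\<gamma>' (tens AH AH a (rmul b h)) = \<epsilon>\<^bsub>H\<^esub> h * \<gamma>' (tens AH AH a b)"
    "\<gamma>' (tens AH AH (rmul a h) b) = \<gamma>' (tens AH AH a (lmul h b))"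
proof -
  have t: "\<gamma>' (f h w) = \<gamma>' (g h w)" if fg: "f \<in> {actl, actr, actm, actn, acte}" "g \<in> {actl, actr, actm, actn, acte}"
    and e: "\<And>h a b. h \<in> carr H \<Longrightarrow> a \<in> carr AH \<Longrightarrow> b \<in> carr AH \<Longrightarrow> \<gamma> (f h (tens AH AH a b)) = \<gamma> (g h (tens AH AH a b))"
    and w: "w \<in> carr E" for f g w
  proof (rule T.g'_transfer[where H = H and a = f and b = g, unfolded A_norm carr_A])
    have b: "bilin H E E f" "bilin H E E g" using fg act_bilin by blast+
    then show "bilin H E E f" "bilin H E E g" by simp_all
    note [simp] = bilinD[OF b(1), unfolded scl_tprod] bilinD[OF b(2), unfolded scl_tprod]
    show "\<gamma> (f h w) = \<gamma> (g h w)" if [simp]: "h \<in> carr H" and w: "w \<in> carr E" for h w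
      by (rule tprod_ext[OF _ _ vspace_Kspace _ _ _ w]) (simp_all add: e)
  qed (use act_ok fg w in \<open>simp_all add: H.coalg_axioms\<close>)
  show "\<gamma>' (tens AH AH (lmul h a) b) = \<epsilon>\<^bsub>H\<^esub> h * \<gamma>' (tens AH AH a b)"
    "\<gamma>' (tens AH AH a (rmul b h)) = \<epsilon>\<^bsub>H\<^esub> h * \<gamma>' (tens AH AH a b)"
    "\<gamma>' (tens AH AH (rmul a h) b) = \<gamma>' (tens AH AH a (lmul h b))"
    using t[of actl acte "tens AH AH a b"] t[of actr acte "tens AH AH a b"] t[of actm actn "tens AH AH a b"]
    by (simp_all add: act_tens g_l g_r g_m)
qed

lemma g'_u:
  assumes "h \<in> carr H" "x \<in> carr AH"
  shows "\<gamma>' (tens AH AH (tens R H u h) x) = \<epsilon>\<^bsub>H\<^esub> h * \<epsilon>\<^bsub>A\<^esub> x"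
    "\<gamma>' (tens AH AH x (tens R H u h)) = \<epsilon>\<^bsub>H\<^esub> h * \<epsilon>\<^bsub>A\<^esub> x"
proof -
  show "\<gamma>' (tens AH AH (tens R H u h) x) = \<epsilon>\<^bsub>H\<^esub> h * \<epsilon>\<^bsub>A\<^esub> x"
    unfolding sigma_lmul[OF assms(1)] using assms g'_m(1)[of h "inc u" x] T.g'_unt(2)[of x] by (simp add: unt_A del: lmul_tens)
  show "\<gamma>' (tens AH AH x (tens R H u h)) = \<epsilon>\<^bsub>H\<^esub> h * \<epsilon>\<^bsub>A\<^esub> x"
    using assms g'_m(2)[of h x "inc u"] T.g'_unt(1)[of x] by (simp add: unt_A)
qed

lemma tmul_sigma:
  assumes [simp]: "h \<in> carr H" "x \<in> carr AH"
  shows "T.tmul (tens R H u h) x = lmul h x" "T.tmul x (tens R H u h) = rmul x h"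
proof -
  have 1: "\<phi> (T.tmul (tens R H u h) x) = \<phi> (lmul h x)" "\<phi> (T.tmul x (tens R H u h)) = \<phi> (rmul x h)" if \<phi>: "lin AH Kspace \<phi>" for \<phi>
  proof -
    note [simp] = linD[OF \<phi>, unfolded scl_tprod scl_Kspace]
    show "\<phi> (T.tmul (tens R H u h) x) = \<phi> (lmul h x)"
      using T.tmul_eq[of "tens R H u h" x, unfolded A_norm carr_A scl_A]
      apply (simp add: g_u g'_u sigma_mul)
      apply (simp add: sw_mult(1)[symmetric] mult.assoc A.counit[unfolded A_norm carr_A] H.counit)
      done
    show "\<phi> (T.tmul x (tens R H u h)) = \<phi> (rmul x h)"
      using T.tmul_eq[of x "tens R H u h", unfolded A_norm carr_A scl_A]
      apply (simp add: g_u g'_u mul_sigma)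
      apply (simp add: sw_mult(1)[symmetric] mult.assoc A.counit[unfolded A_norm carr_A] H.counit)
      done
  qed
  show "T.tmul (tens R H u h) x = lmul h x" by (rule eq_by_forms[OF vspace_tprod[of R H]]) (use 1 in simp_all)
  show "T.tmul x (tens R H u h) = rmul x h" by (rule eq_by_forms[OF vspace_tprod[of R H]]) (use 1 in simp_all)
qed

section \<open>The restricted cocycle and the twisted product\<close>

definition gR where "gR z = sw R R z (\<lambda>r s. \<gamma> (tens AH AH (inc r) (inc s)))"
definition gR' where "gR' z = sw R R z (\<lambda>r s. \<gamma>' (tens AH AH (inc r) (inc s)))"
lemma lin_gR: "lin RR Kspace gR" "lin RR Kspace gR'" by (simp_all add: gR_def[abs_def] gR'_def[abs_def])
lemmas [simp] = linD[OF lin_gR(1), unfolded scl_tprod scl_Kspace] linD[OF lin_gR(2), unfolded scl_tprod scl_Kspace]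
lemma gR_tens: "r \<in> carr R \<Longrightarrow> s \<in> carr R \<Longrightarrow> gR (tens R R r s) = \<gamma> (tens AH AH (inc r) (inc s))"
  "r \<in> carr R \<Longrightarrow> s \<in> carr R \<Longrightarrow> gR' (tens R R r s) = \<gamma>' (tens AH AH (inc r) (inc s))"
  by (simp_all add: gR_def gR'_def)

text \<open>Balancing moves \<open>h\<close> onto \<open>s # k\<close>, where it becomes an action
  on \<open>s\<close> and a factor in H; the latter and \<open>k\<close> leave on the right as
  counits. Both forms are thus determined by their restrictions to
  \<open>R \<otimes> R\<close>.\<close>

lemma g_tens:
  assumes [simp]: "r \<in> carr R" "s \<in> carr R" "h \<in> carr H" "k \<in> carr H"
  shows "\<gamma> (tens AH AH (tens R H r h) (tens R H s k)) = \<epsilon>\<^bsub>H\<^esub> k * gR (tens R R r (act R h s))"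
    "\<gamma>' (tens AH AH (tens R H r h) (tens R H s k)) = \<epsilon>\<^bsub>H\<^esub> k * gR' (tens R R r (act R h s))"
proof -
  have e: "tens R H x h = rmul (inc x) h" if "x \<in> carr R" "h \<in> carr H" for x h using that by simp
  have l: "lmul h (inc s) = sw H H (\<Delta>\<^bsub>H\<^esub> h) (\<lambda>h1 h2. rmul (inc (act R h1 s)) h2)" by simp
  show "\<gamma> (tens AH AH (tens R H r h) (tens R H s k)) = \<epsilon>\<^bsub>H\<^esub> k * gR (tens R R r (act R h s))"
    unfolding e[of r h, OF assms(1,3)] e[of s k, OF assms(2,4)]
    by (simp add: g_r g_m l gR_tens H.counit del: rmul_tens lmul_tens)
  show "\<gamma>' (tens AH AH (tens R H r h) (tens R H s k)) = \<epsilon>\<^bsub>H\<^esub> k * gR' (tens R R r (act R h s))"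
    unfolding e[of r h, OF assms(1,3)] e[of s k, OF assms(2,4)]
    by (simp add: g'_m(2,3) l gR_tens H.counit del: rmul_tens lmul_tens)
qed

text \<open>The comultiplication of \<open>r # 1\<close> puts a coaction component of
  \<open>r\<close> into H, and \<open>g_tens\<close> makes it act on the component of
  \<open>s\<close>. This is the braiding in \<open>\<Delta>\<^sub>2\<close>, so inverses for the
  flip on \<open>A \<otimes> A\<close> restrict to inverses for the braided comultiplication on
  \<open>R \<otimes> R\<close>.\<close>

lemma gR_inv:
  assumes z: "z \<in> carr RR"
  shows "sw RR RR (\<Delta>\<^sub>2 z) (\<lambda>a b. gR a * gR' b) = \<epsilon>\<^bsub>ytens H R R\<^esub> z" "sw RR RR (\<Delta>\<^sub>2 z) (\<lambda>a b. gR' a * gR b) = \<epsilon>\<^bsub>ytens H R R\<^esub> z"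
proof -
  note i = T.inv1[unfolded A_norm carr_A] T.inv2[unfolded A_norm carr_A]
  show "sw RR RR (\<Delta>\<^sub>2 z) (\<lambda>a b. gR a * gR' b) = \<epsilon>\<^bsub>ytens H R R\<^esub> z"
    apply (rule tprod_ext[OF _ _ vspace_Kspace _ _ _ z])
    apply simp_all
    subgoal for r s using i(1)[of "tens AH AH (inc r) (inc s)"]
      by (simp add: g_tens mult.assoc) (simp add: sw_mult(1)[symmetric] mult.left_commute counit_coact sw_swap[of H R _ R R])
    done
  show "sw RR RR (\<Delta>\<^sub>2 z) (\<lambda>a b. gR' a * gR b) = \<epsilon>\<^bsub>ytens H R R\<^esub> z"
    apply (rule tprod_ext[OF _ _ vspace_Kspace _ _ _ z])
    apply simp_all
    subgoal for r s using i(2)[of "tens AH AH (inc r) (inc s)"]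
      by (simp add: g_tens mult.assoc) (simp add: sw_mult(1)[symmetric] mult.left_commute counit_coact sw_swap[of H R _ R R])
    done
qed

lemma At_tmul: "x \<in> carr AH \<Longrightarrow> y \<in> carr AH \<Longrightarrow> x \<cdot>\<^bsub>At\<^esub> y = T.tmul x y"
  using T.tmul_eq[of x y] mul_At[of x y] by (simp only: carr_A)

sublocale BT: smash_bialg H R At u
proof unfold_locales
  show "bialgebra At"
    by (rule T.bialgebra_twist) (simp_all add: At_tmul)
qed (simp_all add: At_tmul tmul_sigma cop_A cou_A unt_A del: cop_A_tens)

lemma prR_M:
  assumes [simp]: "z \<in> carr RR" shows "prR (M z) = m z" "prH (M z) = \<xi> z"
proof -
  show "prR (M z) = m z"
  proof (rule eq_by_forms)
    fix \<phi> assume \<phi>: "lin R Kspace \<phi>"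
    note [simp] = linD[OF \<phi>, unfolded scl_tprod scl_Kspace]
    show "\<phi> (prR (M z)) = \<phi> (m z)"
      using \<phi> by (simp add: M_def SQ_counit)
  qed simp_all
  show "prH (M z) = \<xi> z"
  proof (rule eq_by_forms)
    fix \<phi> assume \<phi>: "lin H Kspace \<phi>"
    note [simp] = linD[OF \<phi>, unfolded scl_tprod scl_Kspace]
    show "\<phi> (prH (M z)) = \<phi> (\<xi> z)"
      using \<phi> by (simp add: M_def SQ_counit)
  qed simp_all
qed

text \<open>Comultiplying \<open>r # 1\<close> and \<open>s # 1\<close> twice creates coaction
  components in H. Those of \<open>r\<close> act on the components of \<open>s\<close> and form the
  braided comultiplication of \<open>z\<close>; the part that reaches the product is the coaction of
  the last component, standing on the right.\<close>

lemma mu_twist: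
  assumes z [simp]: "z \<in> carr RR" and \<phi>: "lin AH Kspace \<phi>"
  shows "\<phi> (BT.\<mu> z) = sw RR RR (\<Delta>\<^sub>2 z) (\<lambda>z1 z'. sw RR RR (\<Delta>\<^sub>2 z') (\<lambda>z2 z3. sw H RR (\<rho>\<^sub>2 z3) (\<lambda>g z30. gR z1 * gR' z30 * \<phi> (rmul (M z2) g))))"
proof -
  note [simp] = linD[OF \<phi>, unfolded scl_tprod scl_Kspace]
  show ?thesis
    apply (rule tprod_ext[OF _ _ vspace_Kspace _ _ _ z])
    apply simp_all
    subgoal for r s
      apply (simp add: BT.mu_tens At_tmul T.tmul_eq[of "inc r" "inc s", unfolded A_norm carr_A scl_A] g_tens mul_tens)
      apply (simp add: mult.assoc sw_mult(1)[symmetric] counit_coact)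
      apply (simp add: sw_mult comod sw_swap[of H R _ R R] sw_swap[of H H _ H R] sw_swap[of H H _ R R])
      apply (subst sw_swap[of R R _ R R])
      apply (simp add: sw_swap[of H R _ R R])
      done
    done
qed

text \<open>Under \<open>prR\<close> the coaction factor on the right becomes a counit, so the last
  component is simply fed to \<open>gR'\<close>. Under \<open>prH\<close> the factor stays; this is
  the origin of the coaction in the last term of the twisted cocycle, see
  \<open>xB_twist\<close>.\<close>

lemma mB_twist:
  assumes z [simp]: "z \<in> carr RR"
  shows "BT.mB z = sw RR RR (\<Delta>\<^sub>2 z) (\<lambda>z1 z'. sw RR RR (\<Delta>\<^sub>2 z') (\<lambda>z2 z3. scl R (gR z1 * gR' z3) (m z2)))"
proof (rule eq_by_forms)
  fix \<phi> assume \<phi>: "lin R Kspace \<phi>"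
  note [simp] = linD[OF \<phi>, unfolded scl_tprod scl_Kspace]
  have "\<phi> (prR (BT.\<mu> z)) = \<phi> (sw RR RR (\<Delta>\<^sub>2 z) (\<lambda>z1 z'. sw RR RR (\<Delta>\<^sub>2 z') (\<lambda>z2 z3. scl R (gR z1 * gR' z3) (m z2))))"
    using mu_twist[OF z, of "\<lambda>x. \<phi> (prR x)"]
    by (simp add: prR_rmul prR_M mult.assoc) (simp add: mult.left_commute[of _ "\<epsilon>\<^bsub>H\<^esub> _"] sw_mult(1)[symmetric] SQ_counit_coact)
  then show "\<phi> (BT.mB z) = \<phi> (sw RR RR (\<Delta>\<^sub>2 z) (\<lambda>z1 z'. sw RR RR (\<Delta>\<^sub>2 z') (\<lambda>z2 z3. scl R (gR z1 * gR' z3) (m z2))))"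
    by (simp add: BT.mB_def)
qed simp_all

lemma xB_twist:
  assumes z [simp]: "z \<in> carr RR"
  shows "BT.xB z = sw RR RR (\<Delta>\<^sub>2 z) (\<lambda>z' z3. sw RR RR (\<Delta>\<^sub>2 z') (\<lambda>z1 z2. scl H (gR z1) \<one>\<^bsub>H\<^esub> \<cdot>\<^bsub>H\<^esub> \<xi> z2) \<cdot>\<^bsub>H\<^esub> sw H RR (\<rho>\<^sub>2 z3) (\<lambda>g z30. scl H (gR' z30) g))"
proof (rule eq_by_forms)
  fix \<phi> assume \<phi>: "lin H Kspace \<phi>"
  note [simp] = linD[OF \<phi>, unfolded scl_tprod scl_Kspace]
  have "\<phi> (prH (BT.\<mu> z)) = \<phi> (sw RR RR (\<Delta>\<^sub>2 z) (\<lambda>z' z3. sw RR RR (\<Delta>\<^sub>2 z') (\<lambda>z1 z2. scl H (gR z1) \<one>\<^bsub>H\<^esub> \<cdot>\<^bsub>H\<^esub> \<xi> z2) \<cdot>\<^bsub>H\<^esub> sw H RR (\<rho>\<^sub>2 z3) (\<lambda>g z30. scl H (gR' z30) g)))"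
    using mu_twist[OF z, of "\<lambda>x. \<phi> (prH x)"]
    apply (simp add: prH_rmul prR_M sw_swap[of H RR _ RR RR] SQ_coassoc)
    apply (simp add: sw_mult sw_swap[of H RR _ RR RR] SQ_coassoc mult.left_commute)
    apply (simp add: mult.assoc)
    done
  then show "\<phi> (BT.xB z) = \<phi> (sw RR RR (\<Delta>\<^sub>2 z) (\<lambda>z' z3. sw RR RR (\<Delta>\<^sub>2 z') (\<lambda>z1 z2. scl H (gR z1) \<one>\<^bsub>H\<^esub> \<cdot>\<^bsub>H\<^esub> \<xi> z2) \<cdot>\<^bsub>H\<^esub> sw H RR (\<rho>\<^sub>2 z3) (\<lambda>g z30. scl H (gR' z30) g)))"
    by (simp add: BT.xB_def)
qed simp_all

end

subsection \<open>Transport of structure along an isomorphism\<close>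

text \<open>Mostly a change of language: linearity and colinearity of the comultiplication, phrased
  in \<open>yd_coalgebra\<close> as a morphism to \<open>ytens\<close>, become explicit formulas
  once action and coaction of \<open>ytens\<close> are unfolded.\<close>

lemma pre_bialgebra_cocycle_imp_pbc:
  assumes H: "hopf_algebra H" and P: "pre_bialgebra_cocycle H R \<xi>"
  shows "pbc H R (pmul R) \<xi> (punit R)"
proof -
  interpret hopf_alg H using H by unfold_locales
  have c: "yd_coalgebra H R" "yd_module H R" "coalgebra R"
    using P by (simp_all add: pre_bialgebra_cocycle_def pre_bialgebra_def coaugmented_def yd_coalgebra_def del: bilin_iff)
  interpret R: coalg R using c(3) by unfold_locales
  have a: "bilin H R R (act R)" and l: "lin R (tprod H R) (\<rho>\<^bsub>R\<^esub>)" using c(2) by (simp_all only: yd_module_def)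
  note [simp] = bilinD[OF a] linD[OF l]
  have d: "\<Delta>\<^bsub>R\<^esub> (act R h v) = act (ytens H R R) h (\<Delta>\<^bsub>R\<^esub> v)"
     "\<rho>\<^bsub>ytens H R R\<^esub> (\<Delta>\<^bsub>R\<^esub> v) = sw H R (\<rho>\<^bsub>R\<^esub> v) (\<lambda>g v0. tens H (tprod R R) g (\<Delta>\<^bsub>R\<^esub> v0))"
    if "h \<in> carr H" "v \<in> carr R" for h v
    using that c(1) by (simp_all add: yd_coalgebra_def yd_hom_def)
  have e: "\<epsilon>\<^bsub>R\<^esub> (act R h v) = \<epsilon>\<^bsub>H\<^esub> h * \<epsilon>\<^bsub>R\<^esub> v"
    if "h \<in> carr H" "v \<in> carr R" for h v
    using that c(1) by (simp_all add: yd_coalgebra_def)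
  have e2: "sw H R (\<rho>\<^bsub>R\<^esub> v) (\<lambda>g c0. scl H (\<epsilon>\<^bsub>R\<^esub> c0) g) = scl H (\<epsilon>\<^bsub>R\<^esub> v) \<one>\<^bsub>H\<^esub>"
    if "v \<in> carr R" for v
    using that c(1) by (simp_all add: yd_coalgebra_def)
  have y: "yd H R"
  proof unfold_locales
    show "\<Delta>\<^bsub>R\<^esub> (act R h v) = sw H H (\<Delta>\<^bsub>H\<^esub> h) (\<lambda>h1 h2. sw R R (\<Delta>\<^bsub>R\<^esub> v) (\<lambda>v1 v2. tens R R (act R h1 v1) (act R h2 v2)))"
      if "h \<in> carr H" "v \<in> carr R" for h v
      using that by (simp add: d) (simp add: ytens_def sw_swap[of H H _ R R])
    show "sw H R (\<rho>\<^bsub>R\<^esub> x) (\<lambda>g x0. tens H (tprod R R) g (\<Delta>\<^bsub>R\<^esub> x0)) =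
      sw R R (\<Delta>\<^bsub>R\<^esub> x) (\<lambda>a b. sw H R (\<rho>\<^bsub>R\<^esub> a) (\<lambda>g a0. sw H R (\<rho>\<^bsub>R\<^esub> b) (\<lambda>k b0.
        tens H (tprod R R) (g \<cdot>\<^bsub>H\<^esub> k) (tens R R a0 b0))))" if "x \<in> carr R" for x
      using d(2)[OF H.unt_carr that] by (simp add: ytens_def)
  qed (use c(2) e e2 in \<open>simp_all only: yd_module_def H.unt_carr H c(3)\<close>)
  then interpret yd H R .
  have p: "coaugmented H R" "coalg_hom (ytens H R R) R (pmul R)"
     "\<And>h z. h\<in>carr H \<Longrightarrow> z\<in>carr (tprod R R) \<Longrightarrow> pmul R (act (ytens H R R) h z) = act R h (pmul R z)"
     "\<And>r. r\<in>carr R \<Longrightarrow> pmul R (tens R R r (punit R)) = r" "\<And>r. r\<in>carr R \<Longrightarrow> pmul R (tens R R (punit R) r) = r"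
    using P by (simp_all add: pre_bialgebra_cocycle_def pre_bialgebra_def)
  show ?thesis
    apply unfold_locales
    using p P by (simp_all add: pre_bialgebra_cocycle_def coalg_hom_def coaugmented_def Let_def)
qed

lemma pbc_imp_pre_bialgebra_cocycle:
  assumes P: "pbc H R (pmul R) \<xi> (punit R)"
  shows "pre_bialgebra_cocycle H R \<xi>"
proof -
  interpret pbc H R "pmul R" \<xi> "punit R" by fact
  have 1: "yd_module H R"
    unfolding yd_module_def using bilin_act lin_coact comod' counit' by (simp del: bilin_iff)
  have 2: "yd_hom H R (ytens H R R) (\<Delta>\<^bsub>R\<^esub>)"
    unfolding yd_hom_def ytens_norm using cop_colin' lin_cop by (simp add: ytens_def sw_swap[of H H _ R R])
  have 3: "yd_coalgebra H R"
    unfolding yd_coalgebra_def using 1 2 coalgebra cou_colin' by simp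
  have 4: "coalg_hom (ytens H R R) R (pmul R)"
    unfolding coalg_hom_def ytens_norm carr_ytens using lin_m by simp
  show ?thesis
    unfolding pre_bialgebra_cocycle_def pre_bialgebra_def coaugmented_def Let_def ytens_norm carr_ytens
    using 3 4 lin_xi act_m cop_xi act_xi ax_c' ax_d ax_e
    by (simp del: SQ.cop_ytens_tens)
qed

lemma lin_cong: "lin V W f \<Longrightarrow> (\<And>x. x \<in> carr V \<Longrightarrow> f' x = f x) \<Longrightarrow> vspace V \<Longrightarrow> lin V W f'"
  by (simp add: lin_def)

text \<open>The structure on \<open>Q\<close> is prescribed on its carrier only. This serves two
  purposes: moving to the coinvariants inside \<open>R \<otimes> H\<close>, and replacing
  \<open>mB\<close> and \<open>xB\<close> by functions that agree with them merely on carriers, with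
  \<open>f\<close> and \<open>g\<close> the identity.\<close>

locale transport = pbc H R m \<xi> u
  for H :: "('k::field, 'h::ab_group_add, 'z) hopf_scheme"
    and R :: "('k, 'h, 'r::ab_group_add, 'y) ydcoalg_scheme" and m \<xi> u +
  fixes Q :: "('k, 'h, 'q::ab_group_add, 'x) ydcoalg_scheme" and f :: "'r \<Rightarrow> 'q" and g :: "'q \<Rightarrow> 'r"
    and mQ :: "('k, 'q, 'q) tensor \<Rightarrow> 'q" and xQ :: "('k, 'q, 'q) tensor \<Rightarrow> 'h"
  assumes vQ [simp]: "vspace Q" and lin_f: "lin R Q f" and lin_g: "lin Q R g"
    and gf [simp]: "r \<in> carr R \<Longrightarrow> g (f r) = r" and fg [simp]: "q \<in> carr Q \<Longrightarrow> f (g q) = q"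
    and copQ [simp]: "q \<in> carr Q \<Longrightarrow> \<Delta>\<^bsub>Q\<^esub> q = sw R R (\<Delta>\<^bsub>R\<^esub> (g q)) (\<lambda>a b. tens Q Q (f a) (f b))"
    and couQ [simp]: "q \<in> carr Q \<Longrightarrow> \<epsilon>\<^bsub>Q\<^esub> q = \<epsilon>\<^bsub>R\<^esub> (g q)"
    and actQ [simp]: "h \<in> carr H \<Longrightarrow> q \<in> carr Q \<Longrightarrow> act Q h q = f (act R h (g q))"
    and coactQ [simp]: "q \<in> carr Q \<Longrightarrow> \<rho>\<^bsub>Q\<^esub> q = sw H R (\<rho>\<^bsub>R\<^esub> (g q)) (\<lambda>k x. tens H Q k (f x))"
    and lin_mQ: "lin (tprod Q Q) Q mQ" and lin_xQ: "lin (tprod Q Q) H xQ"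
    and mQ [simp]: "p \<in> carr Q \<Longrightarrow> q \<in> carr Q \<Longrightarrow> mQ (tens Q Q p q) = f (m (tens R R (g p) (g q)))"
    and xQ [simp]: "p \<in> carr Q \<Longrightarrow> q \<in> carr Q \<Longrightarrow> xQ (tens Q Q p q) = \<xi> (tens R R (g p) (g q))"
begin

lemmas [simp] = linD[OF lin_f] linD[OF lin_g] linD[OF lin_mQ, unfolded scl_tprod] linD[OF lin_xQ, unfolded scl_tprod]

lemma coalgebra_Q: "coalgebra Q"
proof -
  have "lin Q (tprod Q Q) (\<lambda>q. sw R R (\<Delta>\<^bsub>R\<^esub> (g q)) (\<lambda>a b. tens Q Q (f a) (f b)))" by simp
  then have 1: "lin Q (tprod Q Q) (\<Delta>\<^bsub>Q\<^esub>)" by (rule lin_cong) simp_all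
  have "lin Q Kspace (\<lambda>q. \<epsilon>\<^bsub>R\<^esub> (g q))" by simp
  then have 2: "lin Q Kspace (\<epsilon>\<^bsub>Q\<^esub>)" by (rule lin_cong) simp_all
  have 3: "sw Q Q (\<Delta>\<^bsub>Q\<^esub> x) (\<lambda>a b. sw Q Q (\<Delta>\<^bsub>Q\<^esub> a) (\<lambda>c d. tens Q (tprod Q Q) c (tens Q Q d b)))
          = sw Q Q (\<Delta>\<^bsub>Q\<^esub> x) (\<lambda>a b. tens Q (tprod Q Q) a (\<Delta>\<^bsub>Q\<^esub> b))" if [simp]: "x \<in> carr Q" for x
  proof (rule eq_by_forms)
    fix \<phi> assume \<phi>: "lin (tprod Q (tprod Q Q)) Kspace \<phi>"
    note [simp] = linD[OF \<phi>, unfolded scl_tprod scl_Kspace] linD[OF 1, unfolded scl_tprod]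
    show "\<phi> (sw Q Q (\<Delta>\<^bsub>Q\<^esub> x) (\<lambda>a b. sw Q Q (\<Delta>\<^bsub>Q\<^esub> a) (\<lambda>c d. tens Q (tprod Q Q) c (tens Q Q d b))))
          = \<phi> (sw Q Q (\<Delta>\<^bsub>Q\<^esub> x) (\<lambda>a b. tens Q (tprod Q Q) a (\<Delta>\<^bsub>Q\<^esub> b)))"
      by simp (simp add: coassoc)
  qed (simp_all add: lin_carr[OF 1] del: copQ)
  have 4: "sw Q Q (\<Delta>\<^bsub>Q\<^esub> x) (\<lambda>a b. scl Q (\<epsilon>\<^bsub>Q\<^esub> a) b) = x" "sw Q Q (\<Delta>\<^bsub>Q\<^esub> x) (\<lambda>a b. scl Q (\<epsilon>\<^bsub>Q\<^esub> b) a) = x"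
    if [simp]: "x \<in> carr Q" for x
  proof -
    have "\<phi> (sw Q Q (\<Delta>\<^bsub>Q\<^esub> x) (\<lambda>a b. scl Q (\<epsilon>\<^bsub>Q\<^esub> a) b)) = \<phi> x \<and> \<phi> (sw Q Q (\<Delta>\<^bsub>Q\<^esub> x) (\<lambda>a b. scl Q (\<epsilon>\<^bsub>Q\<^esub> b) a)) = \<phi> x"
      if \<phi>: "lin Q Kspace \<phi>" for \<phi>
    proof -
      note [simp] = linD[OF \<phi>, unfolded scl_tprod scl_Kspace] linD[OF 1, unfolded scl_tprod] \<phi>
      show ?thesis by simp (simp add: counit)
    qed
    then show "sw Q Q (\<Delta>\<^bsub>Q\<^esub> x) (\<lambda>a b. scl Q (\<epsilon>\<^bsub>Q\<^esub> a) b) = x" "sw Q Q (\<Delta>\<^bsub>Q\<^esub> x) (\<lambda>a b. scl Q (\<epsilon>\<^bsub>Q\<^esub> b) a) = x"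
      using lin_carr[OF 1, of x] lin_carr[OF 2] by (intro eq_by_forms[of Q]; simp del: copQ couQ)+
  qed
  show ?thesis unfolding coalgebra_def using 1 2 3 4 by (simp del: copQ couQ)
qed

sublocale Qc: coalg Q by unfold_locales (rule coalgebra_Q)

lemma lin_coactQ: "lin Q (tprod H Q) (\<rho>\<^bsub>Q\<^esub>)"
proof -
  have "lin Q (tprod H Q) (\<lambda>q. sw H R (\<rho>\<^bsub>R\<^esub> (g q)) (\<lambda>k x. tens H Q k (f x)))" by simp
  then show ?thesis by (rule lin_cong) simp_all
qed
lemma bilin_actQ: "bilin H Q Q (act Q)"
proof -
  have 1: "lin H Q (\<lambda>h. act Q h q)" if "q \<in> carr Q" for q
    by (rule lin_cong[where f = "\<lambda>h. f (act R h (g q))"]) (use that in simp_all)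
  have 2: "lin Q Q (act Q h)" if "h \<in> carr H" for h
    by (rule lin_cong[where f = "\<lambda>q. f (act R h (g q))"]) (use that in simp_all)
  show ?thesis using 1 2 by (simp add: bilin_def)
qed
lemmas Q_rules = linD[OF lin_coactQ, unfolded scl_tprod] bilinD[OF bilin_actQ]

lemma yd_Q: "yd H Q"
proof unfold_locales
  note [simp] = Q_rules
  show "bilin H Q Q (act Q)" by (rule bilin_actQ)
  show "lin Q (tprod H Q) (\<rho>\<^bsub>Q\<^esub>)" by (rule lin_coactQ)
  fix x assume [simp]: "x \<in> carr Q"
  show "sw H Q (\<rho>\<^bsub>Q\<^esub> x) (\<lambda>g v0. sw H H (\<Delta>\<^bsub>H\<^esub> g) (\<lambda>g1 g2. tens H (tprod H Q) g1 (tens H Q g2 v0)))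
          = sw H Q (\<rho>\<^bsub>Q\<^esub> x) (\<lambda>g v0. tens H (tprod H Q) g (\<rho>\<^bsub>Q\<^esub> v0))"
  proof (rule eq_by_forms)
    fix \<phi> assume \<phi>: "lin (tprod H (tprod H Q)) Kspace \<phi>"
    note [simp] = linD[OF \<phi>, unfolded scl_tprod scl_Kspace]
    show "\<phi> (sw H Q (\<rho>\<^bsub>Q\<^esub> x) (\<lambda>g v0. sw H H (\<Delta>\<^bsub>H\<^esub> g) (\<lambda>g1 g2. tens H (tprod H Q) g1 (tens H Q g2 v0))))
          = \<phi> (sw H Q (\<rho>\<^bsub>Q\<^esub> x) (\<lambda>g v0. tens H (tprod H Q) g (\<rho>\<^bsub>Q\<^esub> v0)))"
      by simp (simp add: comod)
  qed simp_all
  show "sw H Q (\<rho>\<^bsub>Q\<^esub> x) (\<lambda>g v0. scl Q (\<epsilon>\<^bsub>H\<^esub> g) v0) = x"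
  proof (rule eq_by_forms)
    fix \<phi> assume \<phi>: "lin Q Kspace \<phi>"
    note [simp] = linD[OF \<phi>, unfolded scl_tprod scl_Kspace] \<phi>
    show "\<phi> (sw H Q (\<rho>\<^bsub>Q\<^esub> x) (\<lambda>g v0. scl Q (\<epsilon>\<^bsub>H\<^esub> g) v0)) = \<phi> x"
      by simp (simp add: counit_coact)
  qed simp_all
  show "sw H Q (\<rho>\<^bsub>Q\<^esub> x) (\<lambda>g x0. tens H (tprod Q Q) g (\<Delta>\<^bsub>Q\<^esub> x0)) =
      sw Q Q (\<Delta>\<^bsub>Q\<^esub> x) (\<lambda>a b. sw H Q (\<rho>\<^bsub>Q\<^esub> a) (\<lambda>g a0. sw H Q (\<rho>\<^bsub>Q\<^esub> b) (\<lambda>k b0.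
        tens H (tprod Q Q) (g \<cdot>\<^bsub>H\<^esub> k) (tens Q Q a0 b0))))"
  proof (rule eq_by_forms)
    fix \<phi> assume \<phi>: "lin (tprod H (tprod Q Q)) Kspace \<phi>"
    note [simp] = linD[OF \<phi>, unfolded scl_tprod scl_Kspace]
    show "\<phi> (sw H Q (\<rho>\<^bsub>Q\<^esub> x) (\<lambda>g x0. tens H (tprod Q Q) g (\<Delta>\<^bsub>Q\<^esub> x0))) =
      \<phi> (sw Q Q (\<Delta>\<^bsub>Q\<^esub> x) (\<lambda>a b. sw H Q (\<rho>\<^bsub>Q\<^esub> a) (\<lambda>g a0. sw H Q (\<rho>\<^bsub>Q\<^esub> b) (\<lambda>k b0.
        tens H (tprod Q Q) (g \<cdot>\<^bsub>H\<^esub> k) (tens Q Q a0 b0)))))"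
      by simp (simp add: cop_colin)
  qed simp_all
  show "sw H Q (\<rho>\<^bsub>Q\<^esub> x) (\<lambda>g c0. scl H (\<epsilon>\<^bsub>Q\<^esub> c0) g) = scl H (\<epsilon>\<^bsub>Q\<^esub> x) \<one>\<^bsub>H\<^esub>"
  proof (rule eq_by_forms)
    fix \<phi> assume \<phi>: "lin H Kspace \<phi>"
    note [simp] = linD[OF \<phi>, unfolded scl_tprod scl_Kspace] \<phi>
    show "\<phi> (sw H Q (\<rho>\<^bsub>Q\<^esub> x) (\<lambda>g c0. scl H (\<epsilon>\<^bsub>Q\<^esub> c0) g)) = \<phi> (scl H (\<epsilon>\<^bsub>Q\<^esub> x) \<one>\<^bsub>H\<^esub>)"
      by simp (simp add: cou_colin)
  qed simp_all
next
  note [simp] = Q_rules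
  fix h v assume [simp]: "h \<in> carr H" "v \<in> carr Q"
  show "\<Delta>\<^bsub>Q\<^esub> (act Q h v) = sw H H (\<Delta>\<^bsub>H\<^esub> h) (\<lambda>h1 h2. sw Q Q (\<Delta>\<^bsub>Q\<^esub> v) (\<lambda>v1 v2. tens Q Q (act Q h1 v1) (act Q h2 v2)))"
  proof (rule eq_by_forms)
    fix \<phi> assume \<phi>: "lin (tprod Q Q) Kspace \<phi>"
    note [simp] = linD[OF \<phi>, unfolded scl_tprod scl_Kspace]
    show "\<phi> (\<Delta>\<^bsub>Q\<^esub> (act Q h v)) = \<phi> (sw H H (\<Delta>\<^bsub>H\<^esub> h) (\<lambda>h1 h2. sw Q Q (\<Delta>\<^bsub>Q\<^esub> v) (\<lambda>v1 v2. tens Q Q (act Q h1 v1) (act Q h2 v2))))"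
      by simp
  qed simp_all
  show "\<rho>\<^bsub>Q\<^esub> (act Q h v) =
          sw H H (\<Delta>\<^bsub>H\<^esub> h) (\<lambda>h1 h'. sw H H (\<Delta>\<^bsub>H\<^esub> h') (\<lambda>h2 h3. sw H Q (\<rho>\<^bsub>Q\<^esub> v) (\<lambda>g v0.
            tens H Q (h1 \<cdot>\<^bsub>H\<^esub> g \<cdot>\<^bsub>H\<^esub> \<S>\<^bsub>H\<^esub> h3) (act Q h2 v0))))"
  proof (rule eq_by_forms)
    fix \<phi> assume \<phi>: "lin (tprod H Q) Kspace \<phi>"
    note [simp] = linD[OF \<phi>, unfolded scl_tprod scl_Kspace]
    show "\<phi> (\<rho>\<^bsub>Q\<^esub> (act Q h v)) =
          \<phi> (sw H H (\<Delta>\<^bsub>H\<^esub> h) (\<lambda>h1 h'. sw H H (\<Delta>\<^bsub>H\<^esub> h') (\<lambda>h2 h3. sw H Q (\<rho>\<^bsub>Q\<^esub> v) (\<lambda>g v0.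
            tens H Q (h1 \<cdot>\<^bsub>H\<^esub> g \<cdot>\<^bsub>H\<^esub> \<S>\<^bsub>H\<^esub> h3) (act Q h2 v0)))))"
      by simp
  qed simp_all
qed simp_all

lemma pbc_Q: "pbc H Q mQ xQ (f u)"
proof -
  interpret Q: yd H Q by (rule yd_Q)
  let ?QQ = "tprod Q Q"
  have m1: "\<phi> (\<Delta>\<^bsub>Q\<^esub> (mQ z)) = \<phi> (sw ?QQ ?QQ (\<Delta>\<^bsub>ytens H Q Q\<^esub> z) (\<lambda>a b. tens Q Q (mQ a) (mQ b)))"
    if z: "z \<in> carr ?QQ" and \<phi>: "lin (tprod Q Q) Kspace \<phi>" for z \<phi>
  proof -
    note [simp] = linD[OF \<phi>, unfolded scl_tprod scl_Kspace]
    \<comment> \<open>Linearity is settled before \<open>copQ\<close> rewrites the comultiplication: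
      in this form the map is a composite of maps known to be linear.\<close>
    have l: "lin ?QQ Kspace (\<lambda>z. \<phi> (\<Delta>\<^bsub>Q\<^esub> (mQ z)))" by (simp del: copQ)
    show ?thesis
      by (rule tprod_ext[OF _ _ vspace_Kspace l _ _ z]) simp_all
  qed
  have m2: "\<epsilon>\<^bsub>Q\<^esub> (mQ z) = \<epsilon>\<^bsub>ytens H Q Q\<^esub> z" if z: "z \<in> carr ?QQ" for z
  proof -
    have l: "lin ?QQ Kspace (\<lambda>z. \<epsilon>\<^bsub>Q\<^esub> (mQ z))" by (simp del: couQ)
    show ?thesis
      by (rule tprod_ext[OF _ _ vspace_Kspace l _ _ z]) simp_all
  qed
  have m3: "mQ (act (ytens H Q Q) h z) = act Q h (mQ z)" if [simp]: "h \<in> carr H" and z: "z \<in> carr ?QQ" for h z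
  proof (rule eq_by_forms)
    fix \<phi> assume \<phi>: "lin Q Kspace \<phi>"
    note [simp] = linD[OF \<phi>, unfolded scl_tprod scl_Kspace]
    have l: "lin ?QQ Kspace (\<lambda>z. \<phi> (act Q h (mQ z)))" by (simp del: actQ)
    show "\<phi> (mQ (act (ytens H Q Q) h z)) = \<phi> (act Q h (mQ z))"
      apply (rule tprod_ext[OF _ _ vspace_Kspace _ l _ z])
      apply simp_all
      subgoal for p q
        using arg_cong[OF act_m[of h "tens R R (g p) (g q)"], of "\<lambda>x. \<phi> (f x)"] by simp
      done
  qed (simp_all add: z)
  have x1: "\<Delta>\<^bsub>H\<^esub> (xQ z) = sw ?QQ ?QQ (\<Delta>\<^bsub>ytens H Q Q\<^esub> z) (\<lambda>z1 z2.
         sw H ?QQ (\<rho>\<^bsub>ytens H Q Q\<^esub> z2) (\<lambda>g z20. tens H H (xQ z1 \<cdot>\<^bsub>H\<^esub> g) (xQ z20)))" if z: "z \<in> carr ?QQ" for z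
  proof (rule eq_by_forms)
    fix \<phi> assume \<phi>: "lin (tprod H H) Kspace \<phi>"
    note [simp] = linD[OF \<phi>, unfolded scl_tprod scl_Kspace]
    show "\<phi> (\<Delta>\<^bsub>H\<^esub> (xQ z)) = \<phi> (sw ?QQ ?QQ (\<Delta>\<^bsub>ytens H Q Q\<^esub> z) (\<lambda>z1 z2.
         sw H ?QQ (\<rho>\<^bsub>ytens H Q Q\<^esub> z2) (\<lambda>g z20. tens H H (xQ z1 \<cdot>\<^bsub>H\<^esub> g) (xQ z20))))"
      apply (rule tprod_ext[OF _ _ vspace_Kspace _ _ _ z])
      apply simp_all
      subgoal for p q
        using arg_cong[OF cop_xi[of "tens R R (g p) (g q)"], of \<phi>] by simp
      done
  qed (simp_all add: z)
  have x2: "\<epsilon>\<^bsub>H\<^esub> (xQ z) = \<epsilon>\<^bsub>ytens H Q Q\<^esub> z" if z: "z \<in> carr ?QQ" for z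
    by (rule tprod_ext[OF _ _ vspace_Kspace _ _ _ z]) simp_all
  have x3: "xQ (act (ytens H Q Q) h z) = sw H H (\<Delta>\<^bsub>H\<^esub> h) (\<lambda>h1 h2. h1 \<cdot>\<^bsub>H\<^esub> xQ z \<cdot>\<^bsub>H\<^esub> \<S>\<^bsub>H\<^esub> h2)"
    if [simp]: "h \<in> carr H" and z: "z \<in> carr ?QQ" for h z
  proof (rule eq_by_forms)
    fix \<phi> assume \<phi>: "lin H Kspace \<phi>"
    note [simp] = linD[OF \<phi>, unfolded scl_tprod scl_Kspace]
    show "\<phi> (xQ (act (ytens H Q Q) h z)) = \<phi> (sw H H (\<Delta>\<^bsub>H\<^esub> h) (\<lambda>h1 h2. h1 \<cdot>\<^bsub>H\<^esub> xQ z \<cdot>\<^bsub>H\<^esub> \<S>\<^bsub>H\<^esub> h2))"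
      apply (rule tprod_ext[OF _ _ vspace_Kspace _ _ _ z])
      apply simp_all
      subgoal for p q
        using arg_cong[OF act_xi[of h "tens R R (g p) (g q)"], of \<phi>] by simp
      done
  qed (simp_all add: z)
  have c: "sw ?QQ ?QQ (\<Delta>\<^bsub>ytens H Q Q\<^esub> z) (\<lambda>z1 z2. sw H Q (\<rho>\<^bsub>Q\<^esub> (mQ z1)) (\<lambda>g r0. tens H Q (g \<cdot>\<^bsub>H\<^esub> xQ z2) r0))
          = sw ?QQ ?QQ (\<Delta>\<^bsub>ytens H Q Q\<^esub> z) (\<lambda>z1 z2. sw H ?QQ (\<rho>\<^bsub>ytens H Q Q\<^esub> z2) (\<lambda>g z20.
              tens H Q (xQ z1 \<cdot>\<^bsub>H\<^esub> g) (mQ z20)))" if z: "z \<in> carr ?QQ" for z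
  proof (rule eq_by_forms)
    fix \<phi> assume \<phi>: "lin (tprod H Q) Kspace \<phi>"
    note [simp] = linD[OF \<phi>, unfolded scl_tprod scl_Kspace]
    have l: "lin ?QQ Kspace (\<lambda>z. \<phi> (sw ?QQ ?QQ (\<Delta>\<^bsub>ytens H Q Q\<^esub> z) (\<lambda>z1 z2. sw H Q (\<rho>\<^bsub>Q\<^esub> (mQ z1)) (\<lambda>g r0. tens H Q (g \<cdot>\<^bsub>H\<^esub> xQ z2) r0))))"
      by (simp del: coactQ)
    show "\<phi> (sw ?QQ ?QQ (\<Delta>\<^bsub>ytens H Q Q\<^esub> z) (\<lambda>z1 z2. sw H Q (\<rho>\<^bsub>Q\<^esub> (mQ z1)) (\<lambda>g r0. tens H Q (g \<cdot>\<^bsub>H\<^esub> xQ z2) r0)))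
          = \<phi> (sw ?QQ ?QQ (\<Delta>\<^bsub>ytens H Q Q\<^esub> z) (\<lambda>z1 z2. sw H ?QQ (\<rho>\<^bsub>ytens H Q Q\<^esub> z2) (\<lambda>g z20.
              tens H Q (xQ z1 \<cdot>\<^bsub>H\<^esub> g) (mQ z20))))"
      apply (rule tprod_ext[OF _ _ vspace_Kspace l _ _ z])
      apply simp_all
      subgoal for p q
        using ax_c[of "tens R R (g p) (g q)" "\<lambda>k r. \<phi> (tens H Q k (f r))"] by simp
      done
  qed (simp_all add: z del: coactQ)
  have d: "mQ (tens Q Q r (mQ (tens Q Q s t)))
          = sw ?QQ ?QQ (\<Delta>\<^bsub>ytens H Q Q\<^esub> (tens Q Q r s)) (\<lambda>z1 z2. mQ (tens Q Q (mQ z1) (act Q (xQ z2) t)))"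
     if [simp]: "r \<in> carr Q" "s \<in> carr Q" "t \<in> carr Q" for r s t
  proof (rule eq_by_forms)
    fix \<phi> assume \<phi>: "lin Q Kspace \<phi>"
    note [simp] = linD[OF \<phi>, unfolded scl_tprod scl_Kspace]
    show "\<phi> (mQ (tens Q Q r (mQ (tens Q Q s t))))
          = \<phi> (sw ?QQ ?QQ (\<Delta>\<^bsub>ytens H Q Q\<^esub> (tens Q Q r s)) (\<lambda>z1 z2. mQ (tens Q Q (mQ z1) (act Q (xQ z2) t))))"
      using arg_cong[OF ax_d[of "g r" "g s" "g t"], of "\<lambda>x. \<phi> (f x)"] by simp
  qed simp_all
  have e: "sw ?QQ ?QQ (\<Delta>\<^bsub>ytens H Q Q\<^esub> (tens Q Q s t)) (\<lambda>w1 w2. xQ (tens Q Q r (mQ w1)) \<cdot>\<^bsub>H\<^esub> xQ w2)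
          = sw ?QQ ?QQ (\<Delta>\<^bsub>ytens H Q Q\<^esub> (tens Q Q r s)) (\<lambda>z1 z2. sw H H (\<Delta>\<^bsub>H\<^esub> (xQ z2)) (\<lambda>x1 x2.
              xQ (tens Q Q (mQ z1) (act Q x1 t)) \<cdot>\<^bsub>H\<^esub> x2))"
     if [simp]: "r \<in> carr Q" "s \<in> carr Q" "t \<in> carr Q" for r s t
  proof (rule eq_by_forms)
    fix \<phi> assume \<phi>: "lin H Kspace \<phi>"
    note [simp] = linD[OF \<phi>, unfolded scl_tprod scl_Kspace]
    show "\<phi> (sw ?QQ ?QQ (\<Delta>\<^bsub>ytens H Q Q\<^esub> (tens Q Q s t)) (\<lambda>w1 w2. xQ (tens Q Q r (mQ w1)) \<cdot>\<^bsub>H\<^esub> xQ w2))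
          = \<phi> (sw ?QQ ?QQ (\<Delta>\<^bsub>ytens H Q Q\<^esub> (tens Q Q r s)) (\<lambda>z1 z2. sw H H (\<Delta>\<^bsub>H\<^esub> (xQ z2)) (\<lambda>x1 x2.
              xQ (tens Q Q (mQ z1) (act Q x1 t)) \<cdot>\<^bsub>H\<^esub> x2)))"
      using arg_cong[OF ax_e[of "g r" "g s" "g t"], of \<phi>] by simp
  qed (simp_all del: actQ)
  have u1: "\<Delta>\<^bsub>Q\<^esub> (f u) = tens Q Q (f u) (f u)"
    by (simp add: sw_tens[where U = "tprod Q Q"])
  have u2: "\<rho>\<^bsub>Q\<^esub> (f u) = tens H Q \<one>\<^bsub>H\<^esub> (f u)"
    by (simp add: sw_tens[where U = "tprod H Q"])
  show ?thesis
  proof unfold_locales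
    show "lin ?QQ Q mQ" "lin ?QQ H xQ" by (fact lin_mQ lin_xQ)+
    show "\<Delta>\<^bsub>Q\<^esub> (mQ z) = sw ?QQ ?QQ (\<Delta>\<^bsub>ytens H Q Q\<^esub> z) (\<lambda>a b. tens Q Q (mQ a) (mQ b))" if "z \<in> carr ?QQ" for z
      by (rule eq_by_forms[OF vspace_tprod[of Q Q] m1]) (use that in \<open>simp_all del: copQ\<close>)
  qed (fact m2 m3 x1 x2 x3 c d e u1 u2 | simp)+
qed

end

subsection \<open>The splitting datum of a smash product\<close>

locale split_smash = smash_bialg H R B u
  for H :: "('k::field, 'h::ab_group_add, 'z) hopf_scheme"
    and R :: "('k, 'h, 'r::ab_group_add, 'y) ydcoalg_scheme"
    and B :: "('k, ('k, 'r, 'h) tensor, 'x) bialg_scheme" and u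
begin

abbreviation sg where "sg \<equiv> \<lambda>h. tens R H u h"

lemma splitting: "splitting_datum B H prH sg"
proof -
  have s: "lin H (tprod R H) sg" by simp
  have "bialg_hom H B sg"
  proof -
    have "\<Delta>\<^bsub>B\<^esub> (sg h) = sw H H (\<Delta>\<^bsub>H\<^esub> h) (\<lambda>a b. tens (tprod R H) (tprod R H) (sg a) (sg b))" if [simp]: "h \<in> carr H" for h
    proof (rule eq_by_forms)
      fix \<phi> assume \<phi>: "lin (tprod (tprod R H) (tprod R H)) Kspace \<phi>"
      note [simp] = linD[OF \<phi>, unfolded scl_tprod scl_Kspace]
      show "\<phi> (\<Delta>\<^bsub>B\<^esub> (sg h)) = \<phi> (sw H H (\<Delta>\<^bsub>H\<^esub> h) (\<lambda>a b. tens (tprod R H) (tprod R H) (sg a) (sg b)))"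
        by simp
    qed simp_all
    moreover have "sg (a \<cdot>\<^bsub>H\<^esub> b) = sg a \<cdot>\<^bsub>B\<^esub> sg b" if "a \<in> carr H" "b \<in> carr H" for a b
      using that by (simp add: mul_sigma)
    ultimately show ?thesis
      unfolding bialg_hom_def coalg_hom_def A_norm using s by (simp add: unt_B del: cop_A_tens)
  qed
  moreover have "coalg_hom B H prH"
    unfolding coalg_hom_def A_norm carr_A using lin_prH cop_prH cou_pr by simp
  moreover have "prH (sg h \<cdot>\<^bsub>B\<^esub> x \<cdot>\<^bsub>B\<^esub> sg h') = h \<cdot>\<^bsub>H\<^esub> prH x \<cdot>\<^bsub>H\<^esub> h'"
    if "h \<in> carr H" "x \<in> carr (tprod R H)" "h' \<in> carr H" for h x h'
    using that by (simp add: sigma_mul mul_sigma prH_lmul prH_rmul)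
  moreover have "prH (sg h) = h" if "h \<in> carr H" for h using that by simp
  ultimately show ?thesis
    unfolding splitting_datum_def using hopf B.bialgebra by simp
qed

text \<open>The antipode cancels the component in H, so \<open>split_tau\<close> is the projection
  to \<open>R # 1\<close>. All structure maps of the coinvariants thereby become \<open>prR\<close>
  of structure maps of \<open>B\<close>.\<close>

lemma tau: assumes x: "x \<in> carr (tprod R H)" shows "split_tau B H prH sg x = inc (prR x)"
proof (rule eq_by_forms)
  fix \<phi> assume \<phi>: "lin (tprod R H) Kspace \<phi>"
  note [simp] = linD[OF \<phi>, unfolded scl_tprod scl_Kspace]
  have [simp]: "sw H H (\<Delta>\<^bsub>H\<^esub> k) (\<lambda>p q. \<phi> (tens R H r (a \<cdot>\<^bsub>H\<^esub> (p \<cdot>\<^bsub>H\<^esub> \<S>\<^bsub>H\<^esub> q)))) = \<epsilon>\<^bsub>H\<^esub> k * \<phi> (tens R H r a)"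
    if "r \<in> carr R" "k \<in> carr H" "a \<in> carr H" for r k a
    using antip(2)[of k "\<lambda>u. \<phi> (tens R H r (a \<cdot>\<^bsub>H\<^esub> u))"] that by simp
  have *: "split_tau B H prH sg x = sw (tprod R H) (tprod R H) (\<Delta>\<^bsub>B\<^esub> x) (\<lambda>a b. rmul a (\<S>\<^bsub>H\<^esub> (prH b)))"
    unfolding split_tau_def A_norm using x by (simp add: mul_sigma)
  show "\<phi> (split_tau B H prH sg x) = \<phi> (inc (prR x))"
    unfolding *
    apply (rule ext_A[OF _ _ _ x])
    apply simp_all
    apply (simp add: sw_swap[of H H _ H R] sw_mult(1)[symmetric] cou_colin counit)
    subgoal for r h using antip(2)[of h "\<lambda>v. \<phi> (tens R H r v)"] by simp
    done
next
  show "split_tau B H prH sg x \<in> carr (tprod R H)"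
    unfolding split_tau_def A_norm using x by simp
qed (simp_all add: x)

abbreviation Q where "Q \<equiv> split_prebialg B H prH sg"

lemma Q_simps: "scl Q = tscale" "\<Delta>\<^bsub>Q\<^esub> = (\<lambda>r. sw (tprod R H) (tprod R H) (\<Delta>\<^bsub>B\<^esub> r) (\<lambda>r1 r2. tens (tprod R H) (tprod R H) (split_tau B H prH sg r1) r2))"
   "\<epsilon>\<^bsub>Q\<^esub> = \<epsilon>\<^bsub>B\<^esub>" "punit Q = inc u"
   "act Q = (\<lambda>h r. sw H H (\<Delta>\<^bsub>H\<^esub> h) (\<lambda>h1 h2. sg h1 \<cdot>\<^bsub>B\<^esub> r \<cdot>\<^bsub>B\<^esub> sg (\<S>\<^bsub>H\<^esub> h2)))"
   "\<rho>\<^bsub>Q\<^esub> = (\<lambda>r. sw (tprod R H) (tprod R H) (\<Delta>\<^bsub>B\<^esub> r) (\<lambda>r1 r2. tens H (tprod R H) (prH r1) r2))"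
   "pmul Q = (\<lambda>z. sw (tprod R H) (tprod R H) z (\<lambda>r s. split_tau B H prH sg (r \<cdot>\<^bsub>B\<^esub> s)))"
   "carr Q = {a \<in> carr (tprod R H). sw (tprod R H) (tprod R H) (\<Delta>\<^bsub>B\<^esub> a) (\<lambda>a1 a2. tens (tprod R H) H a1 (prH a2)) = tens (tprod R H) H a \<one>\<^bsub>H\<^esub>}"
  by (simp_all add: split_prebialg_def unt_B cong del: sw_cong)

text \<open>Applying \<open>prR\<close> to the left factor of the coinvariance condition turns one
  side into \<open>a\<close>, by \<open>decomp\<close>, and the other into
  \<open>inc (prR a)\<close>.\<close>

lemma carr_Q: "carr Q = inc ` carr R"
proof -
  have "sw (tprod R H) (tprod R H) (\<Delta>\<^bsub>B\<^esub> (inc r)) (\<lambda>a1 a2. tens (tprod R H) H a1 (prH a2)) = tens (tprod R H) H (inc r) \<one>\<^bsub>H\<^esub>"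
    if [simp]: "r \<in> carr R" for r
  proof (rule eq_by_forms)
    fix \<phi> assume \<phi>: "lin (tprod (tprod R H) H) Kspace \<phi>"
    note [simp] = linD[OF \<phi>, unfolded scl_tprod scl_Kspace]
    show "\<phi> (sw (tprod R H) (tprod R H) (\<Delta>\<^bsub>B\<^esub> (inc r)) (\<lambda>a1 a2. tens (tprod R H) H a1 (prH a2))) = \<phi> (tens (tprod R H) H (inc r) \<one>\<^bsub>H\<^esub>)"
      by simp (simp add: cou_colin counit)
  qed simp_all
  moreover have "a = inc (prR a)" if a [simp]: "a \<in> carr (tprod R H)" and e: "sw (tprod R H) (tprod R H) (\<Delta>\<^bsub>B\<^esub> a) (\<lambda>a1 a2. tens (tprod R H) H a1 (prH a2)) = tens (tprod R H) H a \<one>\<^bsub>H\<^esub>" for a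
  proof (rule eq_by_forms)
    fix \<phi> assume \<phi>: "lin (tprod R H) Kspace \<phi>"
    note [simp] = linD[OF \<phi>, unfolded scl_tprod scl_Kspace]
    have "sw (tprod R H) H (sw (tprod R H) (tprod R H) (\<Delta>\<^bsub>B\<^esub> a) (\<lambda>a1 a2. tens (tprod R H) H a1 (prH a2))) (\<lambda>a h. \<phi> (tens R H (prR a) h)) = \<phi> a"
      using arg_cong[OF decomp[OF a], of \<phi>] by simp
    then show "\<phi> a = \<phi> (inc (prR a))" unfolding e by simp
  qed simp_all
  ultimately show ?thesis unfolding Q_simps by (auto simp: image_iff simp del: cop_A_tens intro!: bexI[OF _ lin_carr[OF lin_prR]])
qed

lemma inc_Q [simp]: "r \<in> carr R \<Longrightarrow> inc r \<in> carr Q"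
  by (simp add: carr_Q)

lemma carr_QA: "q \<in> carr Q \<Longrightarrow> q \<in> carr (tprod R H)"
  by (auto simp: carr_Q)

lemma inc_prR [simp]: "q \<in> carr Q \<Longrightarrow> inc (prR q) = q"
  by (auto simp: carr_Q)

lemma vspace_Q [simp]: "vspace Q"
proof -
  interpret vector_space "tscale :: 'k \<Rightarrow> ('k, 'r, 'h) tensor \<Rightarrow> _" by (rule vector_space_tscale)
  have "subspace (carr Q)"
    unfolding subspace_def carr_Q
  proof (intro conjI ballI allI)
    have "inc 0 = 0" using lin_0[of R "tprod R H" inc] by simp
    then show "0 \<in> inc ` carr R" by (metis vspace_zero image_eqI vsp)
    show "x + y \<in> inc ` carr R" if xy: "x \<in> inc ` carr R" "y \<in> inc ` carr R" for x y
      using xy by (auto simp: tens_add_left(1)[symmetric])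
    show "tscale c x \<in> inc ` carr R" if xy: "x \<in> inc ` carr R" for c x
    proof -
      obtain r where r: "r \<in> carr R" "x = inc r" using xy by blast
      then have "tscale c x = inc (scl R c r)" by simp
      then show ?thesis by (rule image_eqI) (use r(1) in simp)
    qed
  qed
  then show ?thesis unfolding vspace_def Q_simps(1) using vector_space_tscale by blast
qed

lemma tens_scl_cong: "scl V = scl V' \<Longrightarrow> scl W = scl W' \<Longrightarrow> tens V W = tens V' W'"
  by (intro ext) (simp only: Rep_tensor_inject[symmetric] tens.rep_eq ambient_def)

lemma tens_Q: "tens Q Q = tens (tprod R H) (tprod R H)" "tens H Q = tens H (tprod R H)" "tens R (K1 H) = tens R H"
  by (rule tens_scl_cong; simp add: Q_simps(1) K1_def)+

text \<open>\<open>sw\<close> depends on the carriers through its choice of a list. A list taken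
  from the subspaces also represents the tensor in the larger spaces, where every representation
  gives the same sum.\<close>

lemma sw_sub:
  assumes V: "vspace V'" "vspace W'" "vspace V" "vspace W" "vspace U" and "scl V' = scl V" "scl W' = scl W" "carr V' \<subseteq> carr V" "carr W' \<subseteq> carr W"
    and b: "bilin V W U F" and t: "t \<in> carr (tprod V' W')"
  shows "sw V' W' t F = sw V W t F"
proof -
  have te: "tens V' W' = tens V W" by (rule tens_scl_cong) fact+
  note l = sw_list[OF V(1,2) t]
  have "sw V W (\<Sum>(v, w)\<leftarrow>sw_list V' W' t. tens V W v w) F = (\<Sum>(v, w)\<leftarrow>sw_list V' W' t. F v w)"
    by (rule sw_eq[OF V(3,4,5) b]) (use l assms in auto)
  then show ?thesis using l(2) by (simp add: te sw_eq_sum_list)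
qed

lemma lin_incQ: "lin R Q inc"
  by (simp add: lin_def Q_simps(1) tens_add_left)

lemma lin_prQ: "lin Q R prR"
  using lin_prR carr_QA by (simp add: lin_def Q_simps(1))

lemma carr_QQ: assumes t: "t \<in> carr (tprod Q Q)" shows "t \<in> carr (tprod (tprod R H) (tprod R H))"
proof -
  have "set xs \<subseteq> carr Q \<times> carr Q \<Longrightarrow> (\<Sum>(v, w)\<leftarrow>xs. tens (tprod R H) (tprod R H) v w) \<in> carr (tprod (tprod R H) (tprod R H))" for xs
    by (induction xs) (auto intro!: vspace_add tens_carr carr_QA)
  then show ?thesis using sw_list[OF vspace_Q vspace_Q t] by (metis tens_Q(1))
qed

lemma cop_inc:
  assumes [simp]: "r \<in> carr R"
  shows "\<Delta>\<^bsub>Q\<^esub> (inc r) = sw R R (\<Delta>\<^bsub>R\<^esub> r) (\<lambda>a b. tens Q Q (inc a) (inc b))"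
  unfolding tens_Q
proof (rule eq_by_forms)
  fix \<phi> assume \<phi>: "lin (tprod (tprod R H) (tprod R H)) Kspace \<phi>"
  note [simp] = linD[OF \<phi>, unfolded scl_tprod scl_Kspace]
  show "\<phi> (\<Delta>\<^bsub>Q\<^esub> (inc r)) = \<phi> (sw R R (\<Delta>\<^bsub>R\<^esub> r) (\<lambda>a b. tens (tprod R H) (tprod R H) (inc a) (inc b)))"
    unfolding Q_simps by (simp add: tau) (simp add: counit_coact)
qed (simp_all add: Q_simps tau)

lemma coact_inc:
  assumes [simp]: "r \<in> carr R"
  shows "\<rho>\<^bsub>Q\<^esub> (inc r) = sw H R (\<rho>\<^bsub>R\<^esub> r) (\<lambda>k x. tens H Q k (inc x))"
  unfolding tens_Q
proof (rule eq_by_forms)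
  fix \<phi> assume \<phi>: "lin (tprod H (tprod R H)) Kspace \<phi>"
  note [simp] = linD[OF \<phi>, unfolded scl_tprod scl_Kspace]
  show "\<phi> (\<rho>\<^bsub>Q\<^esub> (inc r)) = \<phi> (sw H R (\<rho>\<^bsub>R\<^esub> r) (\<lambda>k x. tens H (tprod R H) k (inc x)))"
    unfolding Q_simps by simp (simp add: counit sw_mult(1)[symmetric])
qed (simp_all add: Q_simps)

lemma act_inc:
  assumes [simp]: "r \<in> carr R" "h \<in> carr H"
  shows "act Q h (inc r) = inc (act R h r)"
proof (rule eq_by_forms)
  fix \<phi> assume \<phi>: "lin (tprod R H) Kspace \<phi>"
  note [simp] = linD[OF \<phi>, unfolded scl_tprod scl_Kspace]
  have [simp]: "sw H H (\<Delta>\<^bsub>H\<^esub> k) (\<lambda>p q. \<phi> (tens R H a (p \<cdot>\<^bsub>H\<^esub> \<S>\<^bsub>H\<^esub> q))) = \<epsilon>\<^bsub>H\<^esub> k * \<phi> (inc a)"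
    if "a \<in> carr R" "k \<in> carr H" for a k
    using antip(2)[of k "\<lambda>u. \<phi> (tens R H a u)"] that by simp
  show "\<phi> (act Q h (inc r)) = \<phi> (inc (act R h r))"
    unfolding Q_simps by (simp add: sigma_mul mul_sigma H.coassoc H.counit)
qed (simp_all add: Q_simps sigma_mul mul_sigma)

lemma pmul_inc:
  assumes [simp]: "r \<in> carr R" "s \<in> carr R"
  shows "pmul Q (tens Q Q (inc r) (inc s)) = inc (mB (tens R R r s))"
    "split_cocycle B prH (tens Q Q (inc r) (inc s)) = xB (tens R R r s)"
proof -
  show "pmul Q (tens Q Q (inc r) (inc s)) = inc (mB (tens R R r s))"
    unfolding tens_Q by (simp add: Q_simps sw_tens[where U = "tprod R H"] tau mB_def mu_tens)
  show "split_cocycle B prH (tens Q Q (inc r) (inc s)) = xB (tens R R r s)"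
    unfolding tens_Q by (simp add: split_cocycle_def sw_tens[where U = H] xB_def mu_tens)
qed

lemma pmulQ_eq:
  assumes "z \<in> carr (tprod Q Q)"
  shows "pmul Q z = inc (sw (tprod R H) (tprod R H) z (\<lambda>r s. prR (r \<cdot>\<^bsub>B\<^esub> s)))"
  using carr_QQ[OF assms] by (simp add: Q_simps tau)

lemma lin_QQ:
  assumes "lin (tprod (tprod R H) (tprod R H)) U f" shows "lin (tprod Q Q) U f"
  using assms carr_QQ by (simp add: lin_def)

lemma lin_pmulQ: "lin (tprod Q Q) Q (pmul Q)"
proof (rule lin_cong)
  have "lin (tprod (tprod R H) (tprod R H)) R (\<lambda>z. sw (tprod R H) (tprod R H) z (\<lambda>r s. prR (r \<cdot>\<^bsub>B\<^esub> s)))" by simp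
  then show "lin (tprod Q Q) Q (\<lambda>z. inc (sw (tprod R H) (tprod R H) z (\<lambda>r s. prR (r \<cdot>\<^bsub>B\<^esub> s))))"
    by (intro lin_comp[OF lin_incQ] lin_QQ)
qed (simp_all add: pmulQ_eq)

lemma lin_xiQ: "lin (tprod Q Q) H (split_cocycle B prH)"
  by (rule lin_QQ) (simp add: split_cocycle_def)

sublocale TQ: transport H R mB xB u Q inc prR "pmul Q" "split_cocycle B prH"
proof unfold_locales
  fix p q assume [simp]: "p \<in> carr Q" "q \<in> carr Q"
  have r [simp]: "prR q \<in> carr R" "prR p \<in> carr R" using lin_carr[OF lin_prQ] by simp_all
  show "\<Delta>\<^bsub>Q\<^esub> q = sw R R (\<Delta>\<^bsub>R\<^esub> (prR q)) (\<lambda>a b. tens Q Q (inc a) (inc b))"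
    using cop_inc[of "prR q"] by simp
  show "\<rho>\<^bsub>Q\<^esub> q = sw H R (\<rho>\<^bsub>R\<^esub> (prR q)) (\<lambda>k x. tens H Q k (inc x))"
    using coact_inc[of "prR q"] by simp
  show "\<epsilon>\<^bsub>Q\<^esub> q = \<epsilon>\<^bsub>R\<^esub> (prR q)"
    using cou_A_tens[of "prR q" "\<one>\<^bsub>H\<^esub>"] by (simp add: Q_simps(3) del: cou_A_tens)
  show "act Q h q = inc (act R h (prR q))" if "h \<in> carr H" for h
    using act_inc[of "prR q" h] that by simp
  show "pmul Q (tens Q Q p q) = inc (mB (tens R R (prR p) (prR q)))" "split_cocycle B prH (tens Q Q p q) = xB (tens R R (prR p) (prR q))"
    using pmul_inc[of "prR p" "prR q"] by simp_all
qed (simp_all add: lin_incQ lin_prQ lin_pmulQ lin_xiQ del: Q_simps)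

lemma Q_pbc: "pre_bialgebra_cocycle H Q (split_cocycle B prH)"
  by (rule pbc_imp_pre_bialgebra_cocycle) (use TQ.pbc_Q in \<open>simp add: Q_simps(4)\<close>)

section \<open>The coinvariants as \<open>R \<otimes> K\<close> and the canonical
  isomorphism\<close>

lemma vspace_K1: "vspace (K1 H)"
proof -
  interpret V: vector_space "scl H" using H.vsp by (simp add: vspace_def)
  show ?thesis
    using H.vsp by (simp add: vspace_def K1_def V.span_singleton[symmetric])
qed

lemma carr_K1: "carr (K1 H) \<subseteq> carr H" by (auto simp: K1_def)

lemma carr_Q_K1: "carr Q = carr (tprod R (K1 H))"
proof
  have "\<one>\<^bsub>H\<^esub> \<in> carr (K1 H)" unfolding K1_def by (auto intro!: range_eqI[of _ _ 1])
  then have "inc r \<in> carr (tprod R (K1 H))" if "r \<in> carr R" for r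
    using tens_carr[of r R "\<one>\<^bsub>H\<^esub>" "K1 H"] that by (simp add: tens_Q)
  then show "carr Q \<subseteq> carr (tprod R (K1 H))" by (auto simp: carr_Q)
  show "carr (tprod R (K1 H)) \<subseteq> carr Q"
  proof
    fix t assume t: "t \<in> carr (tprod R (K1 H))"
    have "set xs \<subseteq> carr R \<times> carr (K1 H) \<Longrightarrow> (\<Sum>(v, w)\<leftarrow>xs. tens R H v w) \<in> carr Q" for xs
    proof (induction xs)
      case (Cons p xs)
      obtain r c where p: "p = (r, scl H c \<one>\<^bsub>H\<^esub>)" "r \<in> carr R" using Cons.prems by (cases p) (auto simp: K1_def)
      have "tens R H r (scl H c \<one>\<^bsub>H\<^esub>) = inc (scl R c r)" by simp
      moreover have "inc (scl R c r) \<in> carr Q" by (rule inc_Q) (use p in simp)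
      ultimately show ?case using Cons p by (simp del: tens_scl add: vspace_add[OF vspace_Q])
    qed (use vspace_zero[OF vspace_Q] in simp)
    then show "t \<in> carr Q" using sw_list[OF vsp vspace_K1 t] by (metis tens_Q(3))
  qed
qed

text \<open>The defining sum of \<open>theta\<close>, taken over \<open>R \<otimes> K 1\<close>, is
  the restriction of the one defining \<open>prR\<close> over \<open>R \<otimes> H\<close>; hence
  the canonical isomorphism is \<open>prR\<close> on coinvariants, with inverse
  \<open>inc\<close>.\<close>

lemma theta_Q:
  assumes "q \<in> carr Q" shows "sw R (K1 H) q (\<lambda>r h. scl R (\<epsilon>\<^bsub>H\<^esub> h) r) = prR q"
  unfolding prR_def
  by (rule sw_sub[where U = R]) (use assms carr_Q_K1 carr_K1 vspace_K1 in \<open>simp_all add: K1_def\<close>)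

text \<open>\<open>Rg\<close> and \<open>xg\<close> stand for the twisted pre-bialgebra and its
  cocycle. Only their agreement with \<open>mB\<close> and \<open>xB\<close> on the carrier is
  assumed, which separates the transport of structure from the evaluation of the twisted
  product.\<close>

theorem twisted:
  fixes Rg :: "('k, 'h, 'r, 'w) prebialg_scheme"
  assumes Rg [simp]: "carr Rg = carr R" "scl Rg = scl R" "\<Delta>\<^bsub>Rg\<^esub> = \<Delta>\<^bsub>R\<^esub>" "\<epsilon>\<^bsub>Rg\<^esub> = \<epsilon>\<^bsub>R\<^esub>" "act Rg = act R" "\<rho>\<^bsub>Rg\<^esub> = \<rho>\<^bsub>R\<^esub>" "punit Rg = u"
    and pm: "\<And>z. z \<in> carr RR \<Longrightarrow> pmul Rg z = mB z" and xg: "\<And>z. z \<in> carr RR \<Longrightarrow> xg z = xB z"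
    and th: "\<And>q. q \<in> carr Q \<Longrightarrow> th q = prR q"
    and xt: "xt = (\<lambda>z. xg (sw Q Q z (\<lambda>x y. tens R R (th x) (th y))))"
  shows "pre_bialgebra_cocycle H Rg xg" "pbc_iso H Q xt Rg xg th" "\<And>z. z \<in> carr (tprod Q Q) \<Longrightarrow> split_cocycle B prH z = xt z"
proof -
  note n [simp] = sw_vs_cong[OF Rg(1,2)]
  have vRg [simp]: "vspace Rg" by simp
  \<comment> \<open>Transport along the identity: \<open>pmul Rg\<close> and \<open>xg\<close> may
    differ from \<open>mB\<close> and \<open>xB\<close> outside the carrier, so the axioms cannot be
    carried over by substitution.\<close>
  interpret TR: transport H R mB xB u Rg "\<lambda>x. x" "\<lambda>x. x" "pmul Rg" xg
  proof unfold_locales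
    show "lin (tprod Rg Rg) Rg (pmul Rg)" unfolding n by (rule lin_cong[OF lin_mB]) (simp_all add: pm)
    show "lin (tprod Rg Rg) H xg" unfolding n by (rule lin_cong[OF lin_xB]) (simp_all add: xg)
  qed (simp_all add: sw_id pm xg)
  show "pre_bialgebra_cocycle H Rg xg"
    by (rule pbc_imp_pre_bialgebra_cocycle) (use TR.pbc_Q in simp)
  have th_lin: "lin Q R th" by (rule lin_cong[OF lin_prQ th]) simp_all
  have [simp]: "prR q \<in> carr R" if "q \<in> carr Q" for q using lin_carr[OF lin_prQ that] .
  note th_rules [simp] = linD[OF th_lin, unfolded Q_simps(1)]
  \<comment> \<open>\<open>G\<close> is \<open>th \<otimes> th\<close>. Linear in \<open>z\<close>,
    it reduces the compatibility with products and cocycles to pure tensors; its inverse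
    \<open>F\<close> below is \<open>inc \<otimes> inc\<close>.\<close>
  define G where "G = (\<lambda>z. sw Q Q z (\<lambda>x y. tens R R (th x) (th y)))"
  have lin_G: "lin (tprod Q Q) RR G" unfolding G_def by simp
  have G_tens: "G (tens Q Q p q) = tens R R (prR p) (prR q)" if "p \<in> carr Q" "q \<in> carr Q" for p q
    using that unfolding G_def by (simp add: sw_tens[where U = RR]) (simp add: th)
  have mG: "th (pmul Q z) = mB (G z)" if z: "z \<in> carr (tprod Q Q)" for z
  proof (rule tprod_ext[OF vspace_Q vspace_Q vsp _ _ _ z])
    show "lin (tprod Q Q) R (\<lambda>a. th (pmul Q a))" by (rule lin_comp[OF th_lin lin_pmulQ])
    show "lin (tprod Q Q) R (\<lambda>a. mB (G a))" by (rule lin_comp[OF lin_mB lin_G])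
    fix p q assume "p \<in> carr Q" "q \<in> carr Q"
    then show "th (pmul Q (tens Q Q p q)) = mB (G (tens Q Q p q))"
      by (simp add: G_tens th)
  qed
  have xG: "split_cocycle B prH z = xB (G z)" if z: "z \<in> carr (tprod Q Q)" for z
  proof (rule tprod_ext[OF vspace_Q vspace_Q H.vsp _ _ _ z])
    show "lin (tprod Q Q) H (split_cocycle B prH)" by (rule lin_xiQ)
    show "lin (tprod Q Q) H (\<lambda>a. xB (G a))" by (rule lin_comp[OF lin_xB lin_G])
    fix p q assume "p \<in> carr Q" "q \<in> carr Q"
    then show "split_cocycle B prH (tens Q Q p q) = xB (G (tens Q Q p q))"
      by (simp add: G_tens)
  qed
  have xt_eq: "xt z = xB (G z)" if z: "z \<in> carr (tprod Q Q)" for z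
    using xg[OF lin_carr[OF lin_G z]] by (simp add: xt G_def)
  show "split_cocycle B prH z = xt z" if z: "z \<in> carr (tprod Q Q)" for z
    using xG[OF z] xt_eq[OF z] by simp
  show "pbc_iso H Q xt Rg xg th"
    unfolding pbc_iso_def
  proof (intro conjI exI[of _ inc])
    note [simp] = TQ.Q_rules linD[OF TQ.Qc.lin_cop, unfolded scl_tprod] linD[OF lin_incQ, unfolded Q_simps(1)]
    have thi [simp]: "th (inc r) = r" if "r \<in> carr R" for r using that by (simp add: th)
    have "\<rho>\<^bsub>R\<^esub> (th v) = sw H Q (\<rho>\<^bsub>Q\<^esub> v) (\<lambda>g v0. tens H R g (th v0))" if v [simp]: "v \<in> carr Q" for v
    proof (rule eq_by_forms)
      fix \<phi> assume \<phi>: "lin (tprod H R) Kspace \<phi>"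
      note [simp] = linD[OF \<phi>, unfolded scl_tprod scl_Kspace]
      show "\<phi> (\<rho>\<^bsub>R\<^esub> (th v)) = \<phi> (sw H Q (\<rho>\<^bsub>Q\<^esub> v) (\<lambda>g v0. tens H R g (th v0)))"
        by simp (simp add: th lin_expand[OF \<phi>, of "\<rho>\<^bsub>R\<^esub> _"])
    qed (simp_all del: TQ.coactQ)
    moreover have "\<Delta>\<^bsub>R\<^esub> (th v) = sw Q Q (\<Delta>\<^bsub>Q\<^esub> v) (\<lambda>a b. tens R R (th a) (th b))" if v [simp]: "v \<in> carr Q" for v
    proof (rule eq_by_forms)
      fix \<phi> assume \<phi>: "lin (tprod R R) Kspace \<phi>"
      note [simp] = linD[OF \<phi>, unfolded scl_tprod scl_Kspace]
      show "\<phi> (\<Delta>\<^bsub>R\<^esub> (th v)) = \<phi> (sw Q Q (\<Delta>\<^bsub>Q\<^esub> v) (\<lambda>a b. tens R R (th a) (th b)))"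
        by simp (simp add: th lin_expand[OF \<phi>, of "\<Delta>\<^bsub>R\<^esub> _"])
    qed (simp_all del: TQ.copQ)
    moreover have "th (act Q h v) = act R h (th v)" if "h \<in> carr H" "v \<in> carr Q" for h v
      using that by (simp add: th)
    moreover have "th (pmul Q z) = pmul Rg (sw Q Q z (\<lambda>x y. tens R R (th x) (th y)))" "xg (sw Q Q z (\<lambda>x y. tens R R (th x) (th y))) = xt z"
      if z: "z \<in> carr (tprod Q Q)" for z
      using mG[OF z] pm[OF lin_carr[OF lin_G z]] by (simp_all only: G_def xt)
    moreover have "\<epsilon>\<^bsub>R\<^esub> (th v) = \<epsilon>\<^bsub>Q\<^esub> v" if "v \<in> carr Q" for v using that by (simp add: th)
    ultimately show "pbc_hom H Q xt Rg xg th"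
      unfolding pbc_hom_def yd_hom_def coalg_hom_def n Rg Q_simps(4)
      using th_lin thi[OF u_carr] by blast
    define F where "F = (\<lambda>z. sw R R z (\<lambda>r s. tens Q Q (inc r) (inc s)))"
    have lin_F: "lin RR (tprod Q Q) F" unfolding F_def by simp
    have F_tens: "F (tens R R r s) = tens Q Q (inc r) (inc s)" if "r \<in> carr R" "s \<in> carr R" for r s
      using that unfolding F_def by (simp add: sw_tens[where U = "tprod Q Q"])
    have GF: "G (F z) = z" if z: "z \<in> carr RR" for z
      by (rule tprod_ext[OF vsp vsp vspace_tprod[of R R] lin_comp[OF lin_G lin_F] lin_id _ z]) (simp add: F_tens G_tens)
    have FC: "F z \<in> carr (tprod Q Q)" if "z \<in> carr RR" for z by (rule lin_carr[OF lin_F that])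
    have mF: "inc (mB z) = pmul Q (F z)" if z: "z \<in> carr RR" for z
      using mG[OF FC[OF z]] inc_prR[OF lin_carr[OF lin_pmulQ FC[OF z]]] th[OF lin_carr[OF lin_pmulQ FC[OF z]]] by (simp add: GF z)
    have "inc (pmul Rg z) = pmul Q (sw R R z (\<lambda>r s. tens Q Q (inc r) (inc s)))" "xt (sw R R z (\<lambda>r s. tens Q Q (inc r) (inc s))) = xg z"
      if z: "z \<in> carr (tprod R R)" for z
      using mF[OF z] pm[OF z] xt_eq[OF FC[OF z]] xg[OF z] GF[OF z] by (simp_all only: F_def)
    moreover have "\<epsilon>\<^bsub>Q\<^esub> (inc r) = \<epsilon>\<^bsub>R\<^esub> r" if "r \<in> carr R" for r using that by simp
    ultimately show "pbc_hom H Rg xg Q xt inc"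
      unfolding pbc_hom_def yd_hom_def coalg_hom_def n Rg Q_simps(4)
      by (intro conjI ballI) (simp_all only: lin_incQ cop_inc coact_inc act_inc)
  qed (simp_all add: th)
qed

end

section \<open>Assembly of the result for the twisted smash product\<close>

lemma mul_bialg_twist: "x \<cdot>\<^bsub>bialg_twist A \<gamma>\<^esub> y =
     sw A A (\<Delta>\<^bsub>A\<^esub> x) (\<lambda>x1 x'. sw A A (\<Delta>\<^bsub>A\<^esub> x') (\<lambda>x2 x3.
     sw A A (\<Delta>\<^bsub>A\<^esub> y) (\<lambda>y1 y'. sw A A (\<Delta>\<^bsub>A\<^esub> y') (\<lambda>y2 y3.
       scl A (\<gamma> (tens A A x1 y1) * conv_inv (ctens A A) \<gamma> (tens A A x3 y3)) (x2 \<cdot>\<^bsub>A\<^esub> y2)))))"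
  by (simp add: bialg_twist_def cong del: sw_cong)

text \<open>\<open>conv_inv\<close> is a choice operator, so the first conjunct is what makes the
  inverse of \<open>\<gamma>\<^sub>R\<close> in \<open>R\<^sub>\<gamma>\<close> and
  \<open>\<xi>\<^sub>\<gamma>\<close> a genuine inverse. The line \<open>K1 H\<close> inside H
  stands for K, which turns the coinvariants into \<open>R \<otimes> K\<close> as a subspace of
  \<open>R \<otimes> H\<close>.\<close>

theorem theorem4p11:
  fixes H :: "('k::field_char_0, 'h::ab_group_add) hopf"
    and R :: "('k, 'h, 'r::ab_group_add) prebialg"
    and \<xi> :: "('k, 'r, 'r) tensor \<Rightarrow> 'h"
    and A A\<^sub>\<gamma> :: "('k, ('k, 'r, 'h) tensor) bialg"
    and \<sigma> :: "'h \<Rightarrow> ('k, 'r, 'h) tensor"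
    and \<pi> :: "('k, 'r, 'h) tensor \<Rightarrow> 'h"
    and \<gamma> :: "('k, ('k, 'r, 'h) tensor, ('k, 'r, 'h) tensor) tensor \<Rightarrow> 'k"
    and \<gamma>\<^sub>R :: "('k, 'r, 'r) tensor \<Rightarrow> 'k"
    and \<xi>\<^sub>\<gamma> :: "('k, 'r, 'r) tensor \<Rightarrow> 'h"
    and R\<^sub>\<gamma> :: "('k, 'h, 'r) prebialg"
    and Q :: "('k, 'h, ('k, 'r, 'h) tensor) prebialg"
    and \<theta> :: "('k, 'r, 'h) tensor \<Rightarrow> 'r"
    and \<xi>\<^sub>\<theta> :: "('k, ('k, 'r, 'h) tensor, ('k, 'r, 'h) tensor) tensor \<Rightarrow> 'h"
  assumes "hopf_algebra H"
    and "pre_bialgebra_cocycle H R \<xi>"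
    and "A = smash H R \<xi>" and "\<sigma> = smash_sigma H R" and "\<pi> = smash_pi H R"
    and "\<gamma> \<in> Z2 H A \<sigma>"
    and "\<gamma>\<^sub>R = gamma_R H R \<gamma>"
    and "\<xi>\<^sub>\<gamma> = cocycle_twist H R \<xi> \<gamma>\<^sub>R"
    and "A\<^sub>\<gamma> = bialg_twist A \<gamma>"
    and "R\<^sub>\<gamma> = prebialg_twist H R \<gamma>\<^sub>R"
    and "\<theta> = theta H R"
    and "Q = split_prebialg A\<^sub>\<gamma> H \<pi> \<sigma>"
    and "\<xi>\<^sub>\<theta> = (\<lambda>z. \<xi>\<^sub>\<gamma> (sw Q Q z (\<lambda>x y. tens R R (\<theta> x) (\<theta> y))))"
  shows "conv_invertible (ytens H R R) \<gamma>\<^sub>R \<and>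
    (splitting_datum A\<^sub>\<gamma> H \<pi> \<sigma> \<and>
      pre_bialgebra_cocycle H Q (split_cocycle A\<^sub>\<gamma> \<pi>) \<and>
      carr Q = carr (tprod R (K1 H)) \<and>
      (\<forall>z\<in>carr (tprod Q Q). split_cocycle A\<^sub>\<gamma> \<pi> z = \<xi>\<^sub>\<theta> z)) \<and>
    (pre_bialgebra_cocycle H R\<^sub>\<gamma> \<xi>\<^sub>\<gamma> \<and> pbc_iso H Q \<xi>\<^sub>\<theta> R\<^sub>\<gamma> \<xi>\<^sub>\<gamma> \<theta>) \<and>
    bialg_eq A\<^sub>\<gamma> (smash H R\<^sub>\<gamma> \<xi>\<^sub>\<gamma>)"
proof -
  have P: "pbc H R (pmul R) \<xi> (punit R)"
    using assms(1,2) by (rule pre_bialgebra_cocycle_imp_pbc)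
  interpret P: pbc H R "pmul R" \<xi> "punit R" by (rule P)
  interpret PS: pbc_smash H R "pmul R" \<xi> "punit R" A
    by unfold_locales (simp_all add: assms(3) smash_def)
  have \<sigma>: "\<sigma> = (\<lambda>h. tens R H (punit R) h)" by (simp add: assms(4) smash_sigma_def)
  have \<pi>: "\<pi> = PS.prH" by (simp add: assms(5) smash_pi_def PS.prH_def fun_eq_iff)
  \<comment> \<open>The very inverse chosen in \<open>bialg_twist\<close>, so that the product of
    \<open>A\<^sub>\<gamma>\<close> has the required form by definition.\<close>
  define \<gamma>' where "\<gamma>' = conv_inv (ctens A A) \<gamma>"
  have Z: "conv_invertible (ctens A A) \<gamma>"
     "\<forall>x\<in>carr A. \<forall>y\<in>carr A. \<forall>z\<in>carr A.
        sw A A (\<Delta>\<^bsub>A\<^esub> y) (\<lambda>y1 y2. sw A A (\<Delta>\<^bsub>A\<^esub> z) (\<lambda>z1 z2.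
            \<gamma> (tens A A y1 z1) * \<gamma> (tens A A x (y2 \<cdot>\<^bsub>A\<^esub> z2))))
          = sw A A (\<Delta>\<^bsub>A\<^esub> x) (\<lambda>x1 x2. sw A A (\<Delta>\<^bsub>A\<^esub> y) (\<lambda>y1 y2.
            \<gamma> (tens A A x1 y1) * \<gamma> (tens A A (x2 \<cdot>\<^bsub>A\<^esub> y2) z)))"
     "\<forall>x\<in>carr A. \<gamma> (tens A A x \<one>\<^bsub>A\<^esub>) = \<epsilon>\<^bsub>A\<^esub> x \<and> \<gamma> (tens A A \<one>\<^bsub>A\<^esub> x) = \<epsilon>\<^bsub>A\<^esub> x"
     "\<forall>h\<in>carr H. \<forall>h'\<in>carr H. \<forall>a\<in>carr A. \<forall>a'\<in>carr A.
        \<gamma> (tens A A (\<sigma> h \<cdot>\<^bsub>A\<^esub> a) (a' \<cdot>\<^bsub>A\<^esub> \<sigma> h')) = \<epsilon>\<^bsub>H\<^esub> h * \<gamma> (tens A A a a') * \<epsilon>\<^bsub>H\<^esub> h'"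
    using assms(6) unfolding Z2_def by blast+
  obtain \<delta> where \<delta>: "is_conv_inv (ctens A A) \<gamma> \<delta>" and g: "lin (tprod A A) Kspace \<gamma>"
    using Z(1) unfolding conv_invertible_def ctens_norm by blast
  have g': "is_conv_inv (ctens A A) \<gamma> \<gamma>'"
    using someI[of "is_conv_inv (ctens A A) \<gamma>", OF \<delta>] by (simp only: \<gamma>'_def conv_inv_def)
  interpret PT: pbc_twist H R "pmul R" \<xi> "punit R" A \<gamma> \<gamma>' A\<^sub>\<gamma>
  proof (intro pbc_twist.intro twist.intro twist_axioms.intro pbc_twist_axioms.intro)
    show "pbc_smash H R (pmul R) \<xi> (punit R) A" by unfold_locales
    show "bialg A" by unfold_locales (rule PS.bialgebra_A)
    show "lin (tprod A A) Kspace \<gamma>" by (rule g)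
    show "lin (tprod A A) Kspace \<gamma>'" using g' unfolding is_conv_inv_def ctens_norm by blast
    show "sw (tprod A A) (tprod A A) (\<Delta>\<^bsub>ctens A A\<^esub> w) (\<lambda>a b. \<gamma> a * \<gamma>' b) = \<epsilon>\<^bsub>ctens A A\<^esub> w"
      "sw (tprod A A) (tprod A A) (\<Delta>\<^bsub>ctens A A\<^esub> w) (\<lambda>a b. \<gamma>' a * \<gamma> b) = \<epsilon>\<^bsub>ctens A A\<^esub> w" if "w \<in> carr (tprod A A)" for w
      using g' that unfolding is_conv_inv_def conv_def ctens_norm carr_ctens by blast+
    show "x \<cdot>\<^bsub>A\<^sub>\<gamma>\<^esub> y = sw A A (\<Delta>\<^bsub>A\<^esub> x) (\<lambda>x1 x'. sw A A (\<Delta>\<^bsub>A\<^esub> x') (\<lambda>x2 x3.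
        sw A A (\<Delta>\<^bsub>A\<^esub> y) (\<lambda>y1 y'. sw A A (\<Delta>\<^bsub>A\<^esub> y') (\<lambda>y2 y3.
          scl A (\<gamma> (tens A A x1 y1) * \<gamma>' (tens A A x3 y3)) (x2 \<cdot>\<^bsub>A\<^esub> y2)))))" for x y
      by (simp only: assms(9) mul_bialg_twist \<gamma>'_def)
  qed (use Z(2-4) in \<open>simp_all add: \<sigma> assms(9) bialg_twist_def \<gamma>'_def PS.sigma_mul PS.mul_sigma\<close>)
  interpret S: split_smash H R A\<^sub>\<gamma> "punit R" ..
  have gR: "\<gamma>\<^sub>R = PT.gR" by (simp add: assms(7) gamma_R_def PT.gR_def fun_eq_iff)
  have inv: "is_conv_inv (ytens H R R) \<gamma>\<^sub>R PT.gR'"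
    unfolding is_conv_inv_def conv_def ytens_norm carr_ytens gR using PT.lin_gR PT.gR_inv by simp
  then have ci: "conv_invertible (ytens H R R) \<gamma>\<^sub>R"
    unfolding conv_invertible_def ytens_norm using PT.lin_gR(1) by (auto simp: gR)
  define g' where "g' = conv_inv (ytens H R R) \<gamma>\<^sub>R"
  have "is_conv_inv (ytens H R R) \<gamma>\<^sub>R g'"
    using someI[of "is_conv_inv (ytens H R R) \<gamma>\<^sub>R", OF inv] by (simp only: g'_def conv_inv_def)
  \<comment> \<open>The inverse chosen for \<open>\<gamma>\<^sub>R\<close> and the restriction of
    \<open>\<gamma>'\<close> are both convolution inverses over the braided comultiplication;
    uniqueness identifies them, on the carrier only.\<close>
  then have g'_eq: "g' z = PT.gR' z" if "z \<in> carr (tprod R R)" for z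
    using P.SQm.conv_inv_unique[of PT.gR g' PT.gR' z] PT.lin_gR PT.gR_inv that
    unfolding is_conv_inv_def conv_def ytens_norm carr_ytens gR by simp
  have Rg: "carr R\<^sub>\<gamma> = carr R" "scl R\<^sub>\<gamma> = scl R" "\<Delta>\<^bsub>R\<^sub>\<gamma>\<^esub> = \<Delta>\<^bsub>R\<^esub>" "\<epsilon>\<^bsub>R\<^sub>\<gamma>\<^esub> = \<epsilon>\<^bsub>R\<^esub>" "act R\<^sub>\<gamma> = act R" "\<rho>\<^bsub>R\<^sub>\<gamma>\<^esub> = \<rho>\<^bsub>R\<^esub>" "punit R\<^sub>\<gamma> = punit R"
    by (simp_all add: assms(10) prebialg_twist_def Let_def)
  have pm: "pmul R\<^sub>\<gamma> z = PT.BT.mB z" if "z \<in> carr (tprod R R)" for z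
  proof -
    have "pmul R\<^sub>\<gamma> z = sw (tprod R R) (tprod R R) (\<Delta>\<^bsub>ytens H R R\<^esub> z) (\<lambda>z1 z'. sw (tprod R R) (tprod R R) (\<Delta>\<^bsub>ytens H R R\<^esub> z') (\<lambda>z2 z3.
        scl R (PT.gR z1 * g' z3) (pmul R z2)))"
      by (simp add: assms(10) prebialg_twist_def Let_def gR g'_def cong del: sw_cong)
    also have "\<dots> = sw (tprod R R) (tprod R R) (\<Delta>\<^bsub>ytens H R R\<^esub> z) (\<lambda>z1 z'. sw (tprod R R) (tprod R R) (\<Delta>\<^bsub>ytens H R R\<^esub> z') (\<lambda>z2 z3.
        scl R (PT.gR z1 * PT.gR' z3) (pmul R z2)))"
      using that by (simp add: g'_eq)
    finally show ?thesis by (simp only: PT.mB_twist[OF that])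
  qed
  have xg: "\<xi>\<^sub>\<gamma> z = PT.BT.xB z" if "z \<in> carr (tprod R R)" for z
    using that g'_eq PT.xB_twist[OF that]
    by (simp add: assms(8) cocycle_twist_def conv_def Let_def gR g'_def[unfolded gR, symmetric])
  have Q: "Q = S.Q" by (simp only: assms(12) \<pi> \<sigma>)
  have th: "\<theta> q = PS.prR q" if "q \<in> carr S.Q" for q
    using S.theta_Q[OF that] by (simp add: assms(11) theta_def)
  \<comment> \<open>\<open>pm\<close> and \<open>xg\<close> identify the definitions of
    \<open>R\<^sub>\<gamma>\<close> and \<open>\<xi>\<^sub>\<gamma>\<close> with the components of
    the product of \<open>A\<^sub>\<gamma>\<close>, which is all that \<open>S.twisted\<close> asks
    for besides \<open>th\<close>.\<close>
  note tw = S.twisted[OF Rg pm xg th assms(13)[unfolded Q]]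
  have "bialg_eq A\<^sub>\<gamma> (smash H R\<^sub>\<gamma> \<xi>\<^sub>\<gamma>)"
    unfolding bialg_eq_def
  proof (intro conjI ballI)
    note n = sw_vs_cong[OF Rg(1,2)]
    show "carr A\<^sub>\<gamma> = carr (smash H R\<^sub>\<gamma> \<xi>\<^sub>\<gamma>)" "\<one>\<^bsub>A\<^sub>\<gamma>\<^esub> = \<one>\<^bsub>smash H R\<^sub>\<gamma> \<xi>\<^sub>\<gamma>\<^esub>" "scl A\<^sub>\<gamma> = scl (smash H R\<^sub>\<gamma> \<xi>\<^sub>\<gamma>)"
      by (simp_all add: smash_def n Rg PS.unt_A)
    fix x assume "x \<in> carr A\<^sub>\<gamma>"
    then have x: "x \<in> carr (tprod R H)" by simp
    show "\<Delta>\<^bsub>A\<^sub>\<gamma>\<^esub> x = \<Delta>\<^bsub>smash H R\<^sub>\<gamma> \<xi>\<^sub>\<gamma>\<^esub> x" "\<epsilon>\<^bsub>A\<^sub>\<gamma>\<^esub> x = \<epsilon>\<^bsub>smash H R\<^sub>\<gamma> \<xi>\<^sub>\<gamma>\<^esub> x"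
      using PS.cop_A[OF x] PS.cou_A[OF x] by (simp_all add: smash_def n Rg cong del: sw_cong)
    fix y assume "y \<in> carr A\<^sub>\<gamma>"
    then have y: "y \<in> carr (tprod R H)" by simp
    have "x \<cdot>\<^bsub>smash H R\<^sub>\<gamma> \<xi>\<^sub>\<gamma>\<^esub> y = sw R H x (\<lambda>r h. sw R H y (\<lambda>s h'.
        sw H H (\<Delta>\<^bsub>H\<^esub> h) (\<lambda>h1 h2. sw R R (\<Delta>\<^bsub>R\<^esub> r) (\<lambda>r1 r2. sw H R (\<rho>\<^bsub>R\<^esub> r2) (\<lambda>g r20.
          sw R R (\<Delta>\<^bsub>R\<^esub> (act R h1 s)) (\<lambda>s1 s2.
            tens R H (pmul R\<^sub>\<gamma> (tens R R r1 (act R g s1)))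
              (\<xi>\<^sub>\<gamma> (tens R R r20 s2) \<cdot>\<^bsub>H\<^esub> h2 \<cdot>\<^bsub>H\<^esub> h')))))))"
      by (simp add: smash_def n Rg cong del: sw_cong)
    also have "\<dots> = x \<cdot>\<^bsub>A\<^sub>\<gamma>\<^esub> y"
      using x y by (simp add: PT.BT.mul_eq pm xg)
    finally show "x \<cdot>\<^bsub>A\<^sub>\<gamma>\<^esub> y = x \<cdot>\<^bsub>smash H R\<^sub>\<gamma> \<xi>\<^sub>\<gamma>\<^esub> y" ..
  qed
  moreover have "splitting_datum A\<^sub>\<gamma> H \<pi> \<sigma>" using S.splitting by (simp only: \<pi> \<sigma>)
  ultimately show ?thesis
    using ci tw S.Q_pbc S.carr_Q_K1 by (simp only: Q \<pi>) blast
qed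

end
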